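(* Let $n=2k+1\ge3$ be an odd integer. Among Reuleaux polygons with at most $n$ vertices: (a) the regular Reuleaux $n$-gon maximizes the area; (b) the Reuleaux triangle minimizes the area; (c) a Reuleaux polygon which is not a Reuleaux triangle is not a local minimizer for the area. Moreover, any of its vertices can be perturbed, leaving the other unconstrained vertices fixed, in such a way that the area is strictly decreased.
   Context: All constant width shapes have unit width. $B(c)$ denotes the closed disk of radius $1$ centered at $c\in\mathbb{R}^2$. A Reuleaux polygon is a planar constant width shape that is the intersection of finitely many unit disks with pairwise distinct centers; the minimal number $m\ge3$ of disks involved is its number of sides and vertices. This number is odd, and the centers of the disks are exactly the vertices (angular points of the boundary). The regular Reuleaux $m$-gon ($m$ odd) is the intersection of the unit disks centered at the vertices of a regular $m$-gon of unit diameter; the Reuleaux triangle is the case $m=3$. A Reuleaux polygon $R$ with $m$ vertices is a local minimizer for the area if there is $\varepsilon>0$ such that every Reuleaux polygon with $m$ vertices, whose vertices (suitably labelled) are at distance less than $\varepsilon$ from the corresponding vertices of $R$, has area at least that of $R$. Perturbation of a vertex: let $R$ have $m=2l+1\ge5$ vertices $x_0,\dots,x_{m-1}$ labelled counter-clockwise, with $x_0$ the vertex to be perturbed (after relabelling). The arc of $\partial R$ centered at $x_0$ has endpoints $x_l,x_{l+1}$. Given a unit vector $v\in\mathbb{R}^2$ and small $t$, the vertex $x_0$ is moved to $x_0+tv$; the vertices $x_l,x_{l+1}$ are constrained to move to $x_l(t)\in\partial B(x_0+tv)\cap\partial B(x_{m-1})$ and $x_{l+1}(t)\in\partial B(x_0+tv)\cap\partial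 B(x_1)$ (the intersection points depending continuously on $t$ with $x_l(0)=x_l$, $x_{l+1}(0)=x_{l+1}$); all other vertices, called unconstrained, stay fixed. For small $t$, the intersection of the unit disks centered at these $m$ points is again a Reuleaux $m$-gon. The last assertion of (c) means that for each vertex there are perturbations of this type, with arbitrarily small $t$, for which the resulting Reuleaux polygon has area strictly less than that of $R$. *)

theory Defs
  imports "HOL-Analysis.Analysis"
begin

text \<open>The Euclidean plane is represented by the type \<^typ>\<open>complex\<close>; the closed unit disk
  centred at \<open>c\<close> is \<open>cball c 1\<close> and its boundary is \<open>sphere c 1\<close>.\<close>

definition width :: "complex set \<Rightarrow> complex \<Rightarrow> real" where
  "width K u = (SUP x\<in>K. u \<bullet> x) - (INF x\<in>K. u \<bullet> x)"

definition constant_width_shape :: "complex set \<Rightarrow> bool" where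
  "constant_width_shape K \<longleftrightarrow>
     compact K \<and> convex K \<and> K \<noteq> {} \<and> (\<forall>u. norm u = 1 \<longrightarrow> width K u = 1)"

definition disk_intersection :: "complex set \<Rightarrow> complex set" where
  "disk_intersection C = (\<Inter>c\<in>C. cball c 1)"

definition reuleaux_polygon :: "complex set \<Rightarrow> bool" where
  "reuleaux_polygon K \<longleftrightarrow>
     constant_width_shape K \<and> (\<exists>C. finite C \<and> K = disk_intersection C)"

definition sides :: "complex set \<Rightarrow> nat" where
  "sides K = (LEAST m. \<exists>C. finite C \<and> card C = m \<and> K = disk_intersection C)"

text \<open>Angular points of the boundary: the outward unit normal is not unique.\<close>

definition outer_normal :: "complex set \<Rightarrow> complex \<Rightarrow> complex \<Rightarrow> bool" where
  "outer_normal K x u \<longleftrightarrow> norm u = 1 \<and> (\<forall>y\<in>K. u \<bullet> (y - x) \<le> 0)"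

definition vertices :: "complex set \<Rightarrow> complex set" where
  "vertices K = {x \<in> frontier K. \<exists>u v. u \<noteq> v \<and> outer_normal K x u \<and> outer_normal K x v}"

definition area :: "complex set \<Rightarrow> real" where
  "area K = measure lebesgue K"

definition regular_polygon_vertices :: "nat \<Rightarrow> complex set \<Rightarrow> bool" where
  "regular_polygon_vertices m V \<longleftrightarrow>
     (\<exists>c r \<theta>. r > 0 \<and> V = (\<lambda>j. c + of_real r * cis (\<theta> + 2 * pi * real j / real m)) ` {..<m})"

definition regular_reuleaux_polygon :: "nat \<Rightarrow> complex set \<Rightarrow> bool" where
  "regular_reuleaux_polygon m K \<longleftrightarrow>
     (\<exists>V. regular_polygon_vertices m V \<and> diameter (convex hull V) = 1 \<and> K = disk_intersection V)"

abbreviation reuleaux_triangle :: "complex set \<Rightarrow> bool" where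
  "reuleaux_triangle \<equiv> regular_reuleaux_polygon 3"

lemma regular_reuleaux_polygon_exists:
  assumes "m \<ge> 2"
  shows "\<exists>K. regular_reuleaux_polygon m K"
proof -
  define U where "U = (\<lambda>j. cis (2 * pi * real j / real m)) ` {..<m}"
  define d where "d = diameter (convex hull U)"
  have bnd: "bounded (convex hull U)"
    by (simp add: U_def finite_imp_bounded_convex_hull)
  have "1 \<in> U"
    unfolding U_def using assms by (intro image_eqI[of _ _ 0]) auto
  moreover have "cis (2 * pi / real m) \<in> U"
    unfolding U_def using assms by (intro image_eqI[of _ _ 1]) auto
  moreover have "cis (2 * pi / real m) \<noteq> 1"
  proof
    assume *: "cis (2 * pi / real m) = 1"
    have "0 < 2 * pi / real m" "2 * pi / real m \<le> pi"
      using assms by (auto simp: field_simps)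
    then have "cos (2 * pi / real m) < cos 0"
      by (intro cos_monotone_0_pi) auto
    moreover have "cos (2 * pi / real m) = 1"
      using arg_cong[OF *, of Re] by simp
    ultimately show False by simp
  qed
  ultimately have "d > 0"
    unfolding d_def using diameter_bounded_bound[OF bnd, of "cis (2 * pi / real m)" 1]
    by (metis hull_inc order_less_le_trans zero_less_dist_iff)
  define V where "V = (*\<^sub>R) (1/d) ` U"
  have "diameter (convex hull V) = 1"
  proof (rule antisym)
    have hV: "convex hull V = (*\<^sub>R) (1/d) ` (convex hull U)"
      unfolding V_def by (rule convex_hull_scaling)
    show "diameter (convex hull V) \<le> 1"
    proof (rule diameter_le)
      fix x y assume "x \<in> convex hull V" "y \<in> convex hull V"
      then obtain a b where ab: "a \<in> convex hull U" "b \<in> convex hull U"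
        "x = (1/d) *\<^sub>R a" "y = (1/d) *\<^sub>R b" using hV by auto
      then have "dist a b \<le> d" unfolding d_def by (intro diameter_bounded_bound[OF bnd])
      moreover have "norm (x - y) = dist a b / d" using \<open>d > 0\<close>
        unfolding ab dist_norm scaleR_right_diff_distrib[symmetric] norm_scaleR by simp
      ultimately show "norm (x - y) \<le> 1" using \<open>d > 0\<close> by simp
    qed auto
    have bV: "bounded (convex hull V)"
      unfolding hV using bnd by (rule bounded_scaling)
    have "diameter (convex hull U) \<le> d * diameter (convex hull V)"
    proof (rule diameter_le)
      show "convex hull U \<noteq> {} \<or> 0 \<le> d * diameter (convex hull V)"
        using \<open>1 \<in> U\<close> by auto
      fix a b assume "a \<in> convex hull U" "b \<in> convex hull U"
      then have "dist ((1/d) *\<^sub>R a) ((1/d) *\<^sub>R b) \<le> diameter (convex hull V)"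
        by (intro diameter_bounded_bound[OF bV]) (auto simp: hV)
      moreover have "dist ((1/d) *\<^sub>R a) ((1/d) *\<^sub>R b) = norm (a - b) / d" using \<open>d > 0\<close>
        unfolding dist_norm scaleR_right_diff_distrib[symmetric] norm_scaleR by simp
      ultimately show "norm (a - b) \<le> d * diameter (convex hull V)" using \<open>d > 0\<close>
        by (simp add: pos_divide_le_eq mult.commute)
    qed
    then have "d * 1 \<le> d * diameter (convex hull V)" by (simp add: d_def)
    then show "1 \<le> diameter (convex hull V)" using \<open>d > 0\<close> by (rule mult_left_le_imp_le)
  qed
  moreover have "regular_polygon_vertices m V"
    unfolding regular_polygon_vertices_def V_def U_def
    by (rule exI[of _ 0], rule exI[of _ "1/d"], rule exI[of _ 0])
       (use \<open>d > 0\<close> in \<open>auto simp: image_image scaleR_conv_of_real\<close>)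
  ultimately show ?thesis
    unfolding regular_reuleaux_polygon_def by blast
qed

text \<open>Corresponding vertices are matched by a bijection \<open>\<phi>\<close>.\<close>

definition local_area_minimizer :: "complex set \<Rightarrow> bool" where
  "local_area_minimizer R \<longleftrightarrow>
     (\<exists>\<epsilon>>0. \<forall>S \<phi>. reuleaux_polygon S \<longrightarrow> sides S = sides R \<longrightarrow>
        bij_betw \<phi> (vertices R) (vertices S) \<longrightarrow> (\<forall>p\<in>vertices R. dist (\<phi> p) p < \<epsilon>) \<longrightarrow>
        area R \<le> area S)"

text \<open>The vertices are in strictly convex position, so a labelling is counter-clockwise iff every
  triple with increasing indices is positively oriented.\<close>

definition ccw_labelling :: "complex set \<Rightarrow> nat \<Rightarrow> (nat \<Rightarrow> complex) \<Rightarrow> bool" where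
  "ccw_labelling K m x \<longleftrightarrow>
     bij_betw x {..<m} (vertices K) \<and>
     (\<forall>i j k. i < j \<longrightarrow> j < k \<longrightarrow> k < m \<longrightarrow> Im (cnj (x j - x i) * (x k - x i)) > 0)"

text \<open>\<open>vertex_perturbation l x v t y\<close>: the labelled vertices \<open>x\<^sub>0, \<dots>, x\<^sub>m\<^sub>-\<^sub>1\<close> with \<open>m = 2 l + 1\<close> become
  \<open>y\<^sub>0, \<dots>, y\<^sub>m\<^sub>-\<^sub>1\<close> when \<open>x\<^sub>0\<close> moves to \<open>x\<^sub>0 + t v\<close>. The continuous paths \<open>a\<close>, \<open>b\<close> select the
  branches of the intersection points starting at \<open>x\<^sub>l\<close> and \<open>x\<^sub>l\<^sub>+\<^sub>1\<close>; note that \<open>x\<^sub>m\<^sub>-\<^sub>1 = x (2 * l)\<close>.\<close>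

definition vertex_perturbation ::
    "nat \<Rightarrow> (nat \<Rightarrow> complex) \<Rightarrow> complex \<Rightarrow> real \<Rightarrow> (nat \<Rightarrow> complex) \<Rightarrow> bool" where
  "vertex_perturbation l x v t y \<longleftrightarrow>
     (\<exists>a b :: real \<Rightarrow> complex.
        continuous_on (closed_segment 0 t) a \<and> continuous_on (closed_segment 0 t) b \<and>
        a 0 = x l \<and> b 0 = x (l + 1) \<and>
        (\<forall>s\<in>closed_segment 0 t.
           a s \<in> sphere (x 0 + s *\<^sub>R v) 1 \<inter> sphere (x (2 * l)) 1 \<and>
           b s \<in> sphere (x 0 + s *\<^sub>R v) 1 \<inter> sphere (x 1) 1) \<and>
        y = x(0 := x 0 + t *\<^sub>R v, l := a t, l + 1 := b t))"

end

theory Submission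
  imports Defs
begin

text \<open>A Reuleaux polygon is encoded by the closed path of its unit diagonals: the vertices
  \<open>z\<^sub>0, z\<^sub>1, \<dots>\<close> in the order in which the diagonals link them, and the increasing directions
  \<open>\<theta>\<^sub>0 < \<theta>\<^sub>1 < \<dots>\<close> of the diagonals. The area is \<open>\<pi>/2\<close> plus the sum of the cross products
  \<open>z\<^sub>j \<times> z\<^sub>j\<^sub>+\<^sub>1\<close> over one period.

  For (a), projecting the diagonals to their normals turns this sum into
  \<open>- 1/2 \<Sum> tan (\<alpha>\<^sub>j / 2)\<close> minus a quadratic form which is nonnegative by a discrete Wirtinger
  inequality; here \<open>\<alpha>\<^sub>j = \<theta>\<^sub>j\<^sub>+\<^sub>1 - \<theta>\<^sub>j\<close> sum up to \<open>\<pi>\<close>, and \<open>tan\<close> is convex. Part (b) is Chakerian's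
  argument: by the intermediate value theorem a regular hexagon is circumscribed about the
  polygon, which bounds the support function. For (c), two consecutive vertices of the path are moved
  while their neighbours stay fixed. This is a four-bar linkage with three unit bars, and it can move
  so as to decrease the area unless the angles at the two vertices coincide and are at least \<open>\<pi>/3\<close>.
  With at least five vertices three consecutive equal angles are less than \<open>\<pi>/3\<close>.\<close>

text \<open>Directions \<open>t\<close> and \<open>t + pi\<close> are always treated together:
  except for finitely many directions of a half turn, one of the two support points is a vertex and
  the other runs along the unit arc about it. So a half turn is the natural period, and signs
  alternate along the path. In (a) the quadratic form vanishes on translations. A translation is
  therefore used to make its argument zero at the first direction, hence also half a turn later;
  these are the two places where the cotangent in the proof of the Wirtinger inequality is singular.
  In (b) the integrand over a half turn is h on one kind of interval and 1 - h on the other, where h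
  is the support function. What is needed is thus a two-sided bound of h - 1/2, and the hexagon
  gives one because it bounds both h(t) and h(t + \<pi>) = 1 - h(t). In (c) the obstacle is a
  linkage with equal angles: there \<open>cos \<delta>\<close> already has its greatest value 1, and
  it can only follow the motion if it is required to decrease. Each vertex belongs to two such
  linkages, one with either neighbour in the path, and at least one of them can move.\<close>

definition wedge :: "complex \<Rightarrow> complex \<Rightarrow> real" where
  "wedge a b = Re a * Im b - Im a * Re b"

lemma wedge_eq_Im: "wedge a b = Im (cnj a * b)"
  by (simp add: wedge_def)

lemma wedge_diff_right: "wedge a (b - c) = wedge a b - wedge a c"
  by (simp add: wedge_def algebra_simps)

lemma wedge_cis: "wedge (cis a) (cis b) = sin (b - a)"
  by (simp add: wedge_def sin_diff algebra_simps)

lemma inner_cis: "cis a \<bullet> cis b = cos (b - a)"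
  by (simp add: inner_complex_def cos_diff algebra_simps)

text \<open>The Binet-Cauchy identity in the plane. It converts inequalities between support values
  into the sign of a cross product.\<close>

lemma wedge_mult_inner:
  "wedge u v * wedge a b = (u \<bullet> a) * (v \<bullet> b) - (u \<bullet> b) * (v \<bullet> a)"
  by (simp add: wedge_def inner_complex_def algebra_simps)

section \<open>The four-bar linkage\<close>

text \<open>With \<open>s = (\<beta> + \<gamma>) / 2\<close> and \<open>\<delta> = (\<beta> - \<gamma>) / 2\<close> the constraint reads
  \<open>2 (cos \<delta> - cos s) cos s = \<kappa>\<close>, and then the quantity to be increased is \<open>\<kappa> tan s\<close>. So \<open>s\<close> is increased
  and \<open>\<delta>\<close> is solved for; at \<open>\<delta> = 0\<close> this needs the required value \<open>\<psi> s\<close> of \<open>cos \<delta>\<close> to decrease.\<close>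

lemma linkage_angles_ordered:
  fixes \<beta> \<gamma> \<epsilon> :: real
  assumes "0 < \<gamma>" "\<gamma> \<le> \<beta>" "\<beta> + \<gamma> < pi" and neq: "\<beta> \<noteq> \<gamma> \<or> \<beta> < pi / 3" and "\<epsilon> > 0"
  shows "\<exists>\<beta>' \<gamma>'. \<bar>\<beta>' - \<beta>\<bar> < \<epsilon> \<and> \<bar>\<gamma>' - \<gamma>\<bar> < \<epsilon> \<and>
    cos \<beta>' + cos \<gamma>' - cos (\<beta>' + \<gamma>') = cos \<beta> + cos \<gamma> - cos (\<beta> + \<gamma>) \<and>
    sin \<beta>' + sin \<gamma>' - sin (\<beta>' + \<gamma>') > sin \<beta> + sin \<gamma> - sin (\<beta> + \<gamma>)"
proof -
  define s0 where "s0 = (\<beta> + \<gamma>) / 2"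
  define \<delta>0 where "\<delta>0 = (\<beta> - \<gamma>) / 2"
  define \<kappa> where "\<kappa> = 2 * (cos \<delta>0 - cos s0) * cos s0"
  define \<psi> where "\<psi> s = cos s + \<kappa> / (2 * cos s)" for s
  \<comment> \<open>The clamp keeps the argument inside the domain of \<open>arccos\<close>, so
    \<open>D\<close> inherits continuity at \<open>s0\<close>; where \<open>\<psi> s\<close> lies in
    [-1, 1] it does not change the value.\<close>
  define D where "D s = arccos (max (-1) (min 1 (\<psi> s)))" for s
  have s0: "0 < s0" "s0 < pi / 2" and d0: "0 \<le> \<delta>0" "\<delta>0 < s0"
    using assms by (auto simp: s0_def \<delta>0_def)
  have c0: "cos s0 > 0" using s0 by (intro cos_gt_zero) auto
  have cd: "cos \<delta>0 > cos s0" using s0 d0 by (intro cos_monotone_0_pi) auto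
  have \<kappa>: "\<kappa> > 0" using c0 cd by (simp add: \<kappa>_def)
  have \<psi>0: "\<psi> s0 = cos \<delta>0" using c0 by (simp add: \<psi>_def \<kappa>_def field_simps)
  have contp: "isCont \<psi> s0" unfolding \<psi>_def using c0 by (intro continuous_intros) auto
  have D0: "D s0 = \<delta>0"
  proof -
    have "max (-1) (min 1 (cos \<delta>0)) = cos \<delta>0" by simp
    then show ?thesis using d0 s0 unfolding D_def \<psi>0 by (simp add: arccos_cos)
  qed
  have "continuous_on UNIV (\<lambda>x. arccos (max (-1) (min 1 x)))"
    by (intro continuous_intros continuous_on_arccos) auto
  then have "isCont (\<lambda>x. arccos (max (-1) (min 1 x))) (\<psi> s0)"
    by (simp add: continuous_on_eq_continuous_at)
  from isCont_o2[OF contp this] have contD: "isCont D s0" by (simp add: D_def[abs_def])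
  have e1: "\<forall>\<^sub>F s in at_right s0. \<bar>D s - \<delta>0\<bar> < \<epsilon> / 2"
  proof -
    have "(D \<longlongrightarrow> \<delta>0) (at_right s0)"
      using contD D0 by (metis continuous_at_imp_continuous_at_within continuous_within)
    then have "\<forall>\<^sub>F s in at_right s0. dist (D s) \<delta>0 < \<epsilon> / 2"
      using \<open>\<epsilon> > 0\<close> by (intro tendstoD) auto
    then show ?thesis by (simp add: dist_real_def)
  qed
  have tp: "(\<psi> \<longlongrightarrow> cos \<delta>0) (at_right s0)"
    using contp \<psi>0 by (metis continuous_at_imp_continuous_at_within continuous_within)
  have e2: "\<forall>\<^sub>F s in at_right s0. \<psi> s > -1"
    using c0 cd by (intro order_tendstoD(1)[OF tp]) auto
  have e3: "\<forall>\<^sub>F s in at_right s0. \<psi> s \<le> 1"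
  proof (cases "\<delta>0 = 0")
    case False
    then have "cos \<delta>0 < cos 0" using d0 s0 by (intro cos_monotone_0_pi) auto
    then have "\<forall>\<^sub>F s in at_right s0. \<psi> s < 1" by (intro order_tendstoD(2)[OF tp]) auto
    then show ?thesis by eventually_elim auto
  next
    case True
    then have "\<beta> = \<gamma>" by (simp add: \<delta>0_def)
    then have "s0 < pi / 3" using neq by (simp add: s0_def)
    then have "cos s0 > 1 / 2" using cos_monotone_0_pi[of s0 "pi/3"] s0 by (simp add: cos_60)
    \<comment> \<open>For \<open>\<delta>0 = 0\<close> this derivative of \<open>\<psi>\<close> at
      \<open>s0\<close> equals \<open>sin s0 * (1 - 2 * cos s0) / cos s0\<close>. It is negative
      exactly when \<open>cos s0 > 1 / 2\<close>, which is the origin of the bound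
      \<open>pi / 3\<close>.\<close>
    define d where "d = - sin s0 + \<kappa> * sin s0 / (2 * (cos s0)\<^sup>2)"
    have "\<kappa> / (2 * (cos s0)\<^sup>2) = (1 - cos s0) / cos s0"
      using c0 True by (simp add: \<kappa>_def power2_eq_square field_simps)
    also have "\<dots> < 1" using \<open>cos s0 > 1/2\<close> by (simp add: divide_simps)
    finally have "sin s0 * (\<kappa> / (2 * (cos s0)\<^sup>2)) < sin s0 * 1"
      using s0 by (intro mult_strict_left_mono sin_gt_zero) auto
    then have "d < 0" by (simp add: d_def mult.commute)
    moreover have "(\<psi> has_real_derivative
        - sin s0 + (0 * (2 * cos s0) - \<kappa> * (2 * - sin s0)) / (2 * cos s0 * (2 * cos s0))) (at s0)"
      unfolding \<psi>_def using c0 by (intro DERIV_add DERIV_cos DERIV_divide DERIV_const DERIV_cmult) auto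
    then have "(\<psi> has_real_derivative d) (at s0)"
      using c0 by (simp add: d_def power2_eq_square)
    ultimately obtain h where h: "h > 0" "\<And>k. k > 0 \<Longrightarrow> k < h \<Longrightarrow> \<psi> (s0 + k) < \<psi> s0"
      using DERIV_neg_dec_right by blast
    have "\<psi> s \<le> 1" if "s > s0" "s < s0 + h" for s
      using h(2)[of "s - s0"] that \<psi>0 True by simp
    then show ?thesis unfolding eventually_at_right_field using h(1)
      by (intro exI[of _ "s0 + h"]) auto
  qed
  have e4: "\<forall>\<^sub>F s in at_right s0. s < min (pi / 2) (s0 + \<epsilon> / 2)"
    unfolding eventually_at_right_field using s0 \<open>\<epsilon> > 0\<close>
    by (intro exI[of _ "min (pi / 2) (s0 + \<epsilon> / 2)"]) auto
  have e5: "\<forall>\<^sub>F s in at_right s0. s > s0"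
    by (simp add: eventually_at_right_less)
  obtain s where s: "s > s0" "s < pi / 2" "s < s0 + \<epsilon> / 2" "\<psi> s \<le> 1" "\<psi> s > -1" "\<bar>D s - \<delta>0\<bar> < \<epsilon> / 2"
    using eventually_happens'[OF _ eventually_conj[OF e1 eventually_conj[OF e2 eventually_conj[OF e3 eventually_conj[OF e4 e5]]]]]
    by auto
  have cs: "cos s > 0" using s s0 by (intro cos_gt_zero) auto
  have cD: "cos (D s) = \<psi> s" unfolding D_def using s by (simp add: cos_arccos)
  have gain: "sin (x + y) + sin (x - y) - sin (x + y + (x - y)) = 2 * sin x * (cos y - cos x)" 
    and g: "cos (x + y) + cos (x - y) - cos (x + y + (x - y)) = 1 + 2 * cos x * (cos y - cos x)" for x y :: real
  proof -
    have "x + y + (x - y) = 2 * x" by simp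
    then show "sin (x + y) + sin (x - y) - sin (x + y + (x - y)) = 2 * sin x * (cos y - cos x)" 
      and "cos (x + y) + cos (x - y) - cos (x + y + (x - y)) = 1 + 2 * cos x * (cos y - cos x)"
      by (simp_all only: sin_double cos_double_cos sin_add sin_diff cos_add cos_diff) (simp_all add: algebra_simps power2_eq_square)
  qed
  have bg: "\<beta> = s0 + \<delta>0" "\<gamma> = s0 - \<delta>0" by (auto simp: s0_def \<delta>0_def field_simps)
  have g1: "2 * cos s * (cos (D s) - cos s) = \<kappa>" using cs by (simp add: cD \<psi>_def)
  have g0: "2 * cos s0 * (cos \<delta>0 - cos s0) = \<kappa>" by (simp add: \<kappa>_def)
  have "tan s0 < tan s" using s s0 by (intro tan_monotone) auto
  then have "\<kappa> * tan s0 < \<kappa> * tan s" using \<kappa> by simp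
  moreover have "\<kappa> * tan s = 2 * sin s * (cos (D s) - cos s)"
    using cs unfolding g1[symmetric] tan_def by simp
  moreover have "\<kappa> * tan s0 = 2 * sin s0 * (cos \<delta>0 - cos s0)"
    using c0 unfolding g0[symmetric] tan_def by simp
  ultimately have gt: "2 * sin s0 * (cos \<delta>0 - cos s0) < 2 * sin s * (cos (D s) - cos s)" by simp
  show ?thesis
  proof (intro exI conjI)
    show "\<bar>s + D s - \<beta>\<bar> < \<epsilon>" "\<bar>s - D s - \<gamma>\<bar> < \<epsilon>"
      using s unfolding bg by linarith+
    show "cos (s + D s) + cos (s - D s) - cos (s + D s + (s - D s)) = cos \<beta> + cos \<gamma> - cos (\<beta> + \<gamma>)"
      unfolding bg g g1 g0 ..
    show "sin (s + D s) + sin (s - D s) - sin (s + D s + (s - D s)) > sin \<beta> + sin \<gamma> - sin (\<beta> + \<gamma>)"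
      unfolding bg gain by (rule gt)
  qed
qed

lemma linkage_angles:
  fixes \<beta> \<gamma> \<epsilon> :: real
  assumes "0 < \<beta>" "0 < \<gamma>" "\<beta> + \<gamma> < pi" "\<beta> \<noteq> \<gamma> \<or> \<beta> < pi / 3" "\<epsilon> > 0"
  shows "\<exists>\<beta>' \<gamma>'. \<bar>\<beta>' - \<beta>\<bar> < \<epsilon> \<and> \<bar>\<gamma>' - \<gamma>\<bar> < \<epsilon> \<and>
    cos \<beta>' + cos \<gamma>' - cos (\<beta>' + \<gamma>') = cos \<beta> + cos \<gamma> - cos (\<beta> + \<gamma>) \<and>
    sin \<beta>' + sin \<gamma>' - sin (\<beta>' + \<gamma>') > sin \<beta> + sin \<gamma> - sin (\<beta> + \<gamma>)"
proof (cases "\<gamma> \<le> \<beta>")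
  case True
  then show ?thesis using linkage_angles_ordered assms by blast
next
  case False
  then obtain \<beta>' \<gamma>' where "\<bar>\<beta>' - \<gamma>\<bar> < \<epsilon>" "\<bar>\<gamma>' - \<beta>\<bar> < \<epsilon>"
    "cos \<beta>' + cos \<gamma>' - cos (\<beta>' + \<gamma>') = cos \<gamma> + cos \<beta> - cos (\<gamma> + \<beta>)"
    "sin \<beta>' + sin \<gamma>' - sin (\<beta>' + \<gamma>') > sin \<gamma> + sin \<beta> - sin (\<gamma> + \<beta>)"
    using linkage_angles_ordered[of \<beta> \<gamma> \<epsilon>] assms by (auto simp: add.commute)
  then show ?thesis by (intro exI[of _ \<gamma>'] exI[of _ \<beta>']) (auto simp: add.commute)
qed

section \<open>A discrete Wirtinger inequality\<close>

text \<open>The discrete form of \<open>f'\<^sup>2 - f\<^sup>2 - (f\<^sup>2 cot)' = (f' - f cot)\<^sup>2 \<ge> 0\<close>.\<close>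

lemma cot_add_step:
  fixes a b p q :: real
  assumes "sin p > 0" "sin q > 0" "sin (q - p) > 0"
  shows "a\<^sup>2 * (cos p / sin p) + ((a\<^sup>2 + b\<^sup>2) * cos (q - p) - 2 * a * b) / sin (q - p)
    \<ge> b\<^sup>2 * (cos q / sin q)"
proof -
  have 1: "cos p / sin p + cos (q - p) / sin (q - p) = sin q / (sin p * sin (q - p))"
  proof -
    have "sin q = sin (p + (q - p))" by simp
    also have "\<dots> = sin p * cos (q - p) + cos p * sin (q - p)" by (rule sin_add)
    finally show ?thesis using assms by (simp add: field_simps)
  qed
  have 2: "cos (q - p) / sin (q - p) - cos q / sin q = sin p / (sin q * sin (q - p))"
  proof -
    have "sin p = sin (q - (q - p))" by simp
    also have "\<dots> = sin q * cos (q - p) - cos q * sin (q - p)" by (rule sin_diff)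
    finally show ?thesis using assms by (simp add: field_simps)
  qed
  have "a\<^sup>2 * (cos p / sin p) + ((a\<^sup>2 + b\<^sup>2) * cos (q - p) - 2 * a * b) / sin (q - p) - b\<^sup>2 * (cos q / sin q)
    = a\<^sup>2 * (cos p / sin p + cos (q - p) / sin (q - p)) + b\<^sup>2 * (cos (q - p) / sin (q - p) - cos q / sin q)
      - 2 * a * b / sin (q - p)"
    by (simp add: algebra_simps add_divide_distrib diff_divide_distrib)
  also have "\<dots> = (a * sin q - b * sin p)\<^sup>2 / (sin p * sin q * sin (q - p))"
    unfolding 1 2 using assms by (simp add: field_simps power2_eq_square)
  also have "\<dots> \<ge> 0" using assms by simp
  finally show ?thesis by simp
qed

text \<open>The steps telescope against
  \<open>(c j)\<^sup>2 * cot (\<theta> j - \<theta> 0)\<close>. The cotangent is singular at both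
  ends, but \<open>c\<close> vanishes there: the first summand is handled directly, and the last one
  is exactly minus the accumulated cotangent term because all angles add up to
  \<open>pi\<close>.\<close>

lemma discrete_wirtinger:
  fixes c \<theta> :: "nat \<Rightarrow> real"
  assumes inc: "\<And>j. j < m \<Longrightarrow> \<theta> j < \<theta> (Suc j)" and pi: "\<theta> m = \<theta> 0 + pi" and "m \<ge> 2"
    and "c 0 = 0" "c m = 0"
  shows "(\<Sum>j<m. (((c j)\<^sup>2 + (c (Suc j))\<^sup>2) * cos (\<theta> (Suc j) - \<theta> j) - 2 * c j * c (Suc j))
            / sin (\<theta> (Suc j) - \<theta> j)) \<ge> 0" (is "(\<Sum>j<m. ?Q j) \<ge> 0")
proof -
  have less: "\<theta> i < \<theta> j" if "i < j" "j \<le> m" for i j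
    using that
  proof (induction j)
    case (Suc j)
    show ?case
    proof (cases "i = j")
      case True then show ?thesis using inc Suc by simp
    next
      case False
      then show ?thesis using Suc inc[of j] by force
    qed
  qed simp
  have s: "sin (\<theta> k - \<theta> 0) > 0" if "0 < k" "k < m" for k
    using less[of 0 k] less[of k m] that pi by (intro sin_gt_zero) auto
  have sd: "sin (\<theta> (Suc k) - \<theta> k) > 0" if "0 < k" "k < m" for k
  proof -
    have "\<theta> 0 < \<theta> k" "\<theta> (Suc k) \<le> \<theta> m"
      using less[of 0 k] less[of "Suc k" m] that by (cases "Suc k = m"; auto)+
    then show ?thesis using inc[of k] that pi by (intro sin_gt_zero) auto
  qed
  have step: "(\<Sum>j<Suc k. ?Q j) \<ge> (c (Suc k))\<^sup>2 * (cos (\<theta> (Suc k) - \<theta> 0) / sin (\<theta> (Suc k) - \<theta> 0))"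
    if "Suc k < m" for k
    using that
  proof (induction k)
    case 0
    then show ?case using \<open>c 0 = 0\<close> by simp
  next
    case (Suc k)
    have "(c (Suc k))\<^sup>2 * (cos (\<theta> (Suc k) - \<theta> 0) / sin (\<theta> (Suc k) - \<theta> 0)) + ?Q (Suc k)
      \<ge> (c (Suc (Suc k)))\<^sup>2 * (cos (\<theta> (Suc (Suc k)) - \<theta> 0) / sin (\<theta> (Suc (Suc k)) - \<theta> 0))"
      using cot_add_step[where p = "\<theta> (Suc k) - \<theta> 0" and q = "\<theta> (Suc (Suc k)) - \<theta> 0"
          and a = "c (Suc k)" and b = "c (Suc (Suc k))"]
        s[of "Suc k"] s[of "Suc (Suc k)"] sd[of "Suc k"] Suc.prems by simp
    then show ?case using Suc by simp
  qed
  obtain k where k: "m = Suc (Suc k)" using \<open>m \<ge> 2\<close> by (metis add_2_eq_Suc nat_le_iff_add)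
  have a: "\<theta> (Suc (Suc k)) - \<theta> (Suc k) = pi - (\<theta> (Suc k) - \<theta> 0)" using pi k by simp
  have "?Q (Suc k) = - ((c (Suc k))\<^sup>2 * (cos (\<theta> (Suc k) - \<theta> 0) / sin (\<theta> (Suc k) - \<theta> 0)))"
    using \<open>c m = 0\<close> unfolding k a cos_pi_minus sin_pi_minus by simp
  then show ?thesis using step[of k] unfolding k by simp
qed

section \<open>Support points of shapes of constant width\<close>

text \<open>The free lower bound \<open>a\<close> is there because the boundary parametrisation of a
  star polygon is meaningful only from \<open>\<theta> 0\<close> on.\<close>

lemma norm_1_cisE:
  assumes "norm u = 1"
  obtains t where "a \<le> t" "u = cis t"
proof -
  have u: "u = cis (Arg u)" using assms cis_Arg[of u] by (cases "u = 0") (auto simp: sgn_div_norm)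
  obtain k :: nat where k: "real k \<ge> (a - Arg u) / (2 * pi)" using real_arch_simple by blast
  have "u = cis (Arg u + 2 * pi * real k)"
    using u cis_multiple_2pi[of "real k"] by (simp add: cis_mult[symmetric])
  moreover have "a \<le> Arg u + 2 * pi * real k" using k by (simp add: field_simps)
  ultimately show ?thesis using that by blast
qed

lemma cis_add_pi: "cis (t + pi) = - cis t"
  by (simp add: complex_eq_iff)

lemma cis_add_2pi: "cis (t + 2 * pi) = cis t"
  by (simp add: complex_eq_iff)

text \<open>For \<open>\<phi>\<close> between \<open>s\<close> and \<open>t\<close> with
  \<open>t - s < pi\<close> all coefficients are nonnegative, so linear inequalities in the two
  outer directions carry over to \<open>\<phi>\<close>.\<close>

lemma cis_combine:
  "sin (t - s) *\<^sub>R cis \<phi> = sin (t - \<phi>) *\<^sub>R cis s + sin (\<phi> - s) *\<^sub>R cis t"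
proof -
  have "(sin t * cos s - cos t * sin s) * cos p =
        (sin t * cos p - cos t * sin p) * cos s + (sin p * cos s - cos p * sin s) * cos t"
    "(sin t * cos s - cos t * sin s) * sin p =
        (sin t * cos p - cos t * sin p) * sin s + (sin p * cos s - cos p * sin s) * sin t" for p
    by (simp_all add: algebra_simps)
  then show ?thesis by (simp add: complex_eq_iff sin_diff)
qed

lemma unit_eq_of_inner_eq_1:
  fixes u w :: complex
  assumes "norm u = 1" "norm w \<le> 1" "u \<bullet> w = 1"
  shows "w = u"
proof -
  have "(norm (w - u))\<^sup>2 = (norm w)\<^sup>2 + (norm u)\<^sup>2 - 2 * (u \<bullet> w)"
    by (simp add: power2_norm_eq_inner inner_diff algebra_simps inner_commute)
  also have "\<dots> \<le> 0" using assms by (simp add: abs_square_le_1)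
  finally show ?thesis by simp
qed

text \<open>\<open>X t\<close> and \<open>X (t + pi)\<close> are extreme in direction
  \<open>cis t\<close>, so the width is the component along \<open>cis t\<close> of their
  difference, which is \<open>cis t\<close> itself.\<close>

lemma constant_width_shapeI:
  assumes "compact K" "convex K"
    and X: "\<And>t. t \<ge> a \<Longrightarrow> X t \<in> K" "\<And>t y. t \<ge> a \<Longrightarrow> y \<in> K \<Longrightarrow> cis t \<bullet> y \<le> cis t \<bullet> X t"
    and X_pi: "\<And>t. t \<ge> a \<Longrightarrow> X (t + pi) = X t - cis t"
  shows "constant_width_shape K"
  unfolding constant_width_shape_def
proof (intro conjI allI impI)
  show "K \<noteq> {}" using X(1)[of a] by auto
  fix u :: complex assume "norm u = 1"
  then obtain t where t: "t \<ge> a" "u = cis t" by (rule norm_1_cisE)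
  have "(SUP x\<in>K. u \<bullet> x) = u \<bullet> X t"
    by (rule cSup_eq_maximum) (use X t in auto)
  moreover have "(INF x\<in>K. u \<bullet> x) = u \<bullet> X (t + pi)"
  proof (rule cInf_eq_minimum)
    have tp: "t + pi \<ge> a" using t by (simp add: add_increasing2)
    show "u \<bullet> X (t + pi) \<in> (\<bullet>) u ` K" using X(1)[OF tp] by blast
    fix r assume "r \<in> (\<bullet>) u ` K"
    then obtain y where "y \<in> K" "r = u \<bullet> y" by blast
    then show "u \<bullet> X (t + pi) \<le> r" using X(2)[OF tp, of y] t by (simp add: cis_add_pi)
  qed
  ultimately show "width K u = 1"
    unfolding width_def using X_pi[of t] t by (simp add: inner_diff_right inner_cis)
qed (use assms in auto)

text \<open>Well defined for shapes of constant width, which are strictly convex; see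
  \<open>support_ex1\<close>.\<close>

definition support_point :: "complex set \<Rightarrow> real \<Rightarrow> complex" where
  "support_point K t = (THE x. x \<in> K \<and> (\<forall>y\<in>K. cis t \<bullet> y \<le> cis t \<bullet> x))"

locale constant_width =
  fixes K assumes constant_width: "constant_width_shape K"
begin

lemma compact: "compact K" and convex: "convex K" and nonempty: "K \<noteq> {}"
  and width_1: "norm u = 1 \<Longrightarrow> width K u = 1"
  using constant_width by (auto simp: constant_width_shape_def)

lemma bdd: "bdd_above ((\<bullet>) u ` K)" "bdd_below ((\<bullet>) u ` K)"
proof -
  have "bounded ((\<bullet>) u ` K)"
    by (intro compact_imp_bounded compact_continuous_image compact continuous_intros)
  then show "bdd_above ((\<bullet>) u ` K)" "bdd_below ((\<bullet>) u ` K)"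
    by (auto simp: bounded_imp_bdd_above bounded_imp_bdd_below)
qed

lemma inner_diff_le_1: "norm u = 1 \<Longrightarrow> x \<in> K \<Longrightarrow> y \<in> K \<Longrightarrow> u \<bullet> x - u \<bullet> y \<le> 1"
  using width_1[of u] cSUP_upper[OF _ bdd(1), of x u] cINF_lower[OF bdd(2), of y u]
  unfolding width_def by simp

lemma dist_le_1:
  assumes "x \<in> K" "y \<in> K"
  shows "norm (x - y) \<le> 1"
proof (cases "x = y")
  case False
  have "sgn (x - y) \<bullet> (x - y) = norm (x - y)"
    using False by (simp add: sgn_div_norm dot_square_norm power2_eq_square)
  then show ?thesis using inner_diff_le_1[of "sgn (x - y)" x y] assms False
    by (simp add: norm_sgn inner_diff_right)
qed simp

text \<open>The component of \<open>x - z\<close> along \<open>cis t\<close> is the width 1, while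
  the diameter is at most 1; the equality case of Cauchy-Schwarz determines the difference. Fixing
  one of the points makes the other unique.\<close>

lemma support_unique:
  assumes "x \<in> K" "\<And>y. y \<in> K \<Longrightarrow> cis t \<bullet> y \<le> cis t \<bullet> x" "z \<in> K" "\<And>y. y \<in> K \<Longrightarrow> - cis t \<bullet> y \<le> - cis t \<bullet> z"
  shows "x - z = cis t"
proof -
  have "(SUP x\<in>K. cis t \<bullet> x) = cis t \<bullet> x"
    by (rule cSup_eq_maximum) (use assms in auto)
  moreover have "(INF x\<in>K. cis t \<bullet> x) = cis t \<bullet> z"
    by (rule cInf_eq_minimum) (use assms in auto)
  ultimately have "cis t \<bullet> (x - z) = 1" using width_1[of "cis t"] by (simp add: width_def inner_diff_right)
  then show ?thesis using dist_le_1[OF assms(1,3)] by (intro unit_eq_of_inner_eq_1) auto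
qed

lemma support_exists: "\<exists>x\<in>K. \<forall>y\<in>K. u \<bullet> y \<le> u \<bullet> x"
  by (intro continuous_attains_sup compact nonempty continuous_intros)

abbreviation P :: "real \<Rightarrow> complex" where "P \<equiv> support_point K"

lemma support_ex1: "\<exists>!x. x \<in> K \<and> (\<forall>y\<in>K. cis t \<bullet> y \<le> cis t \<bullet> x)"
proof -
  obtain x where "x \<in> K" "\<forall>y\<in>K. cis t \<bullet> y \<le> cis t \<bullet> x" using support_exists by blast
  moreover obtain z where "z \<in> K" "\<forall>y\<in>K. - cis t \<bullet> y \<le> - cis t \<bullet> z" using support_exists by blast
  ultimately show ?thesis using support_unique by (metis diff_eq_eq)
qed

lemma P_in: "P t \<in> K" and P_max: "y \<in> K \<Longrightarrow> cis t \<bullet> y \<le> cis t \<bullet> P t"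
  using theI'[OF support_ex1[of t]] unfolding support_point_def by auto

lemma P_eqI: "x \<in> K \<Longrightarrow> (\<And>y. y \<in> K \<Longrightarrow> cis t \<bullet> y \<le> cis t \<bullet> x) \<Longrightarrow> P t = x"
  using support_ex1[of t] P_in P_max by blast

lemma P_eqI': "x \<in> K \<Longrightarrow> cis t \<bullet> P t \<le> cis t \<bullet> x \<Longrightarrow> P t = x"
  using P_max[of _ t] by (intro P_eqI) (auto intro: order_trans)

lemma P_strict: "x \<in> K \<Longrightarrow> x \<noteq> P t \<Longrightarrow> cis t \<bullet> x < cis t \<bullet> P t"
  using P_eqI'[of x t] by (cases "cis t \<bullet> x < cis t \<bullet> P t") auto

lemma P_pi: "P (t + pi) = P t - cis t"
proof -
  have "- cis t \<bullet> y \<le> - cis t \<bullet> P (t + pi)" if "y \<in> K" for y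
    using P_max[OF that, of "t + pi"] by (simp add: cis_add_pi)
  then have "P t - P (t + pi) = cis t" by (intro support_unique P_in P_max)
  then show ?thesis by (simp add: algebra_simps)
qed

lemma P_2pi: "P (t + 2 * pi) = P t"
proof -
  have "t + pi + pi = t + 2 * pi" by simp
  then show ?thesis using P_pi[of "t + pi"] P_pi[of t] by (simp only: cis_add_pi) simp
qed

text \<open>Uniqueness makes the graph of \<open>P\<close> an intersection of closed conditions, and
  a closed graph over a compact target gives continuity.\<close>

lemma continuous_P: "continuous_on S P"
proof -
  have "continuous_on UNIV P"
  proof (rule continuous_from_closed_graph[OF compact])
    show "P \<in> UNIV \<rightarrow> K" using P_in by auto
    have "(\<lambda>t. (t, P t)) ` UNIV = {tx. snd tx \<in> K} \<inter> (\<Inter>y\<in>K. {tx. cis (fst tx) \<bullet> y \<le> cis (fst tx) \<bullet> snd tx})"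
      using P_in P_max P_eqI by (auto simp: image_iff)
    moreover have "closed {tx :: real \<times> complex. snd tx \<in> K}"
      using continuous_closed_vimage[of K snd] compact_imp_closed[OF compact]
      by (simp add: vimage_def continuous_snd)
    moreover have "closed {tx. cis (fst tx) \<bullet> y \<le> cis (fst tx) \<bullet> (snd tx :: complex)}" for y
      by (intro closed_Collect_le continuous_intros)
    ultimately show "closed ((\<lambda>t. (t, P t)) ` UNIV)" by (simp add: closed_INT closed_Int)
  qed
  then show ?thesis using continuous_on_subset by blast
qed

text \<open>Normal cones are convex, and \<open>t - s < pi\<close> makes \<open>cis \<phi>\<close> a
  nonnegative combination of the outer directions.\<close>

lemma P_between:
  assumes "P s = x" "P t = x" "s \<le> \<phi>" "\<phi> \<le> t" "t - s < pi"
  shows "P \<phi> = x"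
proof (cases "s = t")
  case False
  then have pos: "sin (t - s) > 0" "sin (t - \<phi>) \<ge> 0" "sin (\<phi> - s) \<ge> 0"
    using assms by (auto intro!: sin_gt_zero sin_ge_zero)
  show ?thesis
  proof (rule P_eqI)
    show "x \<in> K" using P_in assms by auto
    fix y assume "y \<in> K"
    have "sin (t - s) * (cis \<phi> \<bullet> (y - x)) = sin (t - \<phi>) * (cis s \<bullet> (y - x)) + sin (\<phi> - s) * (cis t \<bullet> (y - x))"
      using arg_cong[OF cis_combine[of t s \<phi>], of "\<lambda>v. v \<bullet> (y - x)"] by (simp add: inner_add_left)
    also have "\<dots> \<le> 0"
      using P_max[OF \<open>y \<in> K\<close>, of s] P_max[OF \<open>y \<in> K\<close>, of t] assms pos
      by (intro add_nonpos_nonpos mult_nonneg_nonpos) (auto simp: inner_diff_right)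
    finally show "cis \<phi> \<bullet> y \<le> cis \<phi> \<bullet> x" using pos by (simp add: mult_le_0_iff inner_diff_right)
  qed
qed (use assms in auto)

lemma P_neq_pi: "P (t + pi) \<noteq> P t"
  by (simp add: P_pi)

lemma K_eq_halfplanes: "K = {x. \<forall>t\<ge>a. cis t \<bullet> x \<le> cis t \<bullet> P t}"
proof (intro set_eqI iffI)
  fix x assume x: "x \<in> {x. \<forall>t\<ge>a. cis t \<bullet> x \<le> cis t \<bullet> P t}"
  show "x \<in> K"
  proof (rule ccontr)
    assume "x \<notin> K"
    then obtain v b where v: "v \<bullet> x < b" "\<And>y. y \<in> K \<Longrightarrow> b < v \<bullet> y"
      using separating_hyperplane_closed_point[OF convex compact_imp_closed[OF compact]] by blast
    then have "v \<noteq> 0" using P_in[of 0] by force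
    then have "norm (- sgn v) = 1" by (simp add: norm_sgn)
    then obtain t where t: "a \<le> t" "- sgn v = cis t" by (rule norm_1_cisE)
    have "- sgn v \<bullet> x \<le> - sgn v \<bullet> P t" using x t by auto
    then have "v \<bullet> P t \<le> v \<bullet> x" using \<open>v \<noteq> 0\<close> by (simp add: sgn_div_norm)
    then show False using v P_in[of t] by fastforce
  qed
qed (use P_max in auto)

lemma P_frontier: "P t \<in> frontier K"
proof -
  have "P t \<notin> interior K"
  proof
    assume "P t \<in> interior K"
    then obtain e where e: "e > 0" "cball (P t) e \<subseteq> K" by (meson mem_interior_cball)
    have "P t + e *\<^sub>R cis t \<in> K" using e by (auto simp: dist_norm subset_iff)
    from P_max[OF this, of t] show False using e by (simp add: inner_add_right inner_cis)
  qed
  then show ?thesis using P_in closure_subset by (auto simp: frontier_def)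
qed

lemma vertices_eq: "vertices K = {x. \<exists>s t. cis s \<noteq> cis t \<and> P s = x \<and> P t = x}"
proof (intro set_eqI iffI)
  fix x assume "x \<in> vertices K"
  then obtain u v where x: "x \<in> frontier K" and uv: "u \<noteq> v" "outer_normal K x u" "outer_normal K x v"
    by (auto simp: vertices_def)
  then have "x \<in> K" using compact_imp_closed[OF compact] by (metis frontier_subset_closed subsetD)
  moreover obtain s t where st: "u = cis s" "v = cis t"
    using uv norm_1_cisE unfolding outer_normal_def by metis
  moreover have "P s = x" "P t = x"
    using uv \<open>x \<in> K\<close> unfolding st by (auto simp: outer_normal_def inner_diff_right intro!: P_eqI)
  ultimately show "x \<in> {x. \<exists>s t. cis s \<noteq> cis t \<and> P s = x \<and> P t = x}"
    using uv by blast
next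
  fix x assume "x \<in> {x. \<exists>s t. cis s \<noteq> cis t \<and> P s = x \<and> P t = x}"
  then obtain s t where st: "cis s \<noteq> cis t" "P s = x" "P t = x" by blast
  then have "outer_normal K x (cis s)" "outer_normal K x (cis t)"
    using P_max[of _ s] P_max[of _ t] by (auto simp: outer_normal_def inner_diff_right)
  then show "x \<in> vertices K" using st P_frontier[of s] unfolding vertices_def by blast
qed

text \<open>Opposite directions have different support points, so a second normal of
  \<open>x\<close> is less than \<open>pi\<close> away from \<open>a\<close> on one of the two
  sides; convexity of the normal cone fills the gap.\<close>

lemma vertex_interval:
  assumes "x \<in> vertices K" "P a = x"
  obtains \<delta> where "\<delta> > 0" "(\<forall>s\<in>{0..\<delta>}. P (a + s) = x) \<or> (\<forall>s\<in>{0..\<delta>}. P (a - s) = x)"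
proof -
  obtain b where b: "cis b \<noteq> cis a" "P b = x" using assms unfolding vertices_eq by (smt (verit) mem_Collect_eq)
  obtain t where t: "a \<le> t" "cis b = cis t" using norm_1_cisE[of "cis b" a] by auto
  \<comment> \<open>\<open>r\<close> is the second normal reduced to the turn that starts at
    \<open>a\<close>.\<close>
  define k where "k = \<lfloor>(t - a) / (2 * pi)\<rfloor>"
  define r where "r = t - 2 * pi * of_int k"
  have k: "of_int k * (2 * pi) \<le> t - a" "t - a < (of_int k + 1) * (2 * pi)"
    using floor_divide_lower[of "2 * pi" "t - a"] floor_divide_upper[of "2 * pi" "t - a"] by (auto simp: k_def)
  have cr: "cis r = cis b" unfolding r_def t(2)
    using cis_multiple_2pi[of "of_int k"] by (simp add: cis_divide[symmetric] mult_ac)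
  have Pr: "P r = x" using b cr unfolding support_point_def by simp
  have "r \<noteq> a" using cr b by auto
  then have r: "a < r" "r < a + 2 * pi" using k by (auto simp: r_def algebra_simps)
  have "r \<noteq> a + pi" using Pr assms P_neq_pi by metis
  then consider "r < a + pi" | "a + pi < r" by linarith
  then show thesis
  proof cases
    case 1
    show ?thesis
    proof (rule that[of "r - a"])
      have "P (a + s) = x" if "0 \<le> s" "s \<le> r - a" for s
        by (rule P_between[OF \<open>P a = x\<close> Pr]) (use that 1 r in auto)
      then show "(\<forall>s\<in>{0..r - a}. P (a + s) = x) \<or> (\<forall>s\<in>{0..r - a}. P (a - s) = x)" by auto
    qed (use r in auto)
  next
    case 2
    show ?thesis
    proof (rule that[of "a + 2 * pi - r"])
      have "P (r - 2 * pi) = x" using P_2pi[of "r - 2 * pi"] Pr by simp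
      then have "P (a - s) = x" if "0 \<le> s" "s \<le> a + 2 * pi - r" for s
        by (rule P_between[OF _ \<open>P a = x\<close>]) (use that 2 r in auto)
      then show "(\<forall>s\<in>{0..a + 2 * pi - r}. P (a + s) = x) \<or> (\<forall>s\<in>{0..a + 2 * pi - r}. P (a - s) = x)" by auto
    qed (use r in auto)
  qed
qed

lemma vertices_interval_pair:
  assumes "x \<in> vertices K"
  obtains s t where "s < t" "t - s < pi" "\<And>\<phi>. s \<le> \<phi> \<Longrightarrow> \<phi> \<le> t \<Longrightarrow> P \<phi> = x"
proof -
  obtain a where a: "P a = x" using assms unfolding vertices_eq by blast
  from vertex_interval[OF assms a] obtain \<delta> where
    d: "\<delta> > 0" "(\<forall>s\<in>{0..\<delta>}. P (a + s) = x) \<or> (\<forall>s\<in>{0..\<delta>}. P (a - s) = x)" .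
  define e where "e = min \<delta> 1"
  have e: "0 < e" "e \<le> \<delta>" "e < pi" using d pi_gt3 by (auto simp: e_def)
  from d(2) show thesis
  proof
    assume h: "\<forall>s\<in>{0..\<delta>}. P (a + s) = x"
    show thesis
      by (rule that[of a "a + e"]) (use h[rule_format, of "\<phi> - a" for \<phi>] e in auto)
  next
    assume h: "\<forall>s\<in>{0..\<delta>}. P (a - s) = x"
    show thesis
      by (rule that[of "a - e" a]) (use h[rule_format, of "a - \<phi>" for \<phi>] e in auto)
  qed
qed

end

text \<open>In the coordinate that sends \<open>p\<close> to 0 and \<open>r\<close> to 1 both
  intersection points lie on the bisector \<open>Re = 1 / 2\<close>. The sign of the imaginary part
  tells them apart, which later selects a continuous branch.\<close>

lemma unit_circles_intersection:
  fixes p q r :: complex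
  assumes "norm (q - p) = 1" "norm (q - r) = 1" "p \<noteq> r"
  shows "Re ((q - p) / (r - p)) = 1 / 2"
    "(Im ((q - p) / (r - p)))\<^sup>2 = 1 / (norm (r - p))\<^sup>2 - 1 / 4"
proof -
  define w where "w = (q - p) / (r - p)"
  have rp: "norm (r - p) > 0" using assms by simp
  have q: "q - p = w * (r - p)" using assms by (simp add: w_def)
  have "(norm w)\<^sup>2 * (norm (r - p))\<^sup>2 = 1"
    using assms(1) unfolding q by (simp add: norm_mult power_mult_distrib[symmetric])
  then have n1: "(norm w)\<^sup>2 = 1 / (norm (r - p))\<^sup>2" using rp by (simp add: field_simps)
  have "q - r = (w - 1) * (r - p)" using q by (simp add: algebra_simps)
  then have "(norm (w - 1))\<^sup>2 * (norm (r - p))\<^sup>2 = 1"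
    using assms(2) by (simp add: norm_mult power_mult_distrib[symmetric])
  then have n2: "(norm (w - 1))\<^sup>2 = 1 / (norm (r - p))\<^sup>2" using rp by (simp add: field_simps)
  have "(norm w)\<^sup>2 = (norm (w - 1))\<^sup>2" using n1 n2 by simp
  then show re: "Re ((q - p) / (r - p)) = 1 / 2"
    unfolding cmod_power2 w_def[symmetric] by (simp add: power2_eq_square algebra_simps)
  show "(Im ((q - p) / (r - p)))\<^sup>2 = 1 / (norm (r - p))\<^sup>2 - 1 / 4"
    using n1 re unfolding cmod_power2 w_def[symmetric] by (simp add: power_divide)
qed

lemma finite_unit_circles_intersection:
  fixes p r :: complex
  assumes "p \<noteq> r"
  shows "finite (sphere p 1 \<inter> sphere r 1)"
proof -
  define y where "y = sqrt (1 / (norm (r - p))\<^sup>2 - 1 / 4)"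
  have "sphere p 1 \<inter> sphere r 1 \<subseteq> {p + (r - p) * Complex (1/2) y, p + (r - p) * Complex (1/2) (- y)}"
  proof
    fix q assume "q \<in> sphere p 1 \<inter> sphere r 1"
    then have q: "norm (q - p) = 1" "norm (q - r) = 1" by (auto simp: dist_norm norm_minus_commute)
    define w where "w = (q - p) / (r - p)"
    have "Re w = 1 / 2" "(Im w)\<^sup>2 = 1 / (norm (r - p))\<^sup>2 - 1 / 4"
      using unit_circles_intersection[OF q assms] by (simp_all add: w_def)
    moreover from this(2) have "\<bar>Im w\<bar> = y" unfolding y_def using real_sqrt_abs by metis
    ultimately have "w = Complex (1/2) y \<or> w = Complex (1/2) (- y)"
      by (auto simp: complex_eq_iff abs_if split: if_splits)
    moreover have "q = p + (r - p) * w" using assms by (simp add: w_def)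
    ultimately show "q \<in> {p + (r - p) * Complex (1/2) y, p + (r - p) * Complex (1/2) (- y)}" by auto
  qed
  then show ?thesis using finite_subset by blast
qed

lemma inj_on_cis_half_open: "inj_on cis {a..<a + 2 * pi}"
proof -
  have "s = t" if "cis s = cis t" "a \<le> s" "s \<le> t" "t < a + 2 * pi" for s t
  proof -
    have "cos (t - s) = 1" using inner_cis[of s t] inner_cis[of t t] that by simp
    then obtain n :: int where n: "t - s = n * (2 * pi)" using cos_one_2pi_int by auto
    have "real_of_int n * (2 * pi) < 1 * (2 * pi)" "0 \<le> real_of_int n * (2 * pi)"
      using that unfolding n[symmetric] by linarith+
    then have "real_of_int n < 1" "0 \<le> real_of_int n"
      unfolding mult_less_cancel_right zero_le_mult_iff using pi_gt_zero by linarith+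
    then have "n = 0" by linarith
    then show ?thesis using n by simp
  qed
  then show ?thesis by (intro inj_onI) (metis atLeastLessThan_iff linear)
qed

lemma inj_on_cis_interval: "b - a < 2 * pi \<Longrightarrow> inj_on cis {a..b}"
  by (rule inj_on_subset[OF inj_on_cis_half_open[of a]]) auto

section \<open>Vertices of an intersection of finitely many unit disks\<close>

context constant_width
begin

text \<open>While the normal runs through the cone of a vertex \<open>x\<close>, the opposite
  support point runs along a unit arc about \<open>x\<close>. Each of its points lies on the circle
  of some centre; infinitely many share one centre, which must be \<open>x\<close>. For the second
  claim, either a circle through \<open>P t\<close> has outer normal \<open>cis t\<close>, and its
  centre is \<open>P (t + pi)\<close>, or two different circles pass through \<open>P t\<close> and
  provide two normals.\<close>

lemma vertices_subset_centers:
  assumes C: "finite C" "K = disk_intersection C"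
  shows "vertices K \<subseteq> C"
    and "P t \<in> vertices K \<or> P (t + pi) \<in> C"
proof -
  have inK: "x \<in> K \<longleftrightarrow> (\<forall>c\<in>C. norm (x - c) \<le> 1)" for x
    unfolding C(2) disk_intersection_def by (auto simp: dist_norm norm_minus_commute)
  \<comment> \<open>A direction pointing strictly inside every disk whose circle passes through
    \<open>P t\<close> can be followed for a short while without leaving \<open>K\<close>.\<close>
  have push: "\<exists>e>0. P t + e *\<^sub>R v \<in> K"
    if v: "\<And>c. c \<in> C \<Longrightarrow> norm (P t - c) = 1 \<Longrightarrow> v \<bullet> (P t - c) < 0" for v t
  proof -
    have "\<forall>\<^sub>F e in at_right (0::real). norm (P t + e *\<^sub>R v - c) \<le> 1" if "c \<in> C" for c
    proof (cases "norm (P t - c) = 1")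
      case False
      then have "norm (P t - c) < 1" using P_in[of t] inK that by force
      moreover have "((\<lambda>e. norm (P t + e *\<^sub>R v - c)) \<longlongrightarrow> norm (P t + 0 *\<^sub>R v - c)) (at_right 0)"
        by (intro tendsto_intros)
      ultimately have "\<forall>\<^sub>F e in at_right 0. norm (P t + e *\<^sub>R v - c) < 1"
        by (intro order_tendstoD(2)) auto
      then show ?thesis by eventually_elim auto
    next
      case True
      define d where "d = - (v \<bullet> (P t - c))"
      have d: "d > 0" using v[OF that True] by (simp add: d_def)
      have "v \<noteq> 0" using d by (auto simp: d_def)
      have "norm (P t + e *\<^sub>R v - c) \<le> 1" if e: "0 < e" "e < 2 * d / (norm v)\<^sup>2" for e
      proof -
        have "(norm (P t + e *\<^sub>R v - c))\<^sup>2 = (norm (P t - c))\<^sup>2 - e * (2 * d - e * (norm v)\<^sup>2)"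
          by (simp add: power2_norm_eq_inner inner_diff inner_add inner_commute d_def algebra_simps)
        also have "\<dots> \<le> 1" using e \<open>v \<noteq> 0\<close> True by (simp add: field_simps)
        finally show ?thesis by (simp add: abs_square_le_1)
      qed
      then show ?thesis unfolding eventually_at_right_field using d \<open>v \<noteq> 0\<close>
        by (intro exI[of _ "2 * d / (norm v)\<^sup>2"]) auto
    qed
    then have "\<forall>\<^sub>F e in at_right (0::real). \<forall>c\<in>C. norm (P t + e *\<^sub>R v - c) \<le> 1"
      using C(1) by (simp add: eventually_ball_finite)
    moreover have "\<forall>\<^sub>F e in at_right (0::real). e > 0" by (simp add: eventually_at_right_less)
    ultimately have "\<forall>\<^sub>F e in at_right (0::real). e > 0 \<and> P t + e *\<^sub>R v \<in> K"
      by eventually_elim (simp add: inK)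
    then show ?thesis using eventually_happens'[OF trivial_limit_at_right_real] by blast
  qed
  have not_out: "\<not> (\<forall>c\<in>C. norm (P t - c) = 1 \<longrightarrow> v \<bullet> (P t - c) < 0)" if "cis t \<bullet> v > 0" for v t
  proof
    assume "\<forall>c\<in>C. norm (P t - c) = 1 \<longrightarrow> v \<bullet> (P t - c) < 0"
    then obtain e where "e > 0" "P t + e *\<^sub>R v \<in> K" using push by blast
    then show False using P_max[of "P t + e *\<^sub>R v" t] that by (simp add: inner_add_right zero_less_mult_iff mult_le_0_iff)
  qed
  have active: "\<exists>c\<in>C. norm (P t - c) = 1" for t
    using not_out[of t "cis t"] by (auto simp: inner_cis)
  show "vertices K \<subseteq> C"
  proof
    fix x assume "x \<in> vertices K"
    then obtain s t where st: "s < t" "t - s < pi" "\<And>\<phi>. s \<le> \<phi> \<Longrightarrow> \<phi> \<le> t \<Longrightarrow> P \<phi> = x"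
      by (rule vertices_interval_pair) blast
    define Y where "Y = (\<lambda>\<phi>. x - cis \<phi>) ` {s..t}"
    have "inj_on cis {s..t}" using st by (intro inj_on_cis_interval) auto
    then have "inj_on (\<lambda>\<phi>. x - cis \<phi>) {s..t}" unfolding inj_on_def by simp
    then have "infinite Y" unfolding Y_def using st by (simp add: finite_image_iff infinite_Icc)
    have "Y \<subseteq> (\<Union>c\<in>C. sphere x 1 \<inter> sphere c 1)"
    proof
      fix y assume "y \<in> Y"
      then obtain \<phi> where "s \<le> \<phi>" "\<phi> \<le> t" "y = x - cis \<phi>" by (auto simp: Y_def)
      then have "y = P (\<phi> + pi)" "dist x y = 1" using P_pi st by (auto simp: dist_norm)
      then show "y \<in> (\<Union>c\<in>C. sphere x 1 \<inter> sphere c 1)"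
        using active[of "\<phi> + pi"] by (auto simp: dist_norm norm_minus_commute)
    qed
    then have "\<exists>c\<in>C. infinite (sphere x 1 \<inter> sphere c 1)"
      using \<open>infinite Y\<close> C(1) finite_subset by blast
    then obtain c where c: "c \<in> C" "infinite (sphere x 1 \<inter> sphere c 1)" by blast
    then have "x = c" using finite_unit_circles_intersection[of x c] by metis
    then show "x \<in> C" using c by simp
  qed
  show "P t \<in> vertices K \<or> P (t + pi) \<in> C"
  proof (cases "\<exists>c\<in>C. P t - c = cis t")
    case True
    then obtain c where "c \<in> C" "P t - c = cis t" by blast
    moreover from this have "P (t + pi) = c" using P_pi[of t] by (simp add: algebra_simps)
    ultimately show ?thesis by simp
  next
    case False
    obtain c where c: "c \<in> C" "norm (P t - c) = 1" using active by blast
    have ne: "P t - c \<noteq> cis t" using c False by auto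
    have lt: "cis t \<bullet> w < 1" if "norm w = 1" "w \<noteq> cis t" for w
    proof -
      have "cis t \<bullet> w \<noteq> 1" using unit_eq_of_inner_eq_1[of "cis t" w] that by auto
      moreover have "cis t \<bullet> w \<le> 1" using norm_cauchy_schwarz[of "cis t" w] that by simp
      ultimately show ?thesis by simp
    qed
    \<comment> \<open>If only one circle passed through \<open>P t\<close>, the direction
      \<open>cis t - (P t - c)\<close> would point strictly into its disk and yet increase the
      component along \<open>cis t\<close>.\<close>
    have "\<exists>c'\<in>C. norm (P t - c') = 1 \<and> P t - c' \<noteq> P t - c"
    proof (rule ccontr)
      assume h: "\<not> ?thesis"
      have "\<not> (\<forall>c'\<in>C. norm (P t - c') = 1 \<longrightarrow> (cis t - (P t - c)) \<bullet> (P t - c') < 0)"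
        using lt[OF c(2) ne] by (intro not_out) (simp add: inner_diff_right inner_cis)
      then obtain c' where c': "c' \<in> C" "norm (P t - c') = 1" "\<not> (cis t - (P t - c)) \<bullet> (P t - c') < 0" by blast
      then have "P t - c' = P t - c" using h by blast
      moreover have "(P t - c) \<bullet> (P t - c) = 1" using c(2) by (simp add: dot_square_norm)
      ultimately show False using c'(3) lt[OF c(2) ne] by (simp add: inner_diff_left)
    qed
    then obtain c' where c': "c' \<in> C" "norm (P t - c') = 1" "P t - c' \<noteq> P t - c" by blast
    obtain a b where ab: "P t - c = cis a" "P t - c' = cis b" using c c' norm_1_cisE by metis
    have "P a = P t" if "c \<in> C" "P t - c = cis a" for c a
    proof (rule P_eqI[OF P_in])
      fix y assume "y \<in> K"
      then have "norm (y - c) \<le> 1" using inK that by blast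
      then have "cis a \<bullet> (y - c) \<le> 1" using norm_cauchy_schwarz[of "cis a" "y - c"] by simp
      moreover have "cis a \<bullet> (P t - c) = 1" using that by (simp add: inner_cis)
      ultimately show "cis a \<bullet> y \<le> cis a \<bullet> P t" by (simp add: inner_diff_right)
    qed
    then have "P a = P t" "P b = P t" using ab c c' by blast+
    moreover have "cis a \<noteq> cis b" using ab c' by metis
    ultimately show ?thesis unfolding vertices_eq by blast
  qed
qed

text \<open>The directions violating this form an open set. On an interval inside it
  \<open>P (s + pi)\<close> takes values in the finite set \<open>C\<close>, so by continuity it is
  constant; but a point with an interval of normals is a vertex.\<close>

lemma support_or_opposite_vertex:
  assumes C: "finite C" "K = disk_intersection C"
  shows "P t \<in> vertices K \<or> P (t + pi) \<in> vertices K"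
proof (rule ccontr)
  assume neg: "\<not> ?thesis"
  define B where "B = {s. P s \<notin> vertices K \<and> P (s + pi) \<notin> vertices K}"
  have finV: "finite (vertices K)" using vertices_subset_centers(1)[OF C] C(1) finite_subset by blast
  have cl: "closed ((\<lambda>s. P (s + d)) -` vertices K)" for d
    using finV by (intro closed_vimage finite_imp_closed continuous_on_compose2[OF continuous_P[of UNIV]] continuous_intros) auto
  have "B = - (((\<lambda>s. P (s + 0)) -` vertices K) \<union> ((\<lambda>s. P (s + pi)) -` vertices K))" by (auto simp: B_def)
  then have "open B" using cl[of 0] cl[of pi] by (simp only: open_Compl closed_Un)
  moreover have tB: "t \<in> B" using neg by (simp add: B_def)
  ultimately obtain e where e: "e > 0" "ball t e \<subseteq> B" by (meson openE)
  define d where "d = min (e / 2) 1"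
  have d: "d > 0" "d < e" "d \<le> 1" using e by (auto simp: d_def)
  have sub: "{t..t+d} \<subseteq> B" using e d by (auto simp: dist_real_def subset_iff)
  have "(\<lambda>s. P (s + pi)) constant_on {t..t+d}"
  proof (rule continuous_finite_range_constant)
    show "continuous_on {t..t + d} (\<lambda>s. P (s + pi))"
      by (intro continuous_on_compose2[OF continuous_P[of UNIV]] continuous_intros) auto
    show "finite ((\<lambda>s. P (s + pi)) ` {t..t + d})"
    proof (rule finite_subset[OF _ C(1)], rule image_subsetI)
      fix s assume "s \<in> {t..t + d}"
      then have "P s \<notin> vertices K" using sub unfolding B_def by blast
      then show "P (s + pi) \<in> C" using vertices_subset_centers(2)[OF C, of s] by blast
    qed
  qed simp
  then have "P (t + pi) = P (t + d + pi)" unfolding constant_on_def using d by auto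
  moreover have "cis (t + pi) \<noteq> cis (t + d + pi)"
    using inj_onD[OF inj_on_cis_half_open[of "t + pi"], of "t + pi" "t + d + pi"] d pi_gt3 by auto
  ultimately have "P (t + pi) \<in> vertices K"
    unfolding vertices_eq by (intro CollectI exI[of _ "t + pi"] exI[of _ "t + d + pi"]) simp
  then show False using tB by (simp add: B_def)
qed

end

section \<open>Star polygons\<close>

text \<open>By Binet-Cauchy the cross product has the sign of \<open>p * q - p' * q'\<close> with
  \<open>p' < p\<close> and \<open>q' < q\<close>. Only two negative values \<open>p'\<close>,
  \<open>q'\<close> can spoil positivity.\<close>

lemma wedge_pos_or_opposed:
  assumes "0 < sin (r - t)" "cis t \<bullet> a < cis t \<bullet> b" "cis t \<bullet> c < cis t \<bullet> b"
    "cis r \<bullet> a < cis r \<bullet> c" "cis r \<bullet> b < cis r \<bullet> c"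
  shows "wedge (b - a) (c - a) > 0 \<or> (cis t \<bullet> c < cis t \<bullet> a \<and> cis r \<bullet> b < cis r \<bullet> a)"
proof (rule ccontr)
  assume h: "\<not> ?thesis"
  define p where "p = cis t \<bullet> (b - a)"
  define q where "q = cis r \<bullet> (c - a)"
  define p' where "p' = cis t \<bullet> (c - a)"
  define q' where "q' = cis r \<bullet> (b - a)"
  have pq: "p > 0" "q > 0" "p' < p" "q' < q" "p' \<ge> 0 \<or> q' \<ge> 0"
    using assms h by (auto simp: p_def q_def p'_def q'_def inner_diff_right)
  have "sin (r - t) * wedge (b - a) (c - a) = p * q - p' * q'"
    using wedge_mult_inner[of "cis t" "cis r" "b - a" "c - a"]
    by (simp add: wedge_cis p_def q_def p'_def q'_def)
  moreover have "p' * q' < p * q"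
  proof (cases "p' \<ge> 0 \<and> q' \<ge> 0")
    case True
    then show ?thesis using pq by (intro mult_strict_mono) auto
  next
    case False
    then have "p' * q' \<le> 0" using pq by (auto simp: mult_le_0_iff)
    also have "0 < p * q" using pq by simp
    finally show ?thesis .
  qed
  ultimately have "0 < sin (r - t) * wedge (b - a) (c - a)" by linarith
  then have "wedge (b - a) (c - a) > 0" using assms(1) unfolding zero_less_mult_iff by linarith
  then show False using h by simp
qed

text \<open>At most one of the three gaps between the directions reaches \<open>pi\<close>, so two
  adjacent gaps have positive sine. The exceptional cases of \<open>wedge_pos_or_opposed\<close> for
  these two contradict each other in the direction they share.\<close>

lemma wedge_pos_of_strict_supports:
  assumes "s < t" "t < r" "r < s + 2 * pi"
    and a: "cis s \<bullet> b < cis s \<bullet> a" "cis s \<bullet> c < cis s \<bullet> a"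
    and b: "cis t \<bullet> a < cis t \<bullet> b" "cis t \<bullet> c < cis t \<bullet> b"
    and c: "cis r \<bullet> a < cis r \<bullet> c" "cis r \<bullet> b < cis r \<bullet> c"
  shows "wedge (b - a) (c - a) > 0"
proof -
  have cyc: "wedge (c - b) (a - b) = wedge (b - a) (c - a)" "wedge (a - c) (b - c) = wedge (b - a) (c - a)"
    by (simp_all add: wedge_def algebra_simps)
  have gaps: "0 < sin (t - s) \<and> 0 < sin (r - t) \<or> 0 < sin (r - t) \<and> 0 < sin (s - r) \<or> 0 < sin (s - r) \<and> 0 < sin (t - s)"
  proof -
    have "sin (s - r) > 0" if "s + 2 * pi - r < pi"
    proof -
      have "sin (s - r) = sin (s + 2 * pi - r)" by (metis add.commute add_diff_eq sin_periodic diff_add_eq)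
      also have "\<dots> > 0" using that assms by (intro sin_gt_zero) auto
      finally show ?thesis .
    qed
    moreover have "sin (t - s) > 0" if "t - s < pi" using that assms by (intro sin_gt_zero) auto
    moreover have "sin (r - t) > 0" if "r - t < pi" using that assms by (intro sin_gt_zero) auto
    ultimately show ?thesis using assms(1-3) by linarith
  qed
  show ?thesis
    using gaps wedge_pos_or_opposed[OF _ b c] wedge_pos_or_opposed[OF _ c(2,1) a] wedge_pos_or_opposed[OF _ a(2,1) b(2,1)]
    by (metis cyc less_asym)
qed

text \<open>The vertices in counter-clockwise order along the boundary are \<open>z\<^sub>0, z\<^sub>2, z\<^sub>4, \<dots>\<close>, with indices
  modulo the odd number \<open>m\<close>. The normal cone of \<open>z\<^sub>j\<close> is spanned by the directions \<open>\<theta>\<^sub>j, \<theta>\<^sub>j\<^sub>+\<^sub>1\<close> for even \<open>j\<close>,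
  and by their opposites for odd \<open>j\<close>.\<close>

locale star_polygon =
  fixes m :: nat and \<theta> :: "nat \<Rightarrow> real" and z :: "nat \<Rightarrow> complex"
  assumes odd_m: "odd m"
    and \<theta>_Suc: "\<theta> j < \<theta> (Suc j)"
    and \<theta>_period: "\<theta> (j + m) = \<theta> j + pi"
    and z_Suc: "z (Suc j) = (if even j then z j - cis (\<theta> (Suc j)) else z j + cis (\<theta> (Suc j)))"
    and z_period: "z (j + m) = z j"
begin

lemma \<theta>_less: "i < j \<Longrightarrow> \<theta> i < \<theta> j"
  by (rule lift_Suc_mono_less[of \<theta>, OF \<theta>_Suc])

lemma \<theta>_le: "i \<le> j \<Longrightarrow> \<theta> i \<le> \<theta> j"
  using \<theta>_less[of i j] by (cases "i = j") auto

lemma m_ge_3: "m \<ge> 3"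
proof -
  have "m \<noteq> 1" using z_period[of 0] z_Suc[of 0] by auto
  moreover have "m \<noteq> 0" "m \<noteq> 2" using odd_m even_numeral by (metis even_zero, metis)
  ultimately show ?thesis by linarith
qed

lemma \<theta>_2period: "\<theta> (j + 2 * m) = \<theta> j + 2 * pi"
proof -
  have e: "j + 2 * m = j + m + m" by simp
  show ?thesis unfolding e using \<theta>_period[of "j + m"] \<theta>_period[of j] by simp
qed

lemma z_2period: "z (j + 2 * m) = z j"
proof -
  have "j + 2 * m = j + m + m" by simp
  then show ?thesis using z_period[of "j + m"] z_period[of j] by (simp only:)
qed

lemma z_mod: "z (j mod m) = z j"
proof -
  have "z (j + k * m) = z j" for j k
    by (induction k) (use z_period[of "j + k * m" for k] in \<open>simp_all add: algebra_simps\<close>)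
  from this[of "j mod m" "j div m"] show ?thesis by simp
qed

lemma z_in: "z j \<in> z ` {..<m}"
  using z_mod[of j] m_ge_3 by (intro image_eqI[of _ _ "j mod m"]) auto

lemma \<theta>_Suc_le_pi: "\<theta> (Suc j) < \<theta> j + pi"
  using \<theta>_less[of "Suc j" "j + m"] m_ge_3 \<theta>_period[of j] by simp

lemma \<theta>_unbounded: "\<exists>n. t < \<theta> n"
proof -
  have "\<theta> (k * m) = \<theta> 0 + real k * pi" for k
    by (induction k) (use \<theta>_period[of "k * m" for k] in \<open>simp_all add: algebra_simps\<close>)
  moreover obtain k where "(t - \<theta> 0) / pi < real k" using reals_Archimedean2 by blast
  then have "t < \<theta> 0 + real k * pi" by (simp add: field_simps)
  ultimately show ?thesis by metis
qed

text \<open>The intervals are closed on the left. For \<open>t < \<theta> 0\<close> the value is 0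
  by default, hence the recurring hypothesis \<open>\<theta> 0 \<le> t\<close>.\<close>

definition idx :: "real \<Rightarrow> nat" where "idx t = (LEAST j. t < \<theta> (Suc j))"

lemma idx_bounds:
  assumes "\<theta> 0 \<le> t"
  shows "\<theta> (idx t) \<le> t" "t < \<theta> (Suc (idx t))"
proof -
  obtain n where "t < \<theta> n" using \<theta>_unbounded by blast
  then have "t < \<theta> (Suc n)" using \<theta>_Suc[of n] by simp
  then show u: "t < \<theta> (Suc (idx t))" unfolding idx_def by (rule LeastI)
  show "\<theta> (idx t) \<le> t"
  proof (cases "idx t")
    case (Suc k)
    then show ?thesis using not_less_Least[of k "\<lambda>j. t < \<theta> (Suc j)"] by (simp add: idx_def)
  qed (use assms in simp)
qed

lemma idx_eq: "\<theta> j \<le> t \<Longrightarrow> t < \<theta> (Suc j) \<Longrightarrow> idx t = j"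
  unfolding idx_def
proof (rule Least_equality)
  fix i assume "\<theta> j \<le> t" "t < \<theta> (Suc i)"
  then have "\<not> Suc i \<le> j" using \<theta>_le[of "Suc i" j] by linarith
  then show "j \<le> i" by simp
qed

text \<open>\<open>X t\<close> is the boundary point with outer normal \<open>cis t\<close>, and \<open>\<rho> t\<close> is the radius of curvature there.
  Both are meaningful only for \<open>t \<ge> \<theta> 0\<close>.\<close>

definition X :: "real \<Rightarrow> complex" where
  "X t = (if even (idx t) then z (idx t) else z (idx t) + cis t)"

definition \<rho> :: "real \<Rightarrow> real" where
  "\<rho> t = (if even (idx t) then 0 else 1)"

text \<open>The right end is included because there the formulas for \<open>j\<close> and
  \<open>Suc j\<close> agree by \<open>z_Suc\<close>; this is what makes \<open>X\<close>
  continuous.\<close>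

lemma X_piece: "\<theta> j \<le> t \<Longrightarrow> t \<le> \<theta> (Suc j) \<Longrightarrow> X t = (if even j then z j else z j + cis t)"
proof (cases "t = \<theta> (Suc j)")
  case True
  then have "idx t = Suc j" using \<theta>_Suc by (intro idx_eq) auto
  then show ?thesis using True by (simp add: X_def z_Suc)
qed (simp add: X_def idx_eq)

lemma X_even: "even j \<Longrightarrow> X (\<theta> j) = z j" "even j \<Longrightarrow> X (\<theta> (Suc j)) = z j"
  using X_piece[of j "\<theta> j"] X_piece[of j "\<theta> (Suc j)"] \<theta>_Suc[of j] by auto

lemma idx_pi: "\<theta> 0 \<le> t \<Longrightarrow> idx (t + pi) = idx t + m"
  using idx_bounds[of t] \<theta>_period[of "idx t"] \<theta>_period[of "Suc (idx t)"] by (intro idx_eq) auto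

lemma X_pi: "\<theta> 0 \<le> t \<Longrightarrow> X (t + pi) = X t - cis t"
  using odd_m by (simp add: X_def idx_pi z_period cis_add_pi)

lemma \<rho>_pi: "\<theta> 0 \<le> t \<Longrightarrow> \<rho> (t + pi) = 1 - \<rho> t"
  using odd_m by (simp add: \<rho>_def idx_pi)

lemma \<rho>_bounds: "0 \<le> \<rho> t" "\<rho> t \<le> 1"
  by (simp_all add: \<rho>_def)

lemma X_2pi: "\<theta> 0 \<le> t \<Longrightarrow> X (t + 2 * pi * real n) = X t"
proof (induction n)
  case (Suc n)
  have "X (t + 2 * pi * real (Suc n)) = X (t + 2 * pi * real n + pi + pi)" by (simp add: algebra_simps)
  also have "\<dots> = X (t + 2 * pi * real n)"
    using Suc.prems by (subst X_pi; (subst X_pi)?) (simp_all add: cis_add_pi add_increasing2)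
  finally show ?case using Suc by simp
qed simp

lemma continuous_X:
  assumes "\<theta> 0 \<le> a"
  shows "continuous_on {a..b} X"
proof -
  have piece: "continuous_on {\<theta> j..\<theta> (Suc j)} X" for j
  proof -
    have "continuous_on {\<theta> j..\<theta> (Suc j)} (\<lambda>t. if even j then z j else z j + cis t)"
      by (cases "even j") (auto intro!: continuous_intros)
    then show ?thesis by (rule continuous_on_eq) (auto simp: X_piece[of j])
  qed
  have "continuous_on {\<theta> 0..\<theta> n} X" for n
  proof (induction n)
    case (Suc n)
    have "{\<theta> 0..\<theta> (Suc n)} = {\<theta> 0..\<theta> n} \<union> {\<theta> n..\<theta> (Suc n)}"
      using \<theta>_le[of 0 n] \<theta>_Suc[of n] by auto
    then show ?case using continuous_on_closed_Un[OF _ _ Suc piece[of n]] by simp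
  qed simp
  moreover obtain n where "b < \<theta> n" using \<theta>_unbounded by blast
  ultimately show ?thesis using assms continuous_on_subset[of "{\<theta> 0..\<theta> n}" X "{a..b}"] by auto
qed

lemma X_deriv:
  assumes "\<theta> 0 \<le> t" "t \<noteq> \<theta> (idx t)"
  shows "(X has_vector_derivative \<rho> t *\<^sub>R (\<i> * cis t)) (at t)"
proof -
  define j where "j = idx t"
  have t: "t \<in> {\<theta> j<..<\<theta> (Suc j)}" using idx_bounds[OF assms(1)] assms(2) by (auto simp: j_def)
  have cis: "(cis has_vector_derivative \<i> * cis t) (at t)"
    unfolding cis_conv_exp[abs_def]
    by (rule has_vector_derivative_real_field[where f = "\<lambda>w. exp (\<i> * w)"]) (auto intro!: derivative_eq_intros)
  have "((\<lambda>t. if even j then z j else z j + cis t) has_vector_derivative \<rho> t *\<^sub>R (\<i> * cis t)) (at t)"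
    by (cases "even j") (auto simp: \<rho>_def j_def[symmetric] intro!: derivative_eq_intros cis)
  then show ?thesis
    by (rule has_vector_derivative_transform_within_open[OF _ open_greaterThanLessThan t]) (simp add: X_piece[of j])
qed

lemma finite_switching: "finite {t \<in> {a..b}. \<theta> 0 \<le> t \<and> t = \<theta> (idx t)}"
proof -
  obtain n where n: "b < \<theta> n" using \<theta>_unbounded by blast
  have "idx t < n" if "t \<le> b" "t = \<theta> (idx t)" for t
    using that n \<theta>_le[of n "idx t"] by (cases "idx t < n") auto
  then have "{t \<in> {a..b}. \<theta> 0 \<le> t \<and> t = \<theta> (idx t)} \<subseteq> \<theta> ` {..<n}" by auto
  then show ?thesis using finite_subset by blast
qed

lemma X_integral:
  assumes "\<theta> 0 \<le> a" "a \<le> b"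
  shows "((\<lambda>t. \<rho> t *\<^sub>R (\<i> * cis t)) has_integral X b - X a) {a..b}"
proof (rule fundamental_theorem_of_calculus_strong[OF finite_switching[of a b] assms(2)])
  show "continuous_on {a..b} X" by (rule continuous_X[OF assms(1)])
qed (use assms X_deriv in auto)

lemma X_inner_integral:
  assumes "\<theta> 0 \<le> a" "a \<le> b"
  shows "((\<lambda>t. \<rho> t * (cis t \<bullet> w)) has_integral wedge w (X b - X a)) {a..b}"
proof -
  have "bounded_linear (\<lambda>v. v \<bullet> (\<i> * w))" by (rule bounded_linear_inner_left)
  from has_integral_linear[OF X_integral[OF assms] this]
  show ?thesis by (simp add: o_def wedge_def inner_complex_def algebra_simps)
qed

text \<open>The derivative of \<open>cis \<phi> \<bullet> X r\<close> in \<open>r\<close> is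
  \<open>- \<rho> r * sin (r - \<phi>)\<close>, which is nonpositive on the half turn after
  \<open>\<phi>\<close>.\<close>

lemma X_inner_antimono:
  assumes "\<theta> 0 \<le> \<phi>" "\<phi> \<le> s" "s \<le> t" "t \<le> \<phi> + pi"
  shows "cis \<phi> \<bullet> X t \<le> cis \<phi> \<bullet> X s"
proof -
  have "((\<lambda>r. \<rho> r * (cis r \<bullet> (\<i> * cis \<phi>))) has_integral wedge (\<i> * cis \<phi>) (X t - X s)) {s..t}"
    using assms by (intro X_inner_integral) auto
  moreover have "0 \<le> \<rho> r * (cis r \<bullet> (\<i> * cis \<phi>))" if "r \<in> {s..t}" for r
  proof -
    have "cis r \<bullet> (\<i> * cis \<phi>) = sin (r - \<phi>)" by (simp add: inner_complex_def sin_diff algebra_simps)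
    then show ?thesis using that assms \<rho>_bounds by (auto intro!: mult_nonneg_nonneg sin_ge_zero)
  qed
  ultimately have "0 \<le> wedge (\<i> * cis \<phi>) (X t - X s)" by (rule has_integral_nonneg)
  then show ?thesis by (simp add: wedge_def inner_complex_def algebra_simps)
qed

text \<open>After reduction modulo a full turn, the component along \<open>cis \<phi>\<close>
  decreases during the first half turn after \<open>\<phi>\<close> and increases back during the
  second.\<close>

lemma X_support:
  assumes "\<theta> 0 \<le> \<phi>" "\<theta> 0 \<le> t"
  shows "cis \<phi> \<bullet> X t \<le> cis \<phi> \<bullet> X \<phi>"
proof -
  define k where "k = \<lfloor>(t - \<phi>) / (2 * pi)\<rfloor>"
  define r where "r = t - 2 * pi * of_int k"
  have r: "\<phi> \<le> r" "r < \<phi> + 2 * pi"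
    using floor_divide_lower[of "2 * pi" "t - \<phi>"] floor_divide_upper[of "2 * pi" "t - \<phi>"]
    by (auto simp: k_def r_def algebra_simps)
  have "X r = X t"
  proof (cases "k \<ge> 0")
    case True
    then have "t = r + 2 * pi * real (nat k)" by (simp add: r_def)
    then show ?thesis using X_2pi[of r "nat k"] r assms by simp
  next
    case False
    then have "r = t + 2 * pi * real (nat (- k))" by (simp add: r_def)
    then show ?thesis using X_2pi[of t "nat (- k)"] assms by simp
  qed
  moreover have "cis \<phi> \<bullet> X r \<le> cis \<phi> \<bullet> X \<phi>"
  proof (cases "r \<le> \<phi> + pi")
    case True
    then show ?thesis using X_inner_antimono[of \<phi> \<phi> r] r assms by simp
  next
    case False
    have "cis (\<phi> + pi) \<bullet> X (\<phi> + 2 * pi) \<le> cis (\<phi> + pi) \<bullet> X r"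
      using X_inner_antimono[of "\<phi> + pi" r "\<phi> + 2 * pi"] r False assms by simp
    then show ?thesis using X_2pi[of \<phi> 1] assms by (simp add: cis_add_pi)
  qed
  ultimately show ?thesis by simp
qed

abbreviation body :: "complex set" where "body \<equiv> disk_intersection (z ` {..<m})"

text \<open>A second description of the body, by supporting half-planes. Constant width is easy to
  read off here, and \<open>body_eq_H\<close> identifies the two.\<close>

definition H :: "complex set" where "H = {x. \<forall>t\<ge>\<theta> 0. cis t \<bullet> x \<le> cis t \<bullet> X t}"

lemma X_in_H: "\<theta> 0 \<le> t \<Longrightarrow> X t \<in> H"
  by (simp add: H_def X_support)

lemma H_dist:
  assumes "x \<in> H" "y \<in> H"
  shows "norm (x - y) \<le> 1"
proof (cases "x = y")
  case False
  then obtain t where t: "\<theta> 0 \<le> t" "sgn (x - y) = cis t" using norm_1_cisE[of "sgn (x - y)"] by (auto simp: norm_sgn)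
  have "norm (x - y) = cis t \<bullet> (x - y)"
    using False unfolding t(2)[symmetric] by (simp add: sgn_div_norm dot_square_norm power2_eq_square)
  moreover have "cis t \<bullet> x \<le> cis t \<bullet> X t" using assms t by (simp add: H_def)
  moreover have "cis (t + pi) \<bullet> y \<le> cis (t + pi) \<bullet> X (t + pi)"
  proof -
    have "\<theta> 0 \<le> t + pi" using t by (simp add: add_increasing2)
    then show ?thesis using assms by (simp add: H_def)
  qed
  ultimately show ?thesis using t by (simp add: cis_add_pi X_pi inner_diff_right inner_cis)
qed simp

lemma z_in_H: "z j \<in> H"
proof (cases "even j")
  case True
  then show ?thesis using X_even(1)[of j] X_in_H[of "\<theta> j"] \<theta>_le[of 0 j] by simp
next
  case False
  then have "even (j + m)" using odd_m by simp
  then show ?thesis using X_even(1)[of "j + m"] X_in_H[of "\<theta> (j + m)"] \<theta>_le[of 0 "j + m"] z_period by simp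
qed

lemma body_iff: "x \<in> body \<longleftrightarrow> (\<forall>j. norm (x - z j) \<le> 1)"
proof
  assume x: "x \<in> body"
  show "\<forall>j. norm (x - z j) \<le> 1"
  proof
    fix j
    obtain i where "i < m" "z j = z i" using z_in[of j] by auto
    then show "norm (x - z j) \<le> 1" using x by (auto simp: disk_intersection_def dist_norm norm_minus_commute)
  qed
qed (auto simp: disk_intersection_def dist_norm norm_minus_commute)

lemma closed_H: "closed H" and convex_H: "convex H"
proof -
  have H: "H = (\<Inter>t\<in>{\<theta> 0..}. {x. cis t \<bullet> x \<le> cis t \<bullet> X t})" by (auto simp: H_def)
  show "closed H" unfolding H by (intro closed_INT ballI closed_halfspace_le)
  show "convex H" unfolding H by (intro convex_INT convex_halfspace_le)
qed

text \<open>\<open>H\<close> has diameter at most 1 and contains all \<open>z j\<close>, so it lies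
  in the body. Conversely, let \<open>x\<close> be outside \<open>H\<close> with nearest point
  \<open>y = X \<phi>\<close>. If \<open>y\<close> is on the arc about \<open>z j\<close>, then
  \<open>x\<close> is farther than 1 from \<open>z j\<close>. If \<open>y\<close> is the vertex
  \<open>z j\<close>, the two diagonals at \<open>z j\<close> enclose less than \<open>pi\<close>,
  so \<open>\<phi>\<close> is within a right angle of one of them and \<open>x\<close> is too far
  from its other end.\<close>

lemma body_eq_H: "body = H"
proof (intro set_eqI iffI)
  fix x assume "x \<in> H"
  then show "x \<in> body" using H_dist z_in_H by (simp add: body_iff)
next
  fix x assume x: "x \<in> body"
  show "x \<in> H"
  proof (rule ccontr)
    assume xH: "x \<notin> H"
    have ne: "H \<noteq> {}" using z_in_H by blast
    define y where "y = closest_point H x"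
    have y: "y \<in> H" unfolding y_def by (rule closest_point_in_set[OF closed_H ne])
    have dot: "(x - y) \<bullet> (w - y) \<le> 0" if "w \<in> H" for w
      unfolding y_def by (rule closest_point_dot[OF convex_H closed_H that])
    have "x \<noteq> y" using xH y by auto
    then obtain \<phi> where \<phi>: "\<theta> 0 \<le> \<phi>" "sgn (x - y) = cis \<phi>"
      using norm_1_cisE[of "sgn (x - y)"] by (auto simp: norm_sgn)
    define d where "d = norm (x - y)"
    have d: "d > 0" "x = y + d *\<^sub>R cis \<phi>"
      using \<open>x \<noteq> y\<close> unfolding \<phi>(2)[symmetric] by (auto simp: d_def sgn_div_norm)
    have dp: "\<theta> 0 \<le> \<phi> + pi" using \<phi> by (simp add: add_increasing2)
    have "cis \<phi> \<bullet> (X \<phi> - y) \<le> 0" using dot[OF X_in_H[OF \<phi>(1)]] d by (simp add: mult_le_0_iff)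
    \<comment> \<open>\<open>y\<close> supports \<open>H\<close> in direction
      \<open>cis \<phi>\<close>, and \<open>H\<close> has diameter at most 1, so \<open>y\<close>
      can only be \<open>X \<phi>\<close>.\<close>
    then have ge: "1 \<le> cis \<phi> \<bullet> (y - X (\<phi> + pi))"
      using X_pi[OF \<phi>(1)] by (simp add: inner_diff_right inner_cis)
    have le: "norm (y - X (\<phi> + pi)) \<le> 1" using H_dist[OF y X_in_H[OF dp]] .
    then have "cis \<phi> \<bullet> (y - X (\<phi> + pi)) = 1"
      using ge norm_cauchy_schwarz[of "cis \<phi>" "y - X (\<phi> + pi)"] by simp
    then have "y - X (\<phi> + pi) = cis \<phi>" using le by (intro unit_eq_of_inner_eq_1) auto
    then have yX: "y = X \<phi>" using X_pi[OF \<phi>(1)] by simp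
    define j where "j = idx \<phi>"
    have j: "\<theta> j \<le> \<phi>" "\<phi> < \<theta> (Suc j)" using idx_bounds[OF \<phi>(1)] by (auto simp: j_def)
    have far: False if "norm (x - z i) > 1" for i using x that unfolding body_iff by (meson not_le)
    have obtuse: "norm (d *\<^sub>R cis \<phi> + cis a) > 1" if "cos (\<phi> - a) \<ge> 0" for a
    proof -
      have "(norm (d *\<^sub>R cis \<phi> + cis a))\<^sup>2 = d\<^sup>2 + 2 * d * cos (\<phi> - a) + 1"
        unfolding power2_norm_eq_inner
        using cos_minus[of "\<phi> - a"] by (simp add: inner_add inner_cis power2_eq_square algebra_simps)
      also have "\<dots> > 1\<^sup>2" using d that by (simp add: add_pos_nonneg)
      finally show ?thesis by (rule power2_less_imp_less) simp
    qed
    show False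
    proof (cases "even j")
      case False
      then have "x - z j = (1 + d) *\<^sub>R cis \<phi>" using d yX X_piece[of j \<phi>] j by (simp add: scaleR_left_distrib)
      then show False using far[of j] d by simp
    next
      case True
      then have xe: "x = z j + d *\<^sub>R cis \<phi>" using d yX X_piece[of j \<phi>] j by simp
      consider "\<phi> - \<theta> j \<le> pi / 2" | "\<theta> (Suc j) - \<phi> \<le> pi / 2" using \<theta>_Suc_le_pi[of j] by linarith
      then show False
      proof cases
        case 1
        \<comment> \<open>\<open>k\<close> stands for the predecessor of \<open>j\<close>; two
          periods are added so that it exists for \<open>j = 0\<close> and has odd parity.\<close>
        obtain k where k: "j + 2 * m = Suc k" using m_ge_3 by (cases "j + 2 * m") auto
        then have "odd k" using True by (metis even_Suc even_add even_mult_iff dvd_triv_left)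
        then have "z j = z k + cis (\<theta> j)"
          using z_Suc[of k] z_2period[of j] \<theta>_2period[of j] unfolding k by (simp add: cis_add_2pi)
        then show False using obtuse[of "\<theta> j"] 1 j far[of k] cos_ge_zero[of "\<phi> - \<theta> j"]
          by (simp add: xe algebra_simps)
      next
        case 2
        have "z j = z (Suc j) + cis (\<theta> (Suc j))" using z_Suc[of j] True by simp
        then have "x - z (Suc j) = d *\<^sub>R cis \<phi> + cis (\<theta> (Suc j))" by (simp add: xe)
        then show False using obtuse[of "\<theta> (Suc j)"] 2 j far[of "Suc j"] cos_ge_zero[of "\<phi> - \<theta> (Suc j)"]
          by simp
      qed
    qed
  qed
qed

lemma constant_width_body: "constant_width_shape body"
proof (rule constant_width_shapeI[of _ "\<theta> 0" X])
  show "compact body"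
  proof -
    have "0 < m" using m_ge_3 by simp
    then show ?thesis unfolding disk_intersection_def by (intro compact_Inter) auto
  qed
  show "convex body" unfolding disk_intersection_def by (intro convex_INT) auto
  show "\<And>t. \<theta> 0 \<le> t \<Longrightarrow> X t \<in> body" by (simp add: body_eq_H X_in_H)
  show "\<And>t y. \<theta> 0 \<le> t \<Longrightarrow> y \<in> body \<Longrightarrow> cis t \<bullet> y \<le> cis t \<bullet> X t" by (simp add: body_eq_H H_def)
qed (rule X_pi)

sublocale constant_width body
  by unfold_locales (rule constant_width_body)

lemma reuleaux_polygon_body: "reuleaux_polygon body"
  unfolding reuleaux_polygon_def using constant_width_body by (auto intro!: exI[of _ "z ` {..<m}"])

lemma P_eq_X: "\<theta> 0 \<le> t \<Longrightarrow> P t = X t"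
  by (rule P_eqI) (unfold body_eq_H, rule X_in_H, auto simp: H_def)

text \<open>If the points were equal, \<open>P_between\<close> would keep the support point fixed
  throughout the arc with index \<open>Suc e\<close>, where it actually moves.\<close>

lemma z_even_neq:
  assumes "even e" "even e'" "e < e'" "\<theta> e' - \<theta> (Suc e) < pi"
  shows "z e \<noteq> z e'"
proof
  assume eq: "z e = z e'"
  have lt: "Suc (Suc e) \<le> e'" using assms(1-3) by (metis Suc_leI even_Suc le_neq_implies_less)
  have 0: "\<theta> 0 \<le> \<theta> j" for j using \<theta>_le by simp
  have le: "\<theta> (Suc e) < \<theta> (Suc (Suc e))" "\<theta> (Suc (Suc e)) \<le> \<theta> e'" using \<theta>_Suc \<theta>_le lt by auto
  have "P (\<theta> (Suc e)) = z e" "P (\<theta> e') = z e"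
    using X_even(2)[of e] X_even(1)[of e'] assms eq 0 by (auto simp: P_eq_X)
  then have "P (\<theta> (Suc (Suc e))) = z e"
    by (rule P_between) (use le assms in auto)
  then have "X (\<theta> (Suc (Suc e))) = X (\<theta> (Suc e))"
    using X_even(2)[of e] assms 0 by (simp add: P_eq_X)
  then have "cis (\<theta> (Suc (Suc e))) = cis (\<theta> (Suc e))"
    using X_piece[of "Suc e" "\<theta> (Suc e)"] X_piece[of "Suc e" "\<theta> (Suc (Suc e))"] le assms by simp
  then show False
    using inj_onD[OF inj_on_cis_interval[of "\<theta> (Suc (Suc e))" "\<theta> (Suc e)"], of "\<theta> (Suc (Suc e))" "\<theta> (Suc e)"]
      \<theta>_Suc_le_pi[of "Suc e"] le by simp
qed

text \<open>Of the two gaps between the normal cones around the full turn, at least one is shorter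
  than \<open>pi\<close>.\<close>

lemma z_even_inj:
  assumes "even e" "even e'" "e < e'" "e' < e + 2 * m"
  shows "z e \<noteq> z e'"
proof (cases "\<theta> e' - \<theta> (Suc e) < pi")
  case True
  then show ?thesis using z_even_neq assms by blast
next
  case False
  have "\<theta> (e + 2 * m) - \<theta> (Suc e') < pi"
    using False \<theta>_2period[of e] \<theta>_Suc[of e] \<theta>_Suc[of e'] by linarith
  then have "z e' \<noteq> z (e + 2 * m)" using assms by (intro z_even_neq) auto
  then show ?thesis using z_2period by metis
qed

lemma inj_z_even: "inj_on (\<lambda>i. z (2 * i)) {..<m}"
proof (rule inj_onI)
  fix i j assume "i \<in> {..<m}" "j \<in> {..<m}" "z (2 * i) = z (2 * j)"
  then show "i = j" using z_even_inj[of "2 * i" "2 * j"] z_even_inj[of "2 * j" "2 * i"]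
    by (cases i j rule: linorder_cases) auto
qed

text \<open>Doubling permutes the residues modulo the odd number \<open>m\<close>.\<close>

lemma z_even_image: "(\<lambda>i. z (2 * i)) ` {..<m} = z ` {..<m}"
proof
  show "(\<lambda>i. z (2 * i)) ` {..<m} \<subseteq> z ` {..<m}" using z_in by auto
  show "z ` {..<m} \<subseteq> (\<lambda>i. z (2 * i)) ` {..<m}"
  proof (rule image_subsetI)
    fix i assume i: "i \<in> {..<m}"
    show "z i \<in> (\<lambda>i. z (2 * i)) ` {..<m}"
    proof (cases "even i")
      case True
      then show ?thesis using i by (intro image_eqI[of _ _ "i div 2"]) auto
    next
      case False
      then have "2 * ((i + m) div 2) = i + m" using odd_m by simp
      then show ?thesis using i z_period[of i] by (intro image_eqI[of _ _ "(i + m) div 2"]) auto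
    qed
  qed
qed

lemma card_z: "card (z ` {..<m}) = m"
  using card_image[OF inj_z_even] unfolding z_even_image by simp

lemma inj_z: "inj_on z {..<m}"
  using card_z by (intro eq_card_imp_inj_on) auto

lemma z_even_vertex: "even j \<Longrightarrow> z j \<in> vertices body"
proof -
  assume "even j"
  then have "P (\<theta> j) = z j" "P (\<theta> (Suc j)) = z j"
    using X_even[of j] P_eq_X[of "\<theta> j"] P_eq_X[of "\<theta> (Suc j)"] \<theta>_le[of 0 j] \<theta>_le[of 0 "Suc j"] by simp_all
  moreover have "cis (\<theta> j) \<noteq> cis (\<theta> (Suc j))"
    using inj_onD[OF inj_on_cis_interval[of "\<theta> (Suc j)" "\<theta> j"], of "\<theta> (Suc j)" "\<theta> j"]
      \<theta>_Suc_le_pi[of j] \<theta>_Suc[of j] by auto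
  ultimately show ?thesis
    unfolding vertices_eq by (intro CollectI exI[of _ "\<theta> j"] exI[of _ "\<theta> (Suc j)"]) simp
qed

text \<open>An interval of normals of \<open>x\<close>, moved by full turns beyond
  \<open>\<theta> 0\<close> and cut at the next switching direction, lies in a single piece. On a
  piece with odd index \<open>X\<close> is injective, so the index is even and \<open>x\<close> is
  some \<open>z j\<close>.\<close>

lemma vertices_body: "vertices body = z ` {..<m}"
proof
  show "vertices body \<subseteq> z ` {..<m}"
  proof
    fix x assume "x \<in> vertices body"
    then obtain s t where st: "s < t" "t - s < pi" "\<And>\<phi>. s \<le> \<phi> \<Longrightarrow> \<phi> \<le> t \<Longrightarrow> P \<phi> = x"
      by (rule vertices_interval_pair) blast
    obtain n :: nat where "real n \<ge> (\<theta> 0 - s) / (2 * pi)" using real_arch_simple by blast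
    then have n: "\<theta> 0 \<le> s + 2 * pi * real n" by (simp add: field_simps)
    have per: "P (r + 2 * pi * real k) = P r" for r k
    proof (induction k)
      case (Suc k)
      have "r + 2 * pi * real (Suc k) = (r + 2 * pi * real k) + 2 * pi" by (simp add: algebra_simps)
      then show ?case using Suc P_2pi by metis
    qed simp
    define s' where "s' = s + 2 * pi * real n"
    define j where "j = idx s'"
    define r where "r = min (t + 2 * pi * real n) (\<theta> (Suc j))"
    have s': "\<theta> 0 \<le> s'" using n by (simp add: s'_def)
    have j: "\<theta> j \<le> s'" "s' < \<theta> (Suc j)" using idx_bounds[OF s'] by (auto simp: j_def)
    have r: "s' < r" "r \<le> \<theta> (Suc j)" using j st by (auto simp: r_def s'_def)
    have "P s' = x" "P r = x"
      using st(3)[of s] st(3)[of "r - 2 * pi * real n"] st(1) r per[of s n] per[of "r - 2 * pi * real n" n]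
      by (auto simp: s'_def r_def)
    then have Xs: "X s' = x" "X r = x" using P_eq_X s' r by auto
    show "x \<in> z ` {..<m}"
    proof (cases "even j")
      case True
      then show ?thesis using Xs X_piece[of j s'] j z_in[of j] by simp
    next
      case False
      then have "z j + cis s' = z j + cis r" using Xs X_piece[of j s'] X_piece[of j r] j r by simp
      then have "cis s' = cis r" by simp
      then show ?thesis
        using inj_onD[OF inj_on_cis_interval[of r s'], of s' r] \<theta>_Suc_le_pi[of j] j r by simp
    qed
  qed
  show "z ` {..<m} \<subseteq> vertices body"
    using z_even_vertex unfolding z_even_image[symmetric] by auto
qed

text \<open>Any finite family of centres contains the \<open>m\<close> vertices, so no smaller
  family is possible.\<close>

lemma sides_body: "sides body = m"
  unfolding sides_def
proof (rule Least_equality)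
  show "\<exists>C. finite C \<and> card C = m \<and> body = disk_intersection C"
    using card_z by (intro exI[of _ "z ` {..<m}"]) simp
  fix k assume "\<exists>C. finite C \<and> card C = k \<and> body = disk_intersection C"
  then obtain C where C: "finite C" "card C = k" "body = disk_intersection C" by blast
  have "card (vertices body) \<le> card C"
    by (rule card_mono[OF C(1) vertices_subset_centers(1)[OF C(1,3)]])
  then show "m \<le> k" using C(2) card_z by (simp add: vertices_body)
qed

lemma ccw_labelling_body: "ccw_labelling body m (\<lambda>i. z (2 * i))"
  unfolding ccw_labelling_def
proof (intro conjI allI impI)
  show "bij_betw (\<lambda>i. z (2 * i)) {..<m} (vertices body)"
    unfolding bij_betw_def vertices_body using inj_z_even z_even_image by blast
  fix i j k assume ijk: "i < j" "j < k" "k < m"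
  \<comment> \<open>The bisector of the normal cone of \<open>z (2 * i)\<close>. Among all vertices
    this one alone is extreme in that direction, so the order of the bisectors determines the
    orientation.\<close>
  define \<tau> where "\<tau> i = (\<theta> (2 * i) + \<theta> (Suc (2 * i))) / 2" for i
  have \<tau>: "\<theta> (2 * i) < \<tau> i" "\<tau> i < \<theta> (Suc (2 * i))" for i using \<theta>_Suc[of "2 * i"] by (auto simp: \<tau>_def)
  have P: "P (\<tau> i) = z (2 * i)" for i
    using \<tau>[of i] X_piece[of "2 * i" "\<tau> i"] \<theta>_le[of 0 "2 * i"] by (simp add: P_eq_X)
  have strict: "cis (\<tau> a) \<bullet> z (2 * b) < cis (\<tau> a) \<bullet> z (2 * a)" if "a \<noteq> b" "a < m" "b < m" for a b
  proof -
    have "z (2 * b) \<in> body" unfolding body_eq_H by (rule z_in_H)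
    moreover have "z (2 * b) \<noteq> z (2 * a)" using inj_onD[OF inj_z_even, of a b] that by auto
    ultimately show ?thesis using P_strict[of "z (2 * b)" "\<tau> a"] unfolding P by blast
  qed
  have "\<tau> a < \<tau> b" if "a < b" for a b
    using \<tau>(2)[of a] \<tau>(1)[of b] \<theta>_le[of "Suc (2 * a)" "2 * b"] that by simp
  moreover have "\<tau> k < \<tau> i + 2 * pi"
    using \<tau>(2)[of k] \<tau>(1)[of i] \<theta>_le[of "Suc (2 * k)" "2 * i + 2 * m"] \<theta>_2period[of "2 * i"] ijk by simp
  ultimately have "wedge (z (2 * j) - z (2 * i)) (z (2 * k) - z (2 * i)) > 0"
    using ijk by (intro wedge_pos_of_strict_supports[of "\<tau> i" "\<tau> j" "\<tau> k"] strict) auto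
  then show "Im (cnj (z (2 * j) - z (2 * i)) * (z (2 * k) - z (2 * i))) > 0"
    by (simp add: wedge_eq_Im)
qed

end

section \<open>The upper area bound\<close>

lemma tan_half_eq: "sin x \<noteq> 0 \<Longrightarrow> tan (x / 2) = (1 - cos x) / sin (x::real)"
proof -
  assume s: "sin x \<noteq> 0"
  have "sin x = 2 * sin (x / 2) * cos (x / 2)" "cos x = 1 - 2 * (sin (x / 2))\<^sup>2"
    using sin_double[of "x / 2"] cos_double_sin[of "x / 2"] by simp_all
  then show ?thesis using s by (simp add: tan_def power2_eq_square divide_simps)
qed

lemma tan_above_tangent:
  fixes a x :: real
  assumes "0 \<le> a" "a < pi / 2" "0 \<le> x" "x < pi / 2"
  shows "tan a + (1 + (tan a)\<^sup>2) * (x - a) \<le> tan x"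
proof -
  have d: "(tan has_real_derivative 1 + (tan y)\<^sup>2) (at y)" if "0 \<le> y" "y < pi / 2" for y
  proof -
    have c: "cos y \<noteq> 0" using that cos_gt_zero_pi[of y] by simp
    have "1 + (tan y)\<^sup>2 = inverse ((cos y)\<^sup>2)" using tan_sec[OF c] by (simp add: power_inverse)
    then show ?thesis using DERIV_tan[OF c] by simp
  qed
  consider "x = a" | "x > a" | "x < a" by linarith
  then show ?thesis
  proof cases
    case 2
    obtain \<xi> where \<xi>: "a < \<xi>" "\<xi> < x" "tan x - tan a = (x - a) * (1 + (tan \<xi>)\<^sup>2)"
      using MVT2[OF 2, of tan "\<lambda>y. 1 + (tan y)\<^sup>2"] d assms by force
    have "0 \<le> tan a" "tan a \<le> tan \<xi>"
      using assms \<xi> tan_monotone[of a \<xi>] tan_gt_zero[of a] by (cases "a = 0"; auto)+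
    then have "(tan a)\<^sup>2 \<le> (tan \<xi>)\<^sup>2" by (intro power_mono)
    then have "(x - a) * (1 + (tan a)\<^sup>2) \<le> (x - a) * (1 + (tan \<xi>)\<^sup>2)" using 2 by (intro mult_left_mono) auto
    then show ?thesis using \<xi>(3) by (simp add: mult.commute)
  next
    case 3
    obtain \<xi> where \<xi>: "x < \<xi>" "\<xi> < a" "tan a - tan x = (a - x) * (1 + (tan \<xi>)\<^sup>2)"
      using MVT2[OF 3, of tan "\<lambda>y. 1 + (tan y)\<^sup>2"] d assms by force
    have "0 \<le> tan \<xi>" "tan \<xi> \<le> tan a"
      using assms \<xi> tan_monotone[of \<xi> a] tan_gt_zero[of \<xi>] by auto
    then have "(tan \<xi>)\<^sup>2 \<le> (tan a)\<^sup>2" by (intro power_mono)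
    then have "(a - x) * (1 + (tan \<xi>)\<^sup>2) \<le> (a - x) * (1 + (tan a)\<^sup>2)" using 3 by (intro mult_left_mono) auto
    then show ?thesis using \<xi>(3) by (simp add: algebra_simps)
  qed simp
qed

text \<open>The tangent line is taken at \<open>pi / (2 * real n)\<close> and not at the mean of the
  \<open>m\<close> angles. Its intercept is nonpositive, so having fewer than \<open>n\<close> terms
  only improves the bound, and all \<open>m \<le> n\<close> are covered at once.\<close>

lemma sum_tan_ge:
  fixes x :: "nat \<Rightarrow> real"
  assumes "\<And>j. j < m \<Longrightarrow> 0 \<le> x j \<and> x j < pi / 2" "(\<Sum>j<m. x j) = pi / 2" "m \<le> n" "n \<ge> 2"
  shows "(\<Sum>j<m. tan (x j)) \<ge> real n * tan (pi / (2 * real n))"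
proof -
  define a where "a = pi / (2 * real n)"
  have a: "0 \<le> a" "a < pi / 2" "real n * a = pi / 2"
    using assms(4) by (auto simp: a_def field_simps)
  define D where "D = 1 + (tan a)\<^sup>2"
  have "tan a - D * a \<le> 0" using tan_above_tangent[OF a(1,2), of 0] by (simp add: D_def algebra_simps)
  then have "real n * (tan a - D * a) \<le> real m * (tan a - D * a)"
    using assms(3) by (intro mult_right_mono_neg) auto
  moreover have "real m * (tan a - D * a) + D * (pi / 2) = (\<Sum>j<m. tan a + D * (x j - a))"
    unfolding assms(2)[symmetric] by (simp add: algebra_simps sum.distrib sum_distrib_left sum_subtractf)
  moreover have "\<dots> \<le> (\<Sum>j<m. tan (x j))"
    unfolding D_def using assms(1) a by (intro sum_mono tan_above_tangent) auto
  moreover have "real n * (tan a - D * a) + D * (pi / 2) = real n * tan a"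
    unfolding a(3)[symmetric] by (simp add: algebra_simps)
  ultimately show ?thesis unfolding a_def by linarith
qed

definition star_sum :: "nat \<Rightarrow> (nat \<Rightarrow> complex) \<Rightarrow> real" where
  "star_sum m z = (\<Sum>j<m. wedge (z j) (z (Suc j)))"

context star_polygon
begin

lemma star_polygon_translate: "star_polygon m \<theta> (\<lambda>j. z j - d)"
  using odd_m \<theta>_Suc \<theta>_period z_Suc z_period by unfold_locales auto

lemma z_m: "z m = z 0" and \<theta>_m: "\<theta> m = \<theta> 0 + pi"
  using z_period[of 0] \<theta>_period[of 0] by simp_all

lemma star_sum_translate: "star_sum m (\<lambda>j. z j - d) = star_sum m z"
proof -
  have "star_sum m (\<lambda>j. z j - d) = star_sum m z + (\<Sum>j<m. wedge d (z j) - wedge d (z (Suc j)))"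
    unfolding star_sum_def sum.distrib[symmetric]
    by (intro sum.cong) (simp_all add: wedge_def algebra_simps)
  also have "(\<Sum>j<m. wedge d (z j) - wedge d (z (Suc j))) = wedge d (z 0) - wedge d (z m)"
    by (rule sum_lessThan_telescope')
  finally show ?thesis by (simp add: z_m)
qed

lemma sin_step: "sin (\<theta> (Suc j) - \<theta> j) > 0"
  using \<theta>_Suc[of j] \<theta>_Suc_le_pi[of j] by (intro sin_gt_zero) auto

text \<open>\<open>c j\<close> and \<open>M j\<close> are the coordinates of the midpoint of the \<open>j\<close>-th diagonal along its direction and
  its normal. Both \<open>e j * M j\<close> and \<open>c j * M j\<close> have period \<open>m\<close>, so their differences sum up to 0; the
  second of these identities expresses the linear terms in \<open>c\<close> by the quadratic form \<open>Q\<close>.\<close>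

lemma star_sum_le_tan_aux:
  assumes centred: "cis (\<theta> 0) \<bullet> z 0 = 1 / 2"
  shows "(\<Sum>j<m. tan ((\<theta> (Suc j) - \<theta> j) / 2)) \<le> - 2 * star_sum m z"
proof -
  define e :: "nat \<Rightarrow> real" where "e j = (if even j then 1 else - 1)" for j
  define c where "c j = cis (\<theta> j) \<bullet> z j - e j / 2" for j
  define M where "M j = (\<i> * cis (\<theta> j)) \<bullet> z j" for j
  define \<alpha> where "\<alpha> j = \<theta> (Suc j) - \<theta> j" for j
  define T where "T j = tan (\<alpha> j / 2)" for j
  define Q where "Q j = (((c j)\<^sup>2 + (c (Suc j))\<^sup>2) * cos (\<alpha> j) - 2 * c j * c (Suc j)) / sin (\<alpha> j)" for j
  have e: "e (Suc j) = - e j" "e j * e j = 1" for j by (simp_all add: e_def)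
  have s: "sin (\<alpha> j) > 0" for j unfolding \<alpha>_def by (rule sin_step)
  have zS: "z (Suc j) = z j - e j *\<^sub>R cis (\<theta> (Suc j))" for j
    by (simp add: z_Suc e_def)
  have c': "cis (\<theta> (Suc j)) \<bullet> z j = c (Suc j) + e j / 2" for j
    by (simp add: c_def zS inner_diff_right inner_cis e)
  have M': "(\<i> * cis (\<theta> (Suc j))) \<bullet> z j = M (Suc j)" for j
    by (simp add: M_def zS inner_diff_right inner_complex_def algebra_simps)
  \<comment> \<open>A rotation of the frame from direction \<open>r\<close> to \<open>t\<close>: the
    normal coordinate is recovered from the coordinates along two successive diagonals.\<close>
  have frame: "sin (t - r) * ((\<i> * cis r) \<bullet> w) = cis t \<bullet> w - cos (t - r) * (cis r \<bullet> w)"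
    "sin (t - r) * ((\<i> * cis t) \<bullet> w) = cos (t - r) * (cis t \<bullet> w) - cis r \<bullet> w" for t r w
  proof -
    have rot: "cis t = cos (t - r) *\<^sub>R cis r + sin (t - r) *\<^sub>R (\<i> * cis r)" for t r
      using cis_mult[of "t - r" r] by (simp add: complex_eq_iff algebra_simps)
    have "cis t \<bullet> w = cos (t - r) * (cis r \<bullet> w) + sin (t - r) * ((\<i> * cis r) \<bullet> w)"
      using arg_cong[OF rot[of t r], of "\<lambda>v. v \<bullet> w"] by (simp only: inner_add_left inner_scaleR_left)
    then show "sin (t - r) * ((\<i> * cis r) \<bullet> w) = cis t \<bullet> w - cos (t - r) * (cis r \<bullet> w)" by simp
    have "cis r \<bullet> w = cos (r - t) * (cis t \<bullet> w) + sin (r - t) * ((\<i> * cis t) \<bullet> w)"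
      using arg_cong[OF rot[of r t], of "\<lambda>v. v \<bullet> w"] by (simp only: inner_add_left inner_scaleR_left)
    then show "sin (t - r) * ((\<i> * cis t) \<bullet> w) = cos (t - r) * (cis t \<bullet> w) - cis r \<bullet> w"
      using cos_minus[of "t - r"] sin_minus[of "t - r"] by simp
  qed
  have M1: "sin (\<alpha> j) * M j = (c (Suc j) + e j / 2) - cos (\<alpha> j) * (c j + e j / 2)" for j
    using frame(1)[where t = "\<theta> (Suc j)" and r = "\<theta> j" and w = "z j"] unfolding c' M_def[symmetric] \<alpha>_def[symmetric]
    by (simp add: c_def)
  have M2: "sin (\<alpha> j) * M (Suc j) = cos (\<alpha> j) * (c (Suc j) + e j / 2) - (c j + e j / 2)" for j
    using frame(2)[where t = "\<theta> (Suc j)" and r = "\<theta> j" and w = "z j"] unfolding c' M' \<alpha>_def[symmetric]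
    by (simp add: c_def)
  have T: "T j = (1 - cos (\<alpha> j)) / sin (\<alpha> j)" for j
    unfolding T_def by (rule tan_half_eq) (use s[of j] in simp)
  \<comment> \<open>Up to the factor \<open>e j\<close>, the change of the normal coordinate is
    \<open>tan (\<alpha> j / 2)\<close> plus a term linear in \<open>c\<close>;
    \<open>diffcM\<close> removes the latter.\<close>
  have diffM: "e j * (M j - M (Suc j)) = T j * (1 + e j * (c j + c (Suc j)))" for j
  proof -
    have "sin (\<alpha> j) * (e j * (M j - M (Suc j))) = e j * (sin (\<alpha> j) * M j - sin (\<alpha> j) * M (Suc j))"
      by (simp add: algebra_simps)
    also have "\<dots> = (1 - cos (\<alpha> j)) * (e j * e j + e j * (c j + c (Suc j)))"
      unfolding M1 M2 by (simp add: algebra_simps add_divide_distrib)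
    also have "\<dots> = sin (\<alpha> j) * (T j * (1 + e j * (c j + c (Suc j))))"
      using s[of j] by (simp add: T e)
    finally show ?thesis using s[of j] by simp
  qed
  have diffcM: "c (Suc j) * M (Suc j) - c j * M j = Q j - T j * (e j * (c j + c (Suc j))) / 2" for j
  proof -
    have "sin (\<alpha> j) * (c (Suc j) * M (Suc j) - c j * M j) =
        c (Suc j) * (sin (\<alpha> j) * M (Suc j)) - c j * (sin (\<alpha> j) * M j)"
      by (simp add: algebra_simps)
    also have "\<dots> = ((c j)\<^sup>2 + (c (Suc j))\<^sup>2) * cos (\<alpha> j) - 2 * c j * c (Suc j)
        - (1 - cos (\<alpha> j)) * (e j * (c j + c (Suc j))) / 2"
      unfolding M1 M2 by (simp add: algebra_simps add_divide_distrib diff_divide_distrib power2_eq_square)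
    also have "\<dots> = sin (\<alpha> j) * (Q j - T j * (e j * (c j + c (Suc j))) / 2)"
    proof -
      have "sin (\<alpha> j) * Q j = ((c j)\<^sup>2 + (c (Suc j))\<^sup>2) * cos (\<alpha> j) - 2 * c j * c (Suc j)"
        "sin (\<alpha> j) * T j = 1 - cos (\<alpha> j)"
        using s[of j] by (simp_all add: Q_def T)
      then show ?thesis by (simp add: right_diff_distrib mult.assoc[symmetric])
    qed
    finally show ?thesis using s[of j] by simp
  qed
  have per: "e m = - e 0" "M m = - M 0" "c m = - c 0"
    using odd_m by (simp_all add: e_def M_def c_def z_m \<theta>_m cis_add_pi)
  \<comment> \<open>Together with \<open>c m = - c 0\<close> this gives the two zeros required by
    \<open>discrete_wirtinger\<close>.\<close>
  have c0: "c 0 = 0" using centred by (simp add: c_def e_def)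
  have w: "wedge (z j) (z (Suc j)) = - e (Suc j) * M (Suc j)" for j
  proof -
    have "wedge (z j) (z (Suc j)) = e j * ((\<i> * cis (\<theta> (Suc j))) \<bullet> z j)"
      by (simp add: zS wedge_def inner_complex_def algebra_simps)
    then show ?thesis by (simp add: M' e)
  qed
  have "(\<Sum>j<m. e (Suc j) * M (Suc j) - e j * M j) = e m * M m - e 0 * M 0"
    by (rule sum_lessThan_telescope)
  then have "(\<Sum>j<m. e (Suc j) * M (Suc j)) = (\<Sum>j<m. e j * M j)"
    by (simp add: sum_subtractf per)
  then have "- 2 * star_sum m z = (\<Sum>j<m. e j * (M j - M (Suc j)))"
    unfolding star_sum_def w by (simp add: e sum_negf sum_subtractf right_diff_distrib)
  also have "\<dots> = (\<Sum>j<m. T j) + (\<Sum>j<m. T j * (e j * (c j + c (Suc j))))"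
    unfolding diffM by (simp add: sum.distrib distrib_left)
  also have "(\<Sum>j<m. T j * (e j * (c j + c (Suc j)))) = 2 * (\<Sum>j<m. Q j)"
  proof -
    have "(\<Sum>j<m. c (Suc j) * M (Suc j) - c j * M j) = c m * M m - c 0 * M 0"
      by (rule sum_lessThan_telescope)
    then have "(\<Sum>j<m. Q j - T j * (e j * (c j + c (Suc j))) / 2) = 0"
      unfolding diffcM by (simp add: per)
    then show ?thesis by (simp add: sum_subtractf sum_divide_distrib[symmetric])
  qed
  finally have "- 2 * star_sum m z = (\<Sum>j<m. T j) + 2 * (\<Sum>j<m. Q j)" .
  moreover have "(\<Sum>j<m. Q j) \<ge> 0"
    unfolding Q_def \<alpha>_def by (rule discrete_wirtinger) (use \<theta>_Suc \<theta>_m m_ge_3 c0 per in auto)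
  ultimately show ?thesis by (simp add: T_def \<alpha>_def)
qed

text \<open>A translation along \<open>cis (\<theta> 0)\<close> centres the diagonal in that
  direction and changes neither the angles nor the star sum.\<close>

lemma star_sum_le_tan: "(\<Sum>j<m. tan ((\<theta> (Suc j) - \<theta> j) / 2)) \<le> - 2 * star_sum m z"
proof -
  define d where "d = (cis (\<theta> 0) \<bullet> z 0 - 1 / 2) *\<^sub>R cis (\<theta> 0)"
  interpret T: star_polygon m \<theta> "\<lambda>j. z j - d" by (rule star_polygon_translate)
  have "cis (\<theta> 0) \<bullet> (z 0 - d) = 1 / 2"
    by (simp add: d_def inner_diff_right inner_cis)
  from T.star_sum_le_tan_aux[OF this] show ?thesis by (simp add: star_sum_translate)
qed

lemma star_sum_le:
  assumes "m \<le> n"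
  shows "star_sum m z \<le> - (real n / 2) * tan (pi / (2 * real n))"
proof -
  have sum: "(\<Sum>j<m. (\<theta> (Suc j) - \<theta> j) / 2) = pi / 2"
    using sum_lessThan_telescope[of \<theta> m] by (simp add: sum_divide_distrib[symmetric] \<theta>_m)
  have "real n * tan (pi / (2 * real n)) \<le> (\<Sum>j<m. tan ((\<theta> (Suc j) - \<theta> j) / 2))"
  proof (rule sum_tan_ge)
    show "0 \<le> (\<theta> (Suc j) - \<theta> j) / 2 \<and> (\<theta> (Suc j) - \<theta> j) / 2 < pi / 2" for j
      using \<theta>_Suc[of j] \<theta>_Suc_le_pi[of j] by simp
  qed (use m_ge_3 assms sum in auto)
  then show ?thesis using star_sum_le_tan by simp
qed

end

lemma cis_add_cis: "cis (a + d) + cis a = (2 * cos (d / 2)) *\<^sub>R cis (a + d / 2)"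
proof -
  have "cis (b + h) + cis (b - h) = (2 * cos h) *\<^sub>R cis b" for b h
    by (simp add: complex_eq_iff cos_add cos_diff sin_add sin_diff)
  moreover have "a + d / 2 + d / 2 = a + d" "a + d / 2 - d / 2 = a" by simp_all
  ultimately show ?thesis by metis
qed

text \<open>The path goes from each vertex to one that is opposite up to the turn
  \<open>pi / n\<close>; the alternating sign expresses the antipode. The value of \<open>r\<close>
  is the circumradius for which these diagonals have length 1, and the shift
  \<open>pi / (2 * real n)\<close> in \<open>\<theta>\<close> comes from their bisecting two
  successive radii.\<close>

lemma regular_star_polygon:
  fixes n :: nat and r \<phi> :: real and c :: complex
  assumes "odd n" "n \<ge> 3" "r = 1 / (2 * cos (pi / (2 * real n)))"
  defines "\<theta> \<equiv> \<lambda>j. \<phi> + pi * real j / real n - pi / (2 * real n)"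
  defines "z \<equiv> \<lambda>j. c + (if even j then 1 else -1) *\<^sub>R (r *\<^sub>R cis (\<phi> + pi * real j / real n))"
  shows "star_polygon n \<theta> z"
    and "star_sum n z = - (real n / 2) * tan (pi / (2 * real n))"
proof -
  define h where "h = pi / (2 * real n)"
  have h: "0 < h" "h < pi / 2" using assms(2) by (auto simp: h_def field_simps)
  have ch: "cos h > 0" using h by (intro cos_gt_zero) auto
  have r: "2 * cos h * r = 1" using ch unfolding assms(3) h_def by simp
  have hn: "real n * h = pi / 2" using assms(2) by (simp add: h_def)
  have \<theta>: "\<theta> j = \<phi> + 2 * real j * h - h" for j by (simp add: \<theta>_def h_def field_simps)
  have z: "z j = c + (if even j then 1 else -1) *\<^sub>R (r *\<^sub>R cis (\<phi> + 2 * real j * h))" for j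
    by (simp add: z_def h_def field_simps)
  have step: "r *\<^sub>R cis (\<phi> + 2 * real (Suc j) * h) + r *\<^sub>R cis (\<phi> + 2 * real j * h) = cis (\<theta> (Suc j))" for j
  proof -
    have "cis (\<phi> + 2 * real (Suc j) * h) + cis (\<phi> + 2 * real j * h) = (2 * cos h) *\<^sub>R cis (\<theta> (Suc j))"
      using cis_add_cis[of "\<phi> + 2 * real j * h" "2 * h"] by (simp add: \<theta> algebra_simps)
    then show ?thesis using r unfolding scaleR_add_right[symmetric] by (simp add: mult.commute mult.left_commute)
  qed
  show sp: "star_polygon n \<theta> z"
  proof
    show "odd n" by fact
    fix j
    show "\<theta> j < \<theta> (Suc j)" using h by (simp add: \<theta> algebra_simps)
    show "\<theta> (j + n) = \<theta> j + pi" using hn by (simp add: \<theta> algebra_simps)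
    have "\<phi> + 2 * real (j + n) * h = \<phi> + 2 * real j * h + pi" using hn by (simp add: algebra_simps)
    then show "z (j + n) = z j" using \<open>odd n\<close> by (simp only: z cis_add_pi) simp
    show "z (Suc j) = (if even j then z j - cis (\<theta> (Suc j)) else z j + cis (\<theta> (Suc j)))"
      unfolding step[of j, symmetric] by (simp add: z)
  qed
  interpret star_polygon n \<theta> z by fact
  have "wedge (z j - c) (z (Suc j) - c) = - (r * r) * sin (2 * h)" for j
  proof -
    have "wedge (z j - c) (z (Suc j) - c) = - (r * r) * wedge (cis (\<phi> + 2 * real j * h)) (cis (\<phi> + 2 * real (Suc j) * h))"
      by (simp add: z wedge_def algebra_simps)
    also have "\<dots> = - (r * r) * sin (2 * h)" unfolding wedge_cis by (simp add: algebra_simps)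
    finally show ?thesis .
  qed
  then have "star_sum n z = - real n * (r * r * sin (2 * h))"
    unfolding star_sum_translate[of c, symmetric] by (simp add: star_sum_def)
  also have "r * r * sin (2 * h) = tan h / 2"
  proof -
    have "r * r * sin (2 * h) = (2 * cos h * r) * (r * sin h)" by (simp add: sin_double)
    also have "\<dots> = r * sin h" unfolding r by simp
    also have "\<dots> = tan h / 2" using assms(3) by (simp add: h_def tan_def)
    finally show ?thesis .
  qed
  finally show "star_sum n z = - (real n / 2) * tan (pi / (2 * real n))" by (simp add: h_def)
qed

lemma diameter_hull_eqI:
  fixes V :: "complex set"
  assumes "finite V" "x \<in> V" "y \<in> V" "norm (x - y) = d" "\<And>x y. x \<in> V \<Longrightarrow> y \<in> V \<Longrightarrow> norm (x - y) \<le> d"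
  shows "diameter (convex hull V) = (d :: real)"
proof (rule antisym)
  have ne: "V \<noteq> {}" using assms by auto
  obtain u v where uv: "u \<in> V" "v \<in> V" "\<forall>x\<in>convex hull V. \<forall>y\<in>convex hull V. norm (x - y) \<le> norm (u - v)"
    using simplex_extremal_le[OF assms(1) ne] by blast
  then have "norm (x - y) \<le> d" if "x \<in> convex hull V" "y \<in> convex hull V" for x y
    using assms(5)[of u v] that by fastforce
  then show "diameter (convex hull V) \<le> d" using ne by (intro diameter_le) auto
  have "bounded (convex hull V)" using assms(1) by (simp add: finite_imp_bounded_convex_hull)
  then show "d \<le> diameter (convex hull V)"
    using diameter_bounded_bound[of "convex hull V" x y] assms hull_inc[of x V] hull_inc[of y V]
    by (simp add: dist_norm)
qed

text \<open>The given vertices are a scaled and translated copy of the star polygon with centre 0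
  and circumradius \<open>r0\<close>, whose diameter is 1. Comparing diameters forces
  \<open>r = r0\<close>.\<close>

lemma regular_reuleaux_polygonE:
  assumes "regular_reuleaux_polygon n P" "odd n" "n \<ge> 3"
  obtains \<theta> z where "star_polygon n \<theta> z" "P = disk_intersection (z ` {..<n})"
    "star_sum n z = - (real n / 2) * tan (pi / (2 * real n))"
proof -
  obtain V where V: "regular_polygon_vertices n V" "diameter (convex hull V) = 1" "P = disk_intersection V"
    using assms(1) by (auto simp: regular_reuleaux_polygon_def)
  then obtain c r \<phi> where r: "r > 0"
    and Veq: "V = (\<lambda>j. c + of_real r * cis (\<phi> + 2 * pi * real j / real n)) ` {..<n}"
    by (auto simp: regular_polygon_vertices_def)
  define r0 where "r0 = 1 / (2 * cos (pi / (2 * real n)))"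
  define \<theta> where "\<theta> = (\<lambda>j. \<phi> + pi * real j / real n - pi / (2 * real n))"
  define z where "z = (\<lambda>c r j. c + (if even j then 1 else -1) *\<^sub>R (r *\<^sub>R cis (\<phi> + pi * real j / real n)))"
  have cpos: "cos (pi / (2 * real n)) > 0" using assms(3) by (intro cos_gt_zero) (auto simp: field_simps)
  then have "r0 > 0" by (simp add: r0_def)
  note reg = regular_star_polygon[OF assms(2,3) r0_def, where \<phi> = \<phi>, folded \<theta>_def]
  interpret S: star_polygon n \<theta> "z 0 r0" unfolding z_def by (rule reg)
  have scale: "z c r j = c + (r / r0) *\<^sub>R z 0 r0 j" for j
    using \<open>r0 > 0\<close> by (simp add: z_def)
  have V_even: "V = (\<lambda>i. z c r (2 * i)) ` {..<n}"
    unfolding Veq z_def by (intro image_cong) (auto simp: scaleR_conv_of_real mult_ac)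
  have "(\<lambda>i. z 0 r0 (2 * i)) ` {..<n} = z 0 r0 ` {..<n}" by (rule S.z_even_image)
  then have "(\<lambda>v. c + (r / r0) *\<^sub>R v) ` (\<lambda>i. z 0 r0 (2 * i)) ` {..<n}
    = (\<lambda>v. c + (r / r0) *\<^sub>R v) ` z 0 r0 ` {..<n}" by (rule arg_cong)
  then have Vz: "V = z c r ` {..<n}" unfolding V_even image_image scale .
  have dist: "norm (z c r i - z c r j) = (r / r0) * norm (z 0 r0 i - z 0 r0 j)" for i j
    using r \<open>r0 > 0\<close> unfolding scale by (simp add: scaleR_diff_right[symmetric])
  have "diameter (convex hull V) = r / r0"
  proof (rule diameter_hull_eqI)
    show "finite V" by (simp add: Vz)
    show "z c r 0 \<in> V" "z c r 1 \<in> V" using assms(3) by (auto simp: Vz)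
    show "norm (z c r 0 - z c r 1) = r / r0" using S.z_Suc[of 0] by (simp add: dist)
    fix x y assume "x \<in> V" "y \<in> V"
    then obtain i j where "x = z c r i" "y = z c r j" by (auto simp: Vz)
    then show "norm (x - y) \<le> r / r0"
      using S.H_dist[OF S.z_in_H S.z_in_H, of i j] r \<open>r0 > 0\<close> by (simp only: dist) (intro mult_left_le; simp)
  qed
  then have "r = r0" using V(2) \<open>r0 > 0\<close> by simp
  show thesis
    by (rule that[of \<theta> "z c r0"]) (use reg V(3) Vz \<open>r = r0\<close> in \<open>simp_all add: z_def\<close>)
qed

context star_polygon
begin

text \<open>Closedness of a path of three unit diagonals reads
  \<open>cis (\<theta> 2) = cis (\<theta> 1) + cis (\<theta> 3)\<close>, which fixes the angle
  between the two summands and makes the vertices an equilateral triangle.\<close>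

lemma reuleaux_triangle_body:
  assumes "m = 3"
  shows "reuleaux_triangle body"
proof -
  define u where "u = cis (\<theta> 1)"
  define \<omega> where "\<omega> = cis (2 * pi / 3)"
  have w: "\<omega> = Complex (- 1 / 2) (sqrt 3 / 2)"
    using cos_120 sin_120 by (simp add: \<omega>_def complex_eq_iff)
  have w2: "\<omega> * \<omega> = - 1 - \<omega>" unfolding w by (simp add: complex_eq_iff)
  have z: "z 1 = z 0 - u" "z 2 = z 1 + cis (\<theta> 2)" "z 0 = z 2 - cis (\<theta> 3)"
    using z_Suc[of 0] z_Suc[of 1] z_Suc[of 2] z_m assms by (simp_all add: u_def numeral_2_eq_2 numeral_3_eq_3)
  then have sum: "cis (\<theta> 2) = u + cis (\<theta> 3)" by (simp add: algebra_simps)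
  have "cis (\<theta> 2) \<bullet> cis (\<theta> 2) = (u + cis (\<theta> 3)) \<bullet> (u + cis (\<theta> 3))" unfolding sum ..
  then have "cos (\<theta> 3 - \<theta> 1) = - 1 / 2"
    using cos_minus[of "\<theta> 3 - \<theta> 1"] by (simp add: u_def inner_add inner_cis)
  moreover have "0 < \<theta> 3 - \<theta> 1" "\<theta> 3 - \<theta> 1 < pi"
    using \<theta>_less[of 1 3] \<theta>_less[of 0 1] \<theta>_m assms by auto
  ultimately have "\<theta> 3 - \<theta> 1 = 2 * pi / 3"
    using cos_120 cos_inj_pi[of "\<theta> 3 - \<theta> 1" "2 * pi / 3"] by simp
  then have "\<theta> 3 = \<theta> 1 + 2 * pi / 3" by simp
  then have u3: "cis (\<theta> 3) = u * \<omega>" by (simp add: u_def \<omega>_def cis_mult)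
  \<comment> \<open>The vector from the centroid to \<open>z 0\<close>, since the other vertices are
    \<open>z 0 - u\<close> and \<open>z 0 + u * \<omega>\<close>.\<close>
  define d where "d = u * (1 - \<omega>) / 3"
  define c where "c = z 0 - d"
  have dq: "d = u / 3 * (1 - \<omega>)" by (simp add: d_def)
  have pts: "z 0 = c + d" "z 1 = c + d * \<omega> * \<omega>" "z 2 = c + d * \<omega>"
  proof -
    show "z 0 = c + d" by (simp add: c_def)
    have "d * \<omega> * \<omega> - d = - u"
    proof -
      have "(1 - \<omega>) * \<omega> * \<omega> - (1 - \<omega>) = - 2 + \<omega> + \<omega> * \<omega> - \<omega> * (\<omega> * \<omega> + \<omega> + 1) + \<omega> * \<omega> + \<omega> + 1"
        by (simp add: algebra_simps)
      also have "\<dots> = - 3" by (simp add: w2)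
      finally have e: "(1 - \<omega>) * \<omega> * \<omega> - (1 - \<omega>) = - 3" .
      have "d * \<omega> * \<omega> - d = u / 3 * ((1 - \<omega>) * \<omega> * \<omega> - (1 - \<omega>))"
        unfolding dq by (simp only: ring_distribs mult.assoc)
      then show ?thesis unfolding e by simp
    qed
    then have "z 1 = z 0 + (d * \<omega> * \<omega> - d)" using z(1) by simp
    then show "z 1 = c + d * \<omega> * \<omega>" by (simp add: c_def)
    have "d * \<omega> - d = u * \<omega>"
    proof -
      have "(1 - \<omega>) * \<omega> - (1 - \<omega>) = 2 * \<omega> - \<omega> * \<omega> - 1" by (simp add: algebra_simps)
      also have "\<dots> = 3 * \<omega>" by (simp add: w2)
      finally have e: "(1 - \<omega>) * \<omega> - (1 - \<omega>) = 3 * \<omega>" .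
      have "d * \<omega> - d = u / 3 * ((1 - \<omega>) * \<omega> - (1 - \<omega>))"
        unfolding dq by (simp only: ring_distribs mult.assoc)
      then show ?thesis unfolding e by simp
    qed
    moreover have "z 2 = z 0 + u * \<omega>" using z(3) u3 by simp
    ultimately have "z 2 = z 0 + (d * \<omega> - d)" by simp
    then show "z 2 = c + d * \<omega>" by (simp add: c_def)
  qed
  define r where "r = norm d"
  define \<phi> where "\<phi> = Arg d"
  have "\<omega> \<noteq> 1" using w by (auto simp: complex_eq_iff)
  then have d0: "d \<noteq> 0" by (simp add: d_def u_def)
  have d: "d = of_real r * cis \<phi>" using rcis_cmod_Arg[of d] by (simp add: r_def \<phi>_def rcis_def)
  have "regular_polygon_vertices 3 (z ` {..<m})"
    unfolding regular_polygon_vertices_def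
  proof (intro exI conjI)
    show "r > 0" using d0 by (simp add: r_def)
    have "z ` {..<m} = {z 0, z 1, z 2}" unfolding assms by (auto simp: numeral_3_eq_3 lessThan_Suc numeral_2_eq_2)
    also have "\<dots> = {c + d, c + d * \<omega>, c + d * \<omega> * \<omega>}" unfolding pts by auto
    also have "\<dots> = (\<lambda>j. c + of_real r * cis (\<phi> + 2 * pi * real j / real 3)) ` {..<3}"
    proof -
      have "cis (\<phi> + 2 * pi * 2 / 3) = cis \<phi> * \<omega> * \<omega>" by (simp add: \<omega>_def cis_mult algebra_simps)
      moreover have "cis (\<phi> + 2 * pi / 3) = cis \<phi> * \<omega>" by (simp add: \<omega>_def cis_mult)
      ultimately show ?thesis unfolding d by (auto simp: numeral_3_eq_3 lessThan_Suc mult_ac)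
    qed
    finally show "z ` {..<m} = (\<lambda>j. c + of_real r * cis (\<phi> + 2 * pi * real j / real 3)) ` {..<3}" .
  qed
  moreover have "diameter (convex hull (z ` {..<m})) = 1"
  proof (rule diameter_hull_eqI)
    show "z 0 \<in> z ` {..<m}" "z 1 \<in> z ` {..<m}" by (rule z_in)+
    show "norm (z 0 - z 1) = 1" using z(1) by (simp add: u_def)
    show "norm (x - y) \<le> 1" if "x \<in> z ` {..<m}" "y \<in> z ` {..<m}" for x y
      using that H_dist z_in_H by blast
  qed simp
  ultimately show ?thesis unfolding regular_reuleaux_polygon_def by blast
qed

end

section \<open>Area\<close>

lemma measurable_Complex: "(\<lambda>(x, y). Complex x y) \<in> borel_measurable (lborel \<Otimes>\<^sub>M lborel)"
proof -
  have "continuous_on UNIV (\<lambda>p :: real \<times> real. Complex (fst p) (snd p))"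
    unfolding Complex_eq by (intro continuous_intros)
  then have "(\<lambda>p :: real \<times> real. Complex (fst p) (snd p)) \<in> borel_measurable borel"
    by (rule borel_measurable_continuous_onI)
  then show ?thesis by (simp add: lborel_prod split_beta')
qed

text \<open>Identifies the area measure with a product measure, so that areas can be computed by
  slices.\<close>

lemma lborel_complex_eq_distr:
  "(lborel :: complex measure) = distr (lborel \<Otimes>\<^sub>M lborel) borel (\<lambda>(x, y). Complex x y)"
proof (rule lborel_eqI)
  fix l u :: complex assume le: "\<And>b. b \<in> Basis \<Longrightarrow> l \<bullet> b \<le> u \<bullet> b"
  have le': "Re l \<le> Re u" "Im l \<le> Im u" using le[of 1] le[of \<i>] by (auto simp: Basis_complex_def)
  have "(\<lambda>(x, y). Complex x y) -` box l u \<inter> space (lborel \<Otimes>\<^sub>M lborel) = {Re l<..<Re u} \<times> {Im l<..<Im u}"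
    by (auto simp: box_def Basis_complex_def space_pair_measure)
  then have "emeasure (distr (lborel \<Otimes>\<^sub>M lborel) borel (\<lambda>(x, y). Complex x y)) (box l u)
      = emeasure (lborel \<Otimes>\<^sub>M lborel) ({Re l<..<Re u} \<times> {Im l<..<Im u})"
    by (subst emeasure_distr[OF measurable_Complex]) simp_all
  also have "\<dots> = ennreal ((Re u - Re l) * (Im u - Im l))"
    using le' by (subst lborel.emeasure_pair_measure_Times) (simp_all add: ennreal_mult)
  also have "\<dots> = ennreal (\<Prod>b\<in>Basis. (u - l) \<bullet> b)"
    by (simp add: Basis_complex_def complex_eq_iff)
  finally show "emeasure (distr (lborel \<Otimes>\<^sub>M lborel) borel (\<lambda>(x, y). Complex x y)) (box l u)
      = (\<Prod>b\<in>Basis. (u - l) \<bullet> b)" .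
qed simp

lemma area_between_graphs:
  fixes K :: "complex set" and U L :: "real \<Rightarrow> real"
  assumes K: "compact K" and cont: "continuous_on {a..b} U" "continuous_on {a..b} L"
    and slice: "\<And>x y. Complex x y \<in> K \<longleftrightarrow> x \<in> {a..b} \<and> L x \<le> y \<and> y \<le> U x"
    and le: "\<And>x. x \<in> {a..b} \<Longrightarrow> L x \<le> U x"
  shows "measure lebesgue K = integral {a..b} U - integral {a..b} L"
proof -
  have Kb: "K \<in> sets borel" using K by (simp add: borel_closed compact_imp_closed)
  define S where "S = (\<lambda>(x, y). Complex x y) -` K \<inter> space (lborel \<Otimes>\<^sub>M lborel)"
  have Sm: "S \<in> sets (lborel \<Otimes>\<^sub>M lborel)" unfolding S_def by (rule measurable_sets[OF measurable_Complex Kb])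
  define f where "f x = (if x \<in> {a..b} then U x - L x else 0)" for x
  have "emeasure lborel K = emeasure (lborel \<Otimes>\<^sub>M lborel) S"
    unfolding S_def by (subst lborel_complex_eq_distr) (rule emeasure_distr[OF measurable_Complex Kb])
  also have "\<dots> = (\<integral>\<^sup>+x. emeasure lborel (Pair x -` S) \<partial>lborel)"
    by (rule lborel.emeasure_pair_measure_alt[OF Sm])
  also have "\<dots> = (\<integral>\<^sup>+x. ennreal (f x) \<partial>lborel)"
  proof (rule nn_integral_cong)
    fix x
    have "Pair x -` S = (if x \<in> {a..b} then {L x..U x} else {})"
      using slice by (auto simp: S_def space_pair_measure)
    then show "emeasure lborel (Pair x -` S) = ennreal (f x)" using le by (simp add: f_def)
  qed
  also have "\<dots> = ennreal (integral {a..b} U - integral {a..b} L)"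
  proof (rule nn_integral_has_integral_lborel)
    have "(\<lambda>x. indicator {a..b} x *\<^sub>R (U x - L x)) \<in> borel_measurable borel"
      by (intro borel_measurable_continuous_on_indicator continuous_intros cont) auto
    moreover have "f = (\<lambda>x. indicator {a..b} x *\<^sub>R (U x - L x))"
      by (auto simp: f_def indicator_def)
    ultimately show "f \<in> borel_measurable borel" by simp
    show "0 \<le> f x" for x using le by (simp add: f_def)
    have "((\<lambda>x. U x - L x) has_integral integral {a..b} U - integral {a..b} L) {a..b}"
      by (intro has_integral_diff integrable_integral integrable_continuous_real cont)
    then show "(f has_integral integral {a..b} U - integral {a..b} L) UNIV"
      unfolding f_def by (subst has_integral_restrict_UNIV) simp
  qed
  finally have "emeasure lborel K = ennreal (integral {a..b} U - integral {a..b} L)" .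
  moreover have "0 \<le> integral {a..b} U - integral {a..b} L"
    using integral_le[of L "{a..b}" U] cont le by (simp add: integrable_continuous_real)
  ultimately have "measure lborel K = integral {a..b} U - integral {a..b} L"
    by (simp add: measure_def)
  then show ?thesis using Kb by (simp add: measure_completion)
qed

text \<open>The abscissa \<open>g\<close> may be constant on intervals, as it is at a vertex, so it
  is not inverted; it suffices that \<open>v\<close> depends only on \<open>g\<close>. The graph of
  \<open>U\<close> is a compact image and hence closed.\<close>

lemma continuous_graph_of_curve:
  fixes g v :: "real \<Rightarrow> real"
  assumes "continuous_on {p..q} g" "continuous_on {p..q} v" "{a..b} \<subseteq> g ` {p..q}" "g ` {p..q} \<subseteq> {a..b}"
    and eq: "\<And>s t. s \<in> {p..q} \<Longrightarrow> t \<in> {p..q} \<Longrightarrow> g s = g t \<Longrightarrow> v s = v t"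
  obtains U where "continuous_on {a..b} U" "\<And>t. t \<in> {p..q} \<Longrightarrow> U (g t) = v t"
proof -
  define U where "U x = v (inv_into {p..q} g x)" for x
  have U: "U (g t) = v t" if "t \<in> {p..q}" for t
  proof -
    have "g t \<in> g ` {p..q}" using that by simp
    then show ?thesis using eq[OF inv_into_into that] f_inv_into_f[of "g t" g "{p..q}"] by (simp add: U_def)
  qed
  have graph: "(\<lambda>x. (x, U x)) ` {a..b} = (\<lambda>t. (g t, v t)) ` {p..q}"
  proof (intro set_eqI iffI)
    fix w assume "w \<in> (\<lambda>x. (x, U x)) ` {a..b}"
    then obtain t where "t \<in> {p..q}" "w = (g t, U (g t))" using assms(3) by auto
    then show "w \<in> (\<lambda>t. (g t, v t)) ` {p..q}" using U by auto
  next
    fix w assume "w \<in> (\<lambda>t. (g t, v t)) ` {p..q}"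
    then obtain t where t: "t \<in> {p..q}" "w = (g t, v t)" by blast
    moreover have "g t \<in> {a..b}" using assms(4) t(1) by blast
    ultimately have "w = (g t, U (g t))" "g t \<in> {a..b}" using U by auto
    then show "w \<in> (\<lambda>x. (x, U x)) ` {a..b}" by blast
  qed
  have "continuous_on {a..b} U"
  proof (rule continuous_from_closed_graph)
    show "compact (v ` {p..q})" by (intro compact_continuous_image assms) simp
    show "U \<in> {a..b} \<rightarrow> v ` {p..q}" using assms(3) U by fastforce
    have "compact ((\<lambda>t. (g t, v t)) ` {p..q})" by (intro compact_continuous_image continuous_intros assms) simp
    then show "closed ((\<lambda>x. (x, U x)) ` {a..b})" unfolding graph by (rule compact_imp_closed)
  qed
  then show thesis using U that by blast
qed

context constant_width
begin

lemma continuous_Re_P: "continuous_on S (\<lambda>t. Re (P t))" and continuous_Im_P: "continuous_on S (\<lambda>t. Im (P t))"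
  using continuous_P by (auto intro!: continuous_intros)

text \<open>The support map on \<open>{0..pi}\<close> traces the upper boundary and on
  \<open>{pi..2 * pi}\<close> the lower one. Substitution turns the difference of the two graph
  integrals into the counter-clockwise contour integral of y dx, which is minus the area.\<close>

lemma area_has_integral:
  assumes S: "finite S" and D: "\<And>t. t \<in> {0..2 * pi} - S \<Longrightarrow> (P has_vector_derivative D t) (at t)"
  shows "((\<lambda>t. Re (D t) * Im (P t)) has_integral - area K) {0..2 * pi}"
proof -
  define g v where "g t = Re (P t)" and "v t = Im (P t)" for t
  note contg = continuous_Re_P[folded g_def] and contv = continuous_Im_P[folded v_def]
  \<comment> \<open>Where \<open>sin t = 0\<close> the support line is vertical, and uniqueness of
    the support point replaces the comparison of ordinates.\<close>
  have extreme: "P t = y" if "y \<in> K" "Re y = g t" "sin t = 0" for t y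
  proof (rule P_eqI'[OF that(1)])
    show "cis t \<bullet> P t \<le> cis t \<bullet> y" using that by (simp add: inner_complex_def g_def)
  qed
  have top: "Im y \<le> v t" if "y \<in> K" "Re y = g t" "t \<in> {0..pi}" for t y
  proof (cases "sin t = 0")
    case True
    then show ?thesis using extreme that by (simp add: v_def)
  next
    case False
    then have "sin t > 0" using that sin_ge_zero[of t] by auto
    then show ?thesis using P_max[OF that(1), of t] that(2) by (simp add: inner_complex_def g_def v_def)
  qed
  have bot: "v t \<le> Im y" if "y \<in> K" "Re y = g t" "t \<in> {pi..2 * pi}" for t y
  proof (cases "sin t = 0")
    case True
    then show ?thesis using extreme that by (simp add: v_def)
  next
    case False
    then have "sin t < 0" using that sin_ge_zero[of "t - pi"] by (auto simp: sin_diff)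
    then show ?thesis using P_max[OF that(1), of t] that(2) by (simp add: inner_complex_def g_def v_def)
  qed
  have range: "g pi \<le> Re y" "Re y \<le> g 0" if "y \<in> K" for y
    using P_max[OF that, of 0] P_max[OF that, of pi] by (simp_all add: inner_complex_def g_def)
  have g2: "g (2 * pi) = g 0" using P_2pi[of 0] by (simp add: g_def)
  have sub: "g ` A \<subseteq> {g pi..g 0}" for A using range P_in by (auto simp: g_def)
  have onto1: "{g pi..g 0} \<subseteq> g ` {0..pi}"
  proof
    fix x assume "x \<in> {g pi..g 0}"
    then obtain t where "0 \<le> t" "t \<le> pi" "g t = x" using IVT2'[of g pi x 0] contg by auto
    then show "x \<in> g ` {0..pi}" by auto
  qed
  have onto2: "{g pi..g 0} \<subseteq> g ` {pi..2 * pi}"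
  proof
    fix x assume "x \<in> {g pi..g 0}"
    then obtain t where "pi \<le> t" "t \<le> 2 * pi" "g t = x" using IVT'[of g pi x "2 * pi"] contg g2 by auto
    then show "x \<in> g ` {pi..2 * pi}" by auto
  qed
  have PK: "P t \<in> K" "Re (P t) = g t" "Im (P t) = v t" for t by (simp_all add: P_in g_def v_def)
  obtain U where U: "continuous_on {g pi..g 0} U" "\<And>t. t \<in> {0..pi} \<Longrightarrow> U (g t) = v t"
  proof (rule continuous_graph_of_curve[of 0 pi g v "g pi" "g 0"])
    fix s t assume "s \<in> {0..pi}" "t \<in> {0..pi}" "g s = g t"
    then show "v s = v t" using top[of "P s" t] top[of "P t" s] PK by force
  qed (use contg contv onto1 sub in auto)
  obtain L where L: "continuous_on {g pi..g 0} L" "\<And>t. t \<in> {pi..2 * pi} \<Longrightarrow> L (g t) = v t"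
  proof (rule continuous_graph_of_curve[of pi "2 * pi" g v "g pi" "g 0"])
    fix s t assume "s \<in> {pi..2 * pi}" "t \<in> {pi..2 * pi}" "g s = g t"
    then show "v s = v t" using bot[of "P s" t] bot[of "P t" s] PK by force
  qed (use contg contv onto2 sub in auto)
  have ends: "Complex x (U x) \<in> K" "Complex x (L x) \<in> K" "L x \<le> U x"
    "\<And>y. Complex x y \<in> K \<Longrightarrow> L x \<le> y \<and> y \<le> U x" if x: "x \<in> {g pi..g 0}" for x
  proof -
    obtain s where s: "s \<in> {0..pi}" "x = g s" using x onto1 by blast
    obtain t where t: "t \<in> {pi..2 * pi}" "x = g t" using x onto2 by blast
    have "Complex x (U x) = P s" "Complex x (L x) = P t"
      using U(2)[OF s(1)] L(2)[OF t(1)] s t by (simp_all add: complex_eq_iff g_def v_def)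
    then show "Complex x (U x) \<in> K" "Complex x (L x) \<in> K" by (simp_all add: P_in)
    show *: "\<And>y. Complex x y \<in> K \<Longrightarrow> L x \<le> y \<and> y \<le> U x"
      using top[of _ s] bot[of _ t] s t U(2)[OF s(1)] L(2)[OF t(1)] by force
    show "L x \<le> U x" using *[OF \<open>Complex x (U x) \<in> K\<close>] by simp
  qed
  have slice: "Complex x y \<in> K \<longleftrightarrow> x \<in> {g pi..g 0} \<and> L x \<le> y \<and> y \<le> U x" for x y
  proof
    assume "Complex x y \<in> K"
    then show "x \<in> {g pi..g 0} \<and> L x \<le> y \<and> y \<le> U x" using range[of "Complex x y"] ends(4) by simp
  next
    assume h: "x \<in> {g pi..g 0} \<and> L x \<le> y \<and> y \<le> U x"
    show "Complex x y \<in> K"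
    proof (cases "L x = U x")
      case True
      then have "y = U x" using h by linarith
      then show ?thesis using h ends(1)[of x] by simp
    next
      case False
      define c where "c = (y - L x) / (U x - L x)"
      have "c * (U x - L x) = y - L x" using False by (simp add: c_def)
      then have "y = (1 - c) * L x + c * U x" by (simp add: left_diff_distrib right_diff_distrib)
      moreover have "0 \<le> c" "c \<le> 1" using h False by (simp_all add: c_def)
      ultimately have c: "0 \<le> c" "c \<le> 1" "y = (1 - c) * L x + c * U x" by blast+
      have "(1 - c) *\<^sub>R Complex x (L x) + c *\<^sub>R Complex x (U x) \<in> K"
        using ends(1,2)[of x] h c convex by (intro convexD) auto
      moreover have "(1 - c) *\<^sub>R Complex x (L x) + c *\<^sub>R Complex x (U x) = Complex x y"
        using c(3) by (simp add: complex_eq_iff algebra_simps)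
      ultimately show ?thesis by simp
    qed
  qed
  have area: "area K = integral {g pi..g 0} U - integral {g pi..g 0} L"
    unfolding area_def using U(1) L(1) slice ends(3) by (intro area_between_graphs compact) auto
  have gd: "(g has_field_derivative Re (D t)) (at t within A)" if "t \<in> {0..2 * pi} - S" for t A
  proof -
    have "(g has_vector_derivative Re (D t)) (at t)"
      unfolding g_def by (rule bounded_linear.has_vector_derivative[OF bounded_linear_Re D[OF that]])
    then show ?thesis
      by (simp add: has_real_derivative_iff_has_vector_derivative has_vector_derivative_at_within)
  qed
  have le: "g pi \<le> g 0" using range[OF P_in] by (simp add: g_def)
  have "((\<lambda>t. Re (D t) *\<^sub>R U (g t)) has_integral integral {g 0..g pi} U - integral {g pi..g 0} U) {0..pi}"
    by (rule has_integral_substitution_general[OF S _ sub U(1) contg]) (use gd in auto)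
  \<comment> \<open>The substitution rule returns two integrals, one for each order of the end
    points; here \<open>g pi \<le> g 0\<close>, so this one is over an empty or degenerate
    interval.\<close>
  moreover have "integral {g 0..g pi} U = 0" using le by (cases "g 0 = g pi") auto
  ultimately have "((\<lambda>t. Re (D t) *\<^sub>R U (g t)) has_integral - integral {g pi..g 0} U) {0..pi}" by simp
  then have 1: "((\<lambda>t. Re (D t) * v t) has_integral - integral {g pi..g 0} U) {0..pi}"
    by (rule has_integral_eq[rotated]) (simp add: U(2))
  have "((\<lambda>t. Re (D t) *\<^sub>R L (g t)) has_integral integral {g pi..g (2 * pi)} L - integral {g (2 * pi)..g pi} L) {pi..2 * pi}"
    by (rule has_integral_substitution_general[OF S _ sub L(1) contg]) (use gd in auto)
  moreover have "integral {g 0..g pi} L = 0" using le by (cases "g 0 = g pi") auto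
  ultimately have "((\<lambda>t. Re (D t) *\<^sub>R L (g t)) has_integral integral {g pi..g 0} L) {pi..2 * pi}"
    by (simp add: g2)
  then have 2: "((\<lambda>t. Re (D t) * v t) has_integral integral {g pi..g 0} L) {pi..2 * pi}"
    by (rule has_integral_eq[rotated]) (simp add: L(2))
  show ?thesis using has_integral_combine[OF _ _ 1 2] by (simp add: area v_def)
qed

text \<open>Subtracting twice the integral of y dx from that of the exact differential d(xy) leaves
  x dy - y dx, and along the boundary this is \<open>r t * (cis t \<bullet> P t)\<close>.\<close>

lemma area_support_integral:
  assumes S: "finite S"
    and D: "\<And>t. t \<in> {0..2 * pi} - S \<Longrightarrow> (P has_vector_derivative r t *\<^sub>R (\<i> * cis t)) (at t)"
  shows "((\<lambda>t. r t * (cis t \<bullet> P t)) has_integral 2 * area K) {0..2 * pi}"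
proof -
  define D where "D t = r t *\<^sub>R (\<i> * cis t)" for t
  have 1: "((\<lambda>t. Re (D t) * Im (P t)) has_integral - area K) {0..2 * pi}"
    using area_has_integral[OF S, of D] D unfolding D_def by blast
  have "((\<lambda>t. Re (D t) * Im (P t) + Re (P t) * Im (D t)) has_integral
      Re (P (2 * pi)) * Im (P (2 * pi)) - Re (P 0) * Im (P 0)) {0..2 * pi}"
  proof (rule fundamental_theorem_of_calculus_strong[OF S])
    show "continuous_on {0..2 * pi} (\<lambda>t. Re (P t) * Im (P t))"
      by (intro continuous_intros continuous_Re_P continuous_Im_P)
    fix t assume "t \<in> {0..2 * pi} - S"
    then have d: "(P has_vector_derivative D t) (at t)" using D by (simp add: D_def)
    have "((\<lambda>t. Re (P t)) has_vector_derivative Re (D t)) (at t)" "((\<lambda>t. Im (P t)) has_vector_derivative Im (D t)) (at t)"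
      by (rule bounded_linear.has_vector_derivative[OF bounded_linear_Re d],
          rule bounded_linear.has_vector_derivative[OF bounded_linear_Im d])
    then have "((\<lambda>t. Re (P t) * Im (P t)) has_vector_derivative Re (P t) * Im (D t) + Re (D t) * Im (P t)) (at t)"
      by (rule has_vector_derivative_mult)
    then show "((\<lambda>t. Re (P t) * Im (P t)) has_vector_derivative Re (D t) * Im (P t) + Re (P t) * Im (D t)) (at t)"
      by (simp only: add.commute)
  qed simp
  then have 2: "((\<lambda>t. Re (D t) * Im (P t) + Re (P t) * Im (D t)) has_integral 0) {0..2 * pi}"
    using P_2pi[of 0] by simp
  have "((\<lambda>t. (Re (D t) * Im (P t) + Re (P t) * Im (D t)) - 2 * (Re (D t) * Im (P t))) has_integral 0 - 2 * (- area K)) {0..2 * pi}"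
    by (intro has_integral_diff has_integral_mult_right 1 2)
  then show ?thesis by (simp add: D_def inner_complex_def algebra_simps)
qed

end

text \<open>Periodicity is assumed only on \<open>{a..b}\<close> because \<open>F\<close> is known
  to repeat only from \<open>\<theta> 0\<close> on.\<close>

lemma integral_period_shift:
  fixes f :: "real \<Rightarrow> real"
  assumes "a \<le> b" "0 \<le> T" "f integrable_on {a..b + T}" "\<And>t. t \<in> {a..b} \<Longrightarrow> f (t + T) = f t"
  shows "integral {b..b + T} f = integral {a..a + T} f"
proof -
  have i: "f integrable_on {c..d}" if "a \<le> c" "d \<le> b + T" for c d
    using integrable_on_subinterval[OF assms(3), of c d] that by auto
  have "((\<lambda>x. f (x + T)) has_integral integral {a + T..b + T} f) {a + T - T..b + T - T}"
    using i[of "a + T" "b + T"] assms by (intro has_integral_shift_real_ivl integrable_integral) auto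
  then have "((\<lambda>x. f (x + T)) has_integral integral {a + T..b + T} f) {a..b}" by simp
  then have "(f has_integral integral {a + T..b + T} f) {a..b}"
    by (rule has_integral_eq[rotated]) (rule assms(4))
  then have "integral {a..b} f = integral {a + T..b + T} f" by (rule integral_unique)
  moreover have "integral {a..b} f + integral {b..b + T} f = integral {a..b + T} f"
    using assms by (intro Henstock_Kurzweil_Integration.integral_combine) auto
  moreover have "integral {a..a + T} f + integral {a + T..b + T} f = integral {a..b + T} f"
    using assms by (intro Henstock_Kurzweil_Integration.integral_combine) auto
  ultimately show ?thesis by linarith
qed

lemma integral_cis_inner: 
  assumes "a \<le> b"
  shows "((\<lambda>t. cis t \<bullet> w) has_integral wedge w (cis b - cis a)) {a..b}"
proof -
  have "((\<lambda>t. cis t \<bullet> w) has_integral wedge w (cis b) - wedge w (cis a)) {a..b}"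
    using assms unfolding wedge_def inner_complex_def
    by (intro fundamental_theorem_of_calculus)
       (auto intro!: derivative_eq_intros simp: has_real_derivative_iff_has_vector_derivative[symmetric] algebra_simps)
  then show ?thesis by (simp add: wedge_diff_right)
qed

context star_polygon
begin

text \<open>\<open>F t\<close> is the sum of the values of \<open>\<rho>\<close> times the support function at \<open>t\<close> and at \<open>t + \<pi>\<close>, so the
  integral of \<open>F\<close> over half a turn is twice the area.\<close>

definition F :: "real \<Rightarrow> real" where
  "F t = \<rho> t * (cis t \<bullet> X t) + (1 - \<rho> t) * (1 - cis t \<bullet> X t)"

lemma F_pi: "\<theta> 0 \<le> t \<Longrightarrow> F (t + pi) = F t"
  by (simp add: F_def \<rho>_pi X_pi cis_add_pi inner_diff_right inner_cis)

text \<open>On this interval either \<open>t\<close> or \<open>t + pi\<close> belongs to the arc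
  about \<open>z (Suc j)\<close>, and \<open>F\<close> is 1 plus or minus
  \<open>cis t \<bullet> z (Suc j)\<close>. Integrating \<open>cis t\<close> yields the difference
  of the two neighbours of \<open>z (Suc j)\<close>; the index starts at \<open>Suc j\<close> so
  that both neighbours exist.\<close>

lemma F_integral_piece:
  "(F has_integral (\<theta> (Suc (Suc j)) - \<theta> (Suc j)) + wedge (z j) (z (Suc j)) + wedge (z (Suc j)) (z (Suc (Suc j))))
    {\<theta> (Suc j)..\<theta> (Suc (Suc j))}"
proof -
  define e :: real where "e = (if even j then 1 else - 1)"
  let ?a = "\<theta> (Suc j)" and ?b = "\<theta> (Suc (Suc j))"
  have le: "?a \<le> ?b" using \<theta>_Suc[of "Suc j"] by simp
  have "((\<lambda>t. 1 + e * (cis t \<bullet> z (Suc j))) has_integral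
      (1 * (?b - ?a)) + e * wedge (z (Suc j)) (cis ?b - cis ?a)) {?a..?b}"
    using has_integral_const_real[of "1 :: real" ?a ?b] le
    by (intro has_integral_add has_integral_mult_right integral_cis_inner) auto
  moreover have "e * wedge (z (Suc j)) (cis ?b - cis ?a)
      = wedge (z j) (z (Suc j)) + wedge (z (Suc j)) (z (Suc (Suc j)))"
  proof -
    have "e *\<^sub>R (cis ?b - cis ?a) = z (Suc (Suc j)) - z j"
      using z_Suc[of j] z_Suc[of "Suc j"] by (cases "even j") (simp_all add: e_def)
    then have "wedge (z (Suc j)) (e *\<^sub>R (cis ?b - cis ?a)) = wedge (z (Suc j)) (z (Suc (Suc j)) - z j)" by simp
    then show ?thesis by (simp add: wedge_def algebra_simps)
  qed
  ultimately have *: "((\<lambda>t. 1 + e * (cis t \<bullet> z (Suc j))) has_integral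
      (?b - ?a) + wedge (z j) (z (Suc j)) + wedge (z (Suc j)) (z (Suc (Suc j)))) {?a..?b}"
    by (simp add: add.assoc)
  show ?thesis
  proof (rule has_integral_spike_finite[OF _ _ *])
    show "finite {?b}" by simp
    fix t assume "t \<in> {?a..?b} - {?b}"
    then have t: "?a \<le> t" "t < ?b" by auto
    then have "idx t = Suc j" by (intro idx_eq)
    then show "F t = 1 + e * (cis t \<bullet> z (Suc j))"
      by (simp add: F_def \<rho>_def X_def e_def inner_add_right inner_cis)
  qed
qed

lemma F_integral_pieces:
  "(F has_integral (\<Sum>j<n. (\<theta> (Suc (Suc j)) - \<theta> (Suc j)) + wedge (z j) (z (Suc j)) + wedge (z (Suc j)) (z (Suc (Suc j)))))
    {\<theta> 1..\<theta> (Suc n)}"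
proof (induction n)
  case 0
  then show ?case using has_integral_refl(2)[of F "\<theta> 1"] by simp
next
  case (Suc n)
  show ?case unfolding sum.lessThan_Suc
    by (rule has_integral_combine[OF _ _ Suc F_integral_piece]) (use \<theta>_le[of 1 "Suc n"] \<theta>_le[of "Suc n" "Suc (Suc n)"] in auto)
qed

lemma F_integrable: "\<theta> 1 \<le> a \<Longrightarrow> F integrable_on {a..b}"
proof -
  assume a: "\<theta> 1 \<le> a"
  obtain n where "b < \<theta> n" using \<theta>_unbounded by blast
  then have "b < \<theta> (Suc n)" using \<theta>_Suc[of n] by simp
  moreover have "F integrable_on {\<theta> 1..\<theta> (Suc n)}" using F_integral_pieces by blast
  ultimately show ?thesis using a integrable_on_subinterval[of F "{\<theta> 1..\<theta> (Suc n)}" a b] by auto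
qed

lemma F_period_eq:
  assumes "\<theta> 1 \<le> a"
  shows "integral {a..a + pi} F = pi + 2 * star_sum m z"
proof -
  have "0 \<le> \<theta> 1 - \<theta> 0" using \<theta>_Suc[of 0] by simp
  then have "integral {a..a + pi} F = integral {\<theta> 1..\<theta> 1 + pi} F"
    using assms by (intro integral_period_shift F_integrable F_pi) auto
  also have "\<theta> 1 + pi = \<theta> (Suc m)" using \<theta>_period[of 1] by simp
  also have "integral {\<theta> 1..\<theta> (Suc m)} F
    = (\<Sum>j<m. (\<theta> (Suc (Suc j)) - \<theta> (Suc j)) + wedge (z j) (z (Suc j)) + wedge (z (Suc j)) (z (Suc (Suc j))))"
    by (rule integral_unique[OF F_integral_pieces])
  also have "\<dots> = (\<Sum>j<m. \<theta> (Suc (Suc j)) - \<theta> (Suc j)) + star_sum m z + (\<Sum>j<m. wedge (z (Suc j)) (z (Suc (Suc j))))"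
    by (simp add: sum.distrib star_sum_def)
  also have "(\<Sum>j<m. \<theta> (Suc (Suc j)) - \<theta> (Suc j)) = pi"
    using sum_lessThan_telescope[of "\<lambda>j. \<theta> (Suc j)" m] \<theta>_period[of 1] by simp
  also have "(\<Sum>j<m. wedge (z (Suc j)) (z (Suc (Suc j)))) = star_sum m z"
  proof -
    have "(\<Sum>j<m. wedge (z (Suc j)) (z (Suc (Suc j))) - wedge (z j) (z (Suc j))) = wedge (z m) (z (Suc m)) - wedge (z 0) (z 1)"
      using sum_lessThan_telescope[of "\<lambda>j. wedge (z j) (z (Suc j))" m] by simp
    moreover have "wedge (z m) (z (Suc m)) = wedge (z 0) (z 1)" using z_period[of 0] z_period[of 1] by simp
    ultimately show ?thesis by (simp add: sum_subtractf star_sum_def)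
  qed
  finally show ?thesis by simp
qed

lemma area_eq_integral_F:
  assumes "\<theta> 0 \<le> 0"
  shows "integral {0..pi} F = 2 * area body"
proof -
  have X: "P t = X t" "\<theta> 0 \<le> t" if "t \<ge> 0" for t using that assms P_eq_X by auto
  define S where "S = {t \<in> {0..2 * pi}. \<theta> 0 \<le> t \<and> t = \<theta> (idx t)}"
  have "((\<lambda>t. \<rho> t * (cis t \<bullet> P t)) has_integral 2 * area body) {0..2 * pi}"
  proof (rule area_support_integral)
    show "finite (insert 0 S)" using finite_switching by (simp add: S_def)
    fix t assume t: "t \<in> {0..2 * pi} - insert 0 S"
    then have "(X has_vector_derivative \<rho> t *\<^sub>R (\<i> * cis t)) (at t)"
      using assms by (intro X_deriv) (auto simp: S_def)
    then show "(P has_vector_derivative \<rho> t *\<^sub>R (\<i> * cis t)) (at t)"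
      by (rule has_vector_derivative_transform_within_open[of _ _ _ "{0<..}"]) (use t X in auto)
  qed
  then have f: "((\<lambda>t. \<rho> t * (cis t \<bullet> X t)) has_integral 2 * area body) {0..2 * pi}"
    by (rule has_integral_eq[rotated]) (simp add: X(1))
  define f where "f t = \<rho> t * (cis t \<bullet> X t)" for t
  have fi: "f integrable_on {a..b}" if "0 \<le> a" "b \<le> 2 * pi" for a b
    using f integrable_on_subinterval[of f "{0..2 * pi}" a b] that unfolding f_def by auto
  have "((\<lambda>t. f (t + pi)) has_integral integral {pi..2 * pi} f) {pi - pi..2 * pi - pi}"
    by (intro has_integral_shift_real_ivl integrable_integral fi) auto
  then have 1: "((\<lambda>t. f (t + pi)) has_integral integral {pi..2 * pi} f) {0..pi}" by simp
  have "((\<lambda>t. f t + f (t + pi)) has_integral integral {0..pi} f + integral {pi..2 * pi} f) {0..pi}"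
    by (intro has_integral_add integrable_integral fi 1) auto
  moreover have "integral {0..pi} f + integral {pi..2 * pi} f = integral {0..2 * pi} f"
    by (intro Henstock_Kurzweil_Integration.integral_combine fi) auto
  moreover have "integral {0..2 * pi} f = 2 * area body" using f unfolding f_def by (rule integral_unique)
  ultimately have "((\<lambda>t. f t + f (t + pi)) has_integral 2 * area body) {0..pi}" by simp
  moreover have "f t + f (t + pi) = F t" if "t \<in> {0..pi}" for t
  proof -
    have "\<theta> 0 \<le> t" using X(2) that by simp
    then show ?thesis unfolding f_def F_def
      by (simp only: \<rho>_pi X_pi cis_add_pi) (simp add: inner_diff_right inner_cis algebra_simps)
  qed
  ultimately have "(F has_integral 2 * area body) {0..pi}" by (rule has_integral_eq[rotated])
  then show ?thesis by (rule integral_unique)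
qed

lemma star_polygon_shift_angle: "star_polygon m (\<lambda>j. \<theta> j - 2 * pi * real k) z"
proof -
  have "cis (t - 2 * pi * real k) = cis t" for t
    using cis_multiple_2pi[of "real k"] by (simp add: cis_divide[symmetric])
  then show ?thesis using odd_m \<theta>_Suc \<theta>_period z_Suc z_period by unfold_locales auto
qed

text \<open>The area integral starts at direction 0, but \<open>X\<close> is meaningful only from
  \<open>\<theta> 0\<close> and the pieces of \<open>F\<close> start at \<open>\<theta> 1\<close>;
  full turns move both below 0.\<close>

lemma ex_shift_angle: "\<exists>\<theta>'. star_polygon m \<theta>' z \<and> \<theta>' 1 \<le> 0"
proof -
  obtain k :: nat where "real k \<ge> \<theta> 1 / (2 * pi)" using real_arch_simple by blast
  then have "\<theta> 1 - 2 * pi * real k \<le> 0" by (simp add: field_simps)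
  then show ?thesis using star_polygon_shift_angle by blast
qed

lemma area_body: "area body = pi / 2 + star_sum m z"
proof -
  obtain \<theta>' where \<theta>': "star_polygon m \<theta>' z" "\<theta>' 1 \<le> 0" using ex_shift_angle by blast
  interpret T: star_polygon m \<theta>' z by fact
  have "\<theta>' 0 \<le> 0" using T.\<theta>_Suc[of 0] \<theta>'(2) by simp
  then show ?thesis using T.area_eq_integral_F T.F_period_eq[OF \<theta>'(2)] by simp
qed

end

section \<open>The lower area bound\<close>

context constant_width
begin

lemma support_pi: "cis (t + pi) \<bullet> P (t + pi) = 1 - cis t \<bullet> P t"
  by (simp add: cis_add_pi P_pi inner_diff_right inner_cis)

text \<open>Adding \<open>pi\<close> to the angle replaces the sum by 3 minus itself, so the value
  3/2 is attained. It means that the centre lines of the three strips of width 1 meet in one point,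
  which makes the circumscribed hexagon regular.\<close>

lemma ex_hexagon_angle:
  "\<exists>t\<ge>a. cis t \<bullet> P t + cis (t + 2 * pi / 3) \<bullet> P (t + 2 * pi / 3) + cis (t + 4 * pi / 3) \<bullet> P (t + 4 * pi / 3) = 3 / 2"
proof -
  define f where "f t = cis t \<bullet> P t + cis (t + 2 * pi / 3) \<bullet> P (t + 2 * pi / 3)
    + cis (t + 4 * pi / 3) \<bullet> P (t + 4 * pi / 3)" for t
  have "t + pi + d = t + d + pi" for t d by simp
  then have f: "f (t + pi) = 3 - f t" for t unfolding f_def by (simp only: support_pi)
  have "continuous_on S (\<lambda>t. cis (t + d) \<bullet> P (t + d))" for S d
    by (intro continuous_intros continuous_on_compose2[OF continuous_P[of UNIV]]) auto
  from this[of _ 0] this have cont: "continuous_on S f" for S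
    unfolding f_def by (intro continuous_on_add) simp_all
  have "\<exists>t. a \<le> t \<and> t \<le> a + pi \<and> f t = 3 / 2"
  proof (cases "f a \<le> 3 / 2")
    case True
    then show ?thesis using f[of a] by (intro IVT' cont) auto
  next
    case False
    then show ?thesis using f[of a] by (intro IVT2' cont) auto
  qed
  then show ?thesis unfolding f_def by blast
qed

text \<open>The supporting strips of width 1 in the directions \<open>s\<close> and \<open>s + \<pi>/3\<close> have the common centre \<open>g\<close>;
  the right-hand side belongs to the support function of their intersection.\<close>

lemma support_le_hexagon:
  assumes "cis s \<bullet> P s = 1 / 2 + cis s \<bullet> g" "cis (s + pi / 3) \<bullet> P (s + pi / 3) = 1 / 2 + cis (s + pi / 3) \<bullet> g"
    and t: "s \<le> t" "t \<le> s + pi / 3"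
  shows "\<bar>cis t \<bullet> P t - 1 / 2 - cis t \<bullet> g\<bar> \<le> cis t \<bullet> ((cis s + cis (s + pi / 3)) /\<^sub>R 3) - 1 / 2"
proof -
  define s' where "s' = s + pi / 3"
  \<comment> \<open>The vertex of the hexagon between the two sides, seen from the centre
    \<open>g\<close>; the factor 1/3 gives it the component 1/2 along both normals.\<close>
  define v where "v = (cis s + cis s') /\<^sub>R 3"
  define A B where "A = sin (s' - t)" and "B = sin (t - s)"
  have AB: "0 \<le> A" "0 \<le> B" using t by (auto simp: A_def B_def s'_def intro!: sin_ge_zero)
  have S: "sin (pi / 3) > (0::real)" by (intro sin_gt_zero) auto
  have comb: "sin (pi / 3) * (cis t \<bullet> w) = A * (cis s \<bullet> w) + B * (cis s' \<bullet> w)" for w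
    using arg_cong[OF cis_combine[of s' s t], of "\<lambda>u. u \<bullet> w"]
    by (simp add: s'_def A_def B_def inner_add_left)
  have v: "cis s \<bullet> v = 1 / 2" "cis s' \<bullet> v = 1 / 2"
    by (simp_all add: v_def s'_def inner_add_right inner_cis cos_60)
  have "sin (pi / 3) * (cis t \<bullet> P t - cis t \<bullet> g) = A * (cis s \<bullet> P t - cis s \<bullet> g) + B * (cis s' \<bullet> P t - cis s' \<bullet> g)"
    using comb[of "P t - g"] by (simp add: inner_diff_right)
  also have "\<dots> \<le> A * (1 / 2) + B * (1 / 2)"
    using P_max[OF P_in, of s t] P_max[OF P_in, of s' t] assms AB
    by (intro add_mono mult_left_mono) (auto simp: s'_def)
  also have "\<dots> = sin (pi / 3) * (cis t \<bullet> v)" unfolding comb v ..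
  finally have 1: "cis t \<bullet> P t - cis t \<bullet> g \<le> cis t \<bullet> v" using S by simp
  \<comment> \<open>The same estimate is repeated for the opposite support point; since opposite
    support values add up to 1, this gives the other half of the absolute value.\<close>
  have opp: "- cis r \<bullet> P (t + pi) \<le> 1 - cis r \<bullet> P r" for r
    using P_max[OF P_in, of "r + pi" "t + pi"] support_pi[of r] by (simp add: cis_add_pi)
  have "sin (pi / 3) * (- cis t \<bullet> P (t + pi) + cis t \<bullet> g)
      = A * (- cis s \<bullet> P (t + pi) + cis s \<bullet> g) + B * (- cis s' \<bullet> P (t + pi) + cis s' \<bullet> g)"
    using comb[of "g - P (t + pi)"] by (simp add: inner_diff_right)
  also have "\<dots> \<le> A * (1 / 2) + B * (1 / 2)"
    using opp[of s] opp[of s'] assms AB by (intro add_mono mult_left_mono) (auto simp: s'_def)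
  also have "\<dots> = sin (pi / 3) * (cis t \<bullet> v)" unfolding comb v ..
  finally have "- cis t \<bullet> P (t + pi) + cis t \<bullet> g \<le> cis t \<bullet> v" using S by simp
  moreover have "- cis t \<bullet> P (t + pi) = 1 - cis t \<bullet> P t" using support_pi[of t] by (simp add: cis_add_pi)
  ultimately have "1 - cis t \<bullet> P t + cis t \<bullet> g \<le> cis t \<bullet> v" by simp
  then show ?thesis using 1 unfolding v_def s'_def by linarith
qed

end

context star_polygon
begin

text \<open>\<open>F - 1 / 2\<close> is plus or minus the support value minus 1/2, so the hexagon
  bounds it from below on both kinds of intervals. The terms with \<open>g\<close> are integrated
  exactly, because they cancel over a half turn.\<close>

lemma F_integral_hexagon:
  assumes s: "\<theta> 1 \<le> s"
    and g: "cis s \<bullet> P s = 1 / 2 + cis s \<bullet> g" "cis (s + pi / 3) \<bullet> P (s + pi / 3) = 1 / 2 + cis (s + pi / 3) \<bullet> g"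
  shows "pi / 3 - sqrt 3 / 3 + 2 * wedge g (X (s + pi / 3) - X s) - wedge g (cis (s + pi / 3) - cis s)
    \<le> integral {s..s + pi / 3} F"
proof -
  define s' where "s' = s + pi / 3"
  define v where "v = (cis s + cis s') /\<^sub>R 3"
  have s0: "\<theta> 0 \<le> s" using s \<theta>_Suc[of 0] by simp
  have le: "s \<le> s'" by (simp add: s'_def)
  have I: "((\<lambda>t. 1 + (2 * (\<rho> t * (cis t \<bullet> g)) - cis t \<bullet> g) - cis t \<bullet> v) has_integral
      (pi / 3) + (2 * wedge g (X s' - X s) - wedge g (cis s' - cis s)) - wedge v (cis s' - cis s)) {s..s'}"
    using has_integral_const_real[of "1 :: real" s s']
    by (intro has_integral_diff has_integral_add has_integral_mult_right X_inner_integral integral_cis_inner s0 le)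
       (simp add: s'_def)
  have "wedge v (cis s' - cis s) = 2 / 3 * wedge (cis s) (cis s')"
    by (simp add: v_def wedge_def field_simps)
  also have "\<dots> = sqrt 3 / 3" unfolding wedge_cis by (simp add: s'_def sin_60)
  finally have w: "wedge v (cis s' - cis s) = sqrt 3 / 3" .
  have "(pi / 3) + (2 * wedge g (X s' - X s) - wedge g (cis s' - cis s)) - wedge v (cis s' - cis s) \<le> integral {s..s'} F"
  proof (rule has_integral_le[OF I integrable_integral[OF F_integrable[OF s]]])
    fix t assume t: "t \<in> {s..s'}"
    have "P t = X t" using t s0 by (intro P_eq_X) auto
    then have b: "\<bar>cis t \<bullet> X t - 1 / 2 - cis t \<bullet> g\<bar> \<le> cis t \<bullet> v - 1 / 2"
      using support_le_hexagon[OF g, of t] t unfolding v_def s'_def by simp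
    have "\<rho> t = 0 \<or> \<rho> t = 1" by (simp add: \<rho>_def)
    then show "1 + (2 * (\<rho> t * (cis t \<bullet> g)) - cis t \<bullet> g) - cis t \<bullet> v \<le> F t"
      using b by (auto simp: F_def)
  qed
  then show ?thesis unfolding w unfolding s'_def by simp
qed

lemma area_body_ge: "(pi - sqrt 3) / 2 \<le> area body"
proof -
  obtain s where s: "\<theta> 1 \<le> s" and sum: "cis s \<bullet> P s + cis (s + 2 * pi / 3) \<bullet> P (s + 2 * pi / 3)
      + cis (s + 4 * pi / 3) \<bullet> P (s + 4 * pi / 3) = 3 / 2"
    using ex_hexagon_angle by blast
  define a b where "a = cis s" and "b = cis (s + 2 * pi / 3)"
  define p q where "p = a \<bullet> P s - 1 / 2" and "q = b \<bullet> P (s + 2 * pi / 3) - 1 / 2"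
  define w where "w = wedge a b"
  have w: "w > 0" by (simp add: w_def a_def b_def wedge_cis sin_120)
  have c: "cis (s + 4 * pi / 3) = - a - b"
  proof -
    have "s + 4 * pi / 3 = s + pi / 3 + pi" by simp
    moreover have "cis (s + 2 * pi / 3) + cis s = (2 * cos (pi / 3)) *\<^sub>R cis (s + pi / 3)"
      using cis_add_cis[of s "2 * pi / 3"] by simp
    ultimately show ?thesis by (simp only: cis_add_pi) (simp add: a_def b_def cos_60 algebra_simps)
  qed
  \<comment> \<open>Up to the factor \<open>w\<close> this is the dual basis of \<open>a\<close>,
    \<open>b\<close>; it produces the point \<open>g\<close> with prescribed components along
    both.\<close>
  define a' b' where "a' = \<i> * a" and "b' = - \<i> * b"
  define g where "g = (p / w) *\<^sub>R b' + (q / w) *\<^sub>R a'"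
  have g: "a \<bullet> g = p" "b \<bullet> g = q"
  proof -
    have "a \<bullet> b' = w" "a \<bullet> a' = 0" "b \<bullet> b' = 0" "b \<bullet> a' = w"
      by (simp_all add: a'_def b'_def w_def wedge_def inner_complex_def algebra_simps)
    then show "a \<bullet> g = p" "b \<bullet> g = q" using w by (simp_all add: g_def inner_add_right)
  qed
  define H where "H t \<longleftrightarrow> cis t \<bullet> P t = 1 / 2 + cis t \<bullet> g" for t
  have H0: "H s" and H2: "H (s + 2 * pi / 3)"
    using g by (simp_all add: H_def p_def q_def a_def b_def)
  \<comment> \<open>The third condition follows from the choice of \<open>s\<close>, because the
    three directions add up to 0.\<close>
  have H4: "H (s + 4 * pi / 3)"
    using sum g unfolding H_def c by (simp add: p_def q_def a_def b_def inner_diff_left)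
  have Hpi: "H t \<longleftrightarrow> H (t + pi)" for t
    unfolding H_def support_pi by (auto simp: cis_add_pi)
  have H1: "H (s + pi / 3)" using H4 Hpi[of "s + pi / 3"] by (simp add: add.assoc)
  have H3: "H (s + pi)" using H0 Hpi by blast
  define t1 t2 where "t1 = s + pi / 3" and "t2 = s + 2 * pi / 3"
  have t: "t1 + pi / 3 = t2" "t2 + pi / 3 = s + pi" by (simp_all add: t1_def t2_def)
  have th: "\<theta> 1 \<le> t1" "\<theta> 1 \<le> t2" using s by (simp_all add: t1_def t2_def add_increasing2)
  have h1: "H t1" and h2: "H t2" using H1 H2 by (simp_all add: t1_def t2_def)
  have i0: "pi / 3 - sqrt 3 / 3 + 2 * wedge g (X t1 - X s) - wedge g (cis t1 - cis s) \<le> integral {s..t1} F"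
    using F_integral_hexagon[OF s] H0 h1 unfolding H_def t1_def by blast
  have i1: "pi / 3 - sqrt 3 / 3 + 2 * wedge g (X t2 - X t1) - wedge g (cis t2 - cis t1) \<le> integral {t1..t2} F"
    using F_integral_hexagon[OF th(1), of g] h1 h2 unfolding H_def t by blast
  have i2: "pi / 3 - sqrt 3 / 3 + 2 * wedge g (X (s + pi) - X t2) - wedge g (cis (s + pi) - cis t2) \<le> integral {t2..s + pi} F"
    using F_integral_hexagon[OF th(2), of g] h2 H3 unfolding H_def t by blast
  have "integral {s..t1} F + integral {t1..t2} F = integral {s..t2} F"
    using s by (intro Henstock_Kurzweil_Integration.integral_combine F_integrable) (auto simp: t1_def t2_def)
  moreover have "integral {s..t2} F + integral {t2..s + pi} F = integral {s..s + pi} F"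
    using s by (intro Henstock_Kurzweil_Integration.integral_combine F_integrable) (auto simp: t2_def)
  moreover have "integral {s..s + pi} F = 2 * area body" using F_period_eq[OF s] area_body by simp
  \<comment> \<open>Over the half turn \<open>X\<close> changes by \<open>- cis s\<close> and
    \<open>cis\<close> by \<open>- 2 * cis s\<close>, so the position of the centre drops
    out.\<close>
  moreover have "2 * wedge g (X (s + pi) - X s) - wedge g (cis (s + pi) - cis s) = 0"
  proof -
    have X_s: "X (s + pi) = X s - cis s" using s \<theta>_Suc[of 0] by (intro X_pi) simp
    show ?thesis unfolding X_s cis_add_pi by (simp add: wedge_def algebra_simps)
  qed
  moreover have "pi - sqrt 3 + (2 * wedge g (X (s + pi) - X s) - wedge g (cis (s + pi) - cis s))
      \<le> integral {s..t1} F + integral {t1..t2} F + integral {t2..s + pi} F"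
    using add_mono[OF add_mono[OF i0 i1] i2] unfolding wedge_diff_right by (simp add: field_simps)
  ultimately show ?thesis by simp
qed

end

section \<open>The star polygon of a Reuleaux polygon\<close>

locale reuleaux = constant_width +
  fixes C assumes finite_C: "finite C" and K_eq: "K = disk_intersection C"
begin

definition vertex_angles :: "real set" where "vertex_angles = {t. P t \<in> vertices K}"
definition antipodal_angles :: "real set" where "antipodal_angles = {t. P (t + pi) \<in> vertices K}"

lemma finite_vertices: "finite (vertices K)"
  using vertices_subset_centers(1)[OF finite_C K_eq] finite_C finite_subset by blast

lemma vertex_or_antipodal: "t \<in> vertex_angles \<or> t \<in> antipodal_angles"
  using support_or_opposite_vertex[OF finite_C K_eq] by (simp add: vertex_angles_def antipodal_angles_def)

lemma closed_vertex_angles: "closed vertex_angles" and closed_antipodal_angles: "closed antipodal_angles"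
proof -
  have cl: "closed ((\<lambda>s. P (s + d)) -` vertices K)" for d
    using finite_vertices
    by (intro closed_vimage finite_imp_closed continuous_on_compose2[OF continuous_P[of UNIV]] continuous_intros) auto
  from cl[of 0] cl[of pi] show "closed vertex_angles" "closed antipodal_angles" by (simp_all add: vertex_angles_def antipodal_angles_def vimage_def)
qed

lemma vertex_angles_pi: "t + pi \<in> vertex_angles \<longleftrightarrow> t \<in> antipodal_angles" and antipodal_angles_pi: "t + pi \<in> antipodal_angles \<longleftrightarrow> t \<in> vertex_angles"
proof -
  have e: "t + pi + pi = t + 2 * pi" by simp
  show "t + pi \<in> vertex_angles \<longleftrightarrow> t \<in> antipodal_angles" by (simp add: vertex_angles_def antipodal_angles_def)
  show "t + pi \<in> antipodal_angles \<longleftrightarrow> t \<in> vertex_angles" unfolding vertex_angles_def antipodal_angles_def mem_Collect_eq e P_2pi ..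
qed

text \<open>These are the directions of the unit diagonals: both ends \<open>P t\<close> and
  \<open>P (t + pi)\<close> are vertices, and their difference is \<open>cis t\<close>.\<close>

definition switching_angles :: "real set" where "switching_angles = vertex_angles \<inter> antipodal_angles"

lemma switching_angles_pi: "t + pi \<in> switching_angles \<longleftrightarrow> t \<in> switching_angles"
  unfolding switching_angles_def using vertex_angles_pi antipodal_angles_pi by blast

text \<open>The line is connected and covered by two nonempty closed sets, which therefore
  meet.\<close>

lemma ex_switching_angle: "\<exists>t. t \<in> switching_angles"
proof (rule ccontr)
  assume no: "\<nexists>t. t \<in> switching_angles"
  have "vertex_angles \<noteq> {}" "antipodal_angles \<noteq> {}" using vertex_or_antipodal vertex_angles_pi antipodal_angles_pi by blast+
  moreover have "UNIV \<subseteq> vertex_angles \<union> antipodal_angles" "vertex_angles \<inter> antipodal_angles \<inter> UNIV = {}" using vertex_or_antipodal no unfolding switching_angles_def by blast+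
  ultimately show False
    using connected_UNIV[where 'a = real] closed_vertex_angles closed_antipodal_angles unfolding connected_closed by blast
qed

text \<open>\<open>cis t\<close> is a difference of two of the finitely many vertices, and
  \<open>cis\<close> is injective on such a short interval.\<close>

lemma finite_switching_angles: "b \<le> a + pi \<Longrightarrow> finite (switching_angles \<inter> {a..b})"
proof -
  assume b: "b \<le> a + pi"
  have "b - a < 2 * pi" using b pi_gt_zero by linarith
  then have "inj_on cis (switching_angles \<inter> {a..b})"
    using inj_on_cis_interval inj_on_subset by blast
  moreover have "cis ` (switching_angles \<inter> {a..b}) \<subseteq> (\<lambda>(x, y). x - y) ` (vertices K \<times> vertices K)"
  proof (rule image_subsetI)
    fix t assume "t \<in> switching_angles \<inter> {a..b}"
    then have "P t \<in> vertices K" "P (t + pi) \<in> vertices K" by (auto simp: switching_angles_def vertex_angles_def antipodal_angles_def)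
    moreover have "cis t = P t - P (t + pi)" by (simp add: P_pi)
    ultimately show "cis t \<in> (\<lambda>(x, y). x - y) ` (vertices K \<times> vertices K)" by auto
  qed
  then have "finite (cis ` (switching_angles \<inter> {a..b}))"
    by (rule finite_subset) (intro finite_imageI finite_cartesian_product finite_vertices)
  ultimately show ?thesis using finite_imageD by blast
qed

definition consecutive :: "real \<Rightarrow> real \<Rightarrow> bool" where
  "consecutive s t \<longleftrightarrow> s \<in> switching_angles \<and> t \<in> switching_angles \<and> s < t \<and> (\<forall>r. s < r \<longrightarrow> r < t \<longrightarrow> r \<notin> switching_angles)"

lemma consecutive_unique: "consecutive s t \<Longrightarrow> consecutive s t' \<Longrightarrow> t = t'"
  unfolding consecutive_def by (meson linorder_neqE)

lemma consecutive_pi: "consecutive s t \<Longrightarrow> consecutive (s + pi) (t + pi)"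
  unfolding consecutive_def
proof (intro conjI allI impI)
  assume h: "s \<in> switching_angles \<and> t \<in> switching_angles \<and> s < t \<and> (\<forall>r. s < r \<longrightarrow> r < t \<longrightarrow> r \<notin> switching_angles)"
  then show "s + pi \<in> switching_angles" "t + pi \<in> switching_angles" "s + pi < t + pi" by (simp_all add: switching_angles_pi)
  fix r assume "s + pi < r" "r < t + pi"
  then have "r - pi \<notin> switching_angles" using h by simp
  then show "r \<notin> switching_angles" using switching_angles_pi[of "r - pi"] by simp
qed

lemma ex_consecutive: "s \<in> switching_angles \<Longrightarrow> \<exists>t. consecutive s t"
proof -
  assume s: "s \<in> switching_angles"
  define F where "F = switching_angles \<inter> {s..s + pi} - {s}"
  have F: "finite F" "F \<noteq> {}" using finite_switching_angles[of "s + pi" s] s switching_angles_pi[of s] by (auto simp: F_def)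
  define t where "t = Min F"
  have "t \<in> F" unfolding t_def by (rule Min_in[OF F])
  moreover have "r \<notin> switching_angles" if "s < r" "r < t" for r
  proof
    assume "r \<in> switching_angles"
    then have "r \<in> F" using that \<open>t \<in> F\<close> by (auto simp: F_def)
    then show False using Min_le[OF F(1), of r] that by (simp add: t_def)
  qed
  ultimately show ?thesis using s unfolding consecutive_def F_def by (intro exI[of _ t]) auto
qed

text \<open>Between consecutive switching angles the two closed sets are disjoint, so by
  connectedness one of them covers everything.\<close>

lemma consecutive_cases:
  assumes "consecutive s t"
  shows "{s..t} \<subseteq> vertex_angles \<or> {s..t} \<subseteq> antipodal_angles"
proof -
  have "vertex_angles \<inter> antipodal_angles \<inter> {s<..<t} = {}" using assms by (auto simp: consecutive_def switching_angles_def)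
  moreover have "{s<..<t} \<subseteq> vertex_angles \<union> antipodal_angles" using vertex_or_antipodal by blast
  moreover have "connected {s<..<t}" by simp
  ultimately have "vertex_angles \<inter> {s<..<t} = {} \<or> antipodal_angles \<inter> {s<..<t} = {}"
    using closed_vertex_angles closed_antipodal_angles unfolding connected_closed by blast
  then have "{s<..<t} \<subseteq> antipodal_angles \<or> {s<..<t} \<subseteq> vertex_angles" using vertex_or_antipodal by blast
  moreover have "s \<in> vertex_angles" "s \<in> antipodal_angles" "t \<in> vertex_angles" "t \<in> antipodal_angles" using assms by (auto simp: consecutive_def switching_angles_def)
  moreover have "{s..t} = {s<..<t} \<union> {s, t}" using assms by (auto simp: consecutive_def)
  ultimately show ?thesis by blast
qed

lemma constant_on_vertex_angles: "{s..t} \<subseteq> vertex_angles \<Longrightarrow> r \<in> {s..t} \<Longrightarrow> P r = P s"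
proof -
  assume h: "{s..t} \<subseteq> vertex_angles" "r \<in> {s..t}"
  have "P constant_on {s..t}"
  proof (rule continuous_finite_range_constant)
    show "finite (P ` {s..t})" using h(1) by (intro finite_subset[OF _ finite_vertices]) (auto simp: vertex_angles_def)
  qed (auto intro: continuous_P)
  then show ?thesis using h(2) unfolding constant_on_def by auto
qed

lemma shift_antipodal_angles: "{s..t} \<subseteq> antipodal_angles \<Longrightarrow> {s + pi..t + pi} \<subseteq> vertex_angles"
proof
  fix x assume h: "{s..t} \<subseteq> antipodal_angles" "x \<in> {s + pi..t + pi}"
  then have "x - pi \<in> antipodal_angles" by auto
  then show "x \<in> vertex_angles" using vertex_angles_pi[of "x - pi"] by simp
qed

lemma constant_on_antipodal_angles: "{s..t} \<subseteq> antipodal_angles \<Longrightarrow> r \<in> {s..t} \<Longrightarrow> P (r + pi) = P (s + pi)"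
  by (rule constant_on_vertex_angles[OF shift_antipodal_angles]) auto

text \<open>The normal cone of a vertex is nondegenerate, so it occupies one side of a switching angle,
  and the opposite cone of the other vertex occupies the other side.\<close>

lemma not_vertex_angles_twice:
  assumes st: "consecutive s t" "consecutive t r"
  shows "\<not> ({s..t} \<subseteq> vertex_angles \<and> {t..r} \<subseteq> vertex_angles)"
proof -
  have tT: "P t \<in> vertices K" "P (t + pi) \<in> vertices K"
    using st by (auto simp: consecutive_def switching_angles_def vertex_angles_def antipodal_angles_def)
  have lt: "s < t" "t < r" and no: "\<And>x. s < x \<Longrightarrow> x < t \<Longrightarrow> x \<notin> switching_angles" "\<And>x. t < x \<Longrightarrow> x < r \<Longrightarrow> x \<notin> switching_angles"
    using st by (auto simp: consecutive_def)
  show "\<not> ({s..t} \<subseteq> vertex_angles \<and> {t..r} \<subseteq> vertex_angles)"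
  proof
    assume h: "{s..t} \<subseteq> vertex_angles \<and> {t..r} \<subseteq> vertex_angles"
    obtain \<delta> where \<delta>: "\<delta> > 0"
      "(\<forall>x\<in>{0..\<delta>}. P (t + pi + x) = P (t + pi)) \<or> (\<forall>x\<in>{0..\<delta>}. P (t + pi - x) = P (t + pi))"
      using vertex_interval[OF tT(2) refl] .
    define u v where "u = (t - s) / 2" and "v = (r - t) / 2"
    have uv: "0 < u" "u < t - s" "0 < v" "v < r - t" using lt by (simp_all add: u_def v_def)
    define e where "e = min \<delta> (min u v)"
    have e: "0 < e" "e \<le> \<delta>" "e < t - s" "e < r - t" using \<delta>(1) uv by (auto simp: e_def)
    have "t + e \<in> vertex_angles" "t - e \<in> vertex_angles" using h e by auto
    moreover have "t + e \<in> antipodal_angles \<or> t - e \<in> antipodal_angles"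
    proof -
      have "P (t + pi + e) \<in> vertices K \<or> P (t + pi - e) \<in> vertices K" using \<delta>(2) e tT(2) by auto
      moreover have "t + pi + e = t + e + pi" "t + pi - e = t - e + pi" by simp_all
      ultimately show ?thesis unfolding antipodal_angles_def by simp
    qed
    ultimately have "t + e \<in> switching_angles \<or> t - e \<in> switching_angles" unfolding switching_angles_def by blast
    then show False using no(1)[of "t - e"] no(2)[of "t + e"] e by auto
  qed
qed

lemma not_antipodal_angles_twice:
  "consecutive s t \<Longrightarrow> consecutive t r \<Longrightarrow> \<not> ({s..t} \<subseteq> antipodal_angles \<and> {t..r} \<subseteq> antipodal_angles)"
  using not_vertex_angles_twice[OF consecutive_pi consecutive_pi] shift_antipodal_angles by blast

text \<open>Successive switching angles serve as \<open>\<theta>\<close>. The two types of intervals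
  alternate, and the iteration starts with a normal cone of a vertex to match the parity convention
  of \<open>star_polygon\<close>. Both shapes then have the same support points, hence
  coincide.\<close>

lemma ex_star_polygon: "\<exists>m \<theta> z. star_polygon m \<theta> z \<and> K = disk_intersection (z ` {..<m})"
proof -
  have "\<exists>n. \<forall>s\<in>switching_angles. consecutive s (n s)" using ex_consecutive by metis
  then obtain n where n: "\<And>s. s \<in> switching_angles \<Longrightarrow> consecutive s (n s)" by blast
  have nT: "n s \<in> switching_angles" if "s \<in> switching_angles" for s using n[OF that] by (simp add: consecutive_def)
  obtain t1 where t1: "t1 \<in> switching_angles" using ex_switching_angle by blast
  have "\<exists>t\<in>switching_angles. {t..n t} \<subseteq> vertex_angles"
  proof (cases "{t1..n t1} \<subseteq> vertex_angles")
    case False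
    then have "{t1..n t1} \<subseteq> antipodal_angles" using consecutive_cases[OF n[OF t1]] by blast
    then have "{n t1..n (n t1)} \<subseteq> vertex_angles"
      using not_antipodal_angles_twice[OF n[OF t1] n[OF nT[OF t1]]] consecutive_cases[OF n[OF nT[OF t1]]] by blast
    then show ?thesis using nT[OF t1] by blast
  qed (use t1 in blast)
  then obtain t0 where t0: "t0 \<in> switching_angles" "{t0..n t0} \<subseteq> vertex_angles" by blast
  define \<theta> where "\<theta> j = (n ^^ j) t0" for j
  have \<theta>0: "\<theta> 0 = t0" and \<theta>S: "\<theta> (Suc j) = n (\<theta> j)" for j by (simp_all add: \<theta>_def)
  have \<theta>switching_angles: "\<theta> j \<in> switching_angles" for j by (induction j) (use t0 nT in \<open>auto simp: \<theta>0 \<theta>S\<close>)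
  have cons: "consecutive (\<theta> j) (\<theta> (Suc j))" for j unfolding \<theta>S by (rule n[OF \<theta>switching_angles])
  then have inc: "\<theta> j < \<theta> (Suc j)" for j by (simp add: consecutive_def)
  then have less: "\<theta> i < \<theta> j" if "i < j" for i j using that by (rule lift_Suc_mono_less)
  have type: "{\<theta> j..\<theta> (Suc j)} \<subseteq> (if even j then vertex_angles else antipodal_angles)" for j
  proof (induction j)
    case 0
    then show ?case using t0 by (simp add: \<theta>0 \<theta>S)
  next
    case (Suc j)
    then show ?case using not_vertex_angles_twice[OF cons[of j] cons[of "Suc j"]] not_antipodal_angles_twice[OF cons[of j] cons[of "Suc j"]] consecutive_cases[OF cons[of "Suc j"]]
      by (cases "even j") auto
  qed
  have ex: "\<exists>j. \<theta> j > t0 + pi"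
  proof (rule ccontr)
    assume "\<nexists>j. \<theta> j > t0 + pi"
    then have "\<theta> j \<le> t0 + pi" for j by (meson not_le)
    moreover have "t0 \<le> \<theta> j" for j using less[of 0 j] \<theta>0 by (cases "j = 0") auto
    ultimately have "range \<theta> \<subseteq> switching_angles \<inter> {t0..t0 + pi}" using \<theta>switching_angles by auto
    then have "finite (range \<theta>)" using finite_switching_angles[of "t0 + pi" t0] finite_subset by blast
    moreover have "inj \<theta>" using inc by (intro strict_mono_imp_inj_on) (simp add: strict_mono_Suc_iff)
    ultimately show False using finite_imageD by blast
  qed
  \<comment> \<open>\<open>t0 + pi\<close> is itself a switching angle, so the last iterate not
    beyond it equals it, and the index of that iterate is the period.\<close>
  define N where "N = (LEAST j. \<theta> j > t0 + pi)"
  have N: "\<theta> N > t0 + pi" unfolding N_def using ex by (rule LeastI_ex)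
  have "N \<noteq> 0" using N \<theta>0 by (cases "N = 0") auto
  then obtain m where m: "N = Suc m" by (cases N) auto
  have "\<theta> m \<le> t0 + pi" using not_less_Least[of m "\<lambda>j. \<theta> j > t0 + pi"] m unfolding N_def by simp
  moreover have "\<not> (\<theta> m < t0 + pi)" using cons[of m] N switching_angles_pi[of t0] t0 unfolding m consecutive_def by blast
  ultimately have \<theta>m: "\<theta> m = \<theta> 0 + pi" using \<theta>0 by simp
  have per: "\<theta> (j + m) = \<theta> j + pi" for j
  proof (induction j)
    case (Suc j)
    have "consecutive (\<theta> (j + m)) (\<theta> (Suc j + m))" using cons[of "j + m"] by simp
    moreover have "consecutive (\<theta> (j + m)) (\<theta> (Suc j) + pi)" using consecutive_pi[OF cons[of j]] Suc by simp
    ultimately show ?case using consecutive_unique by blast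
  qed (use \<theta>m in simp)
  \<comment> \<open>A half turn exchanges the two types of intervals, which alternate with the
    index.\<close>
  have odd: "odd m"
  proof
    assume ev: "even m"
    define s where "s = (\<theta> 0 + \<theta> 1) / 2"
    have s: "\<theta> 0 < s" "s < \<theta> 1" using inc[of 0] by (auto simp: s_def)
    have "s \<in> vertex_angles" using type[of 0] s by auto
    moreover have "s + pi \<in> vertex_angles" using type[of m] s per[of 0] per[of 1] ev by auto
    ultimately have "s \<in> switching_angles" using vertex_angles_pi unfolding switching_angles_def by blast
    then show False using cons[of 0] s by (auto simp: consecutive_def)
  qed
  define z where "z j = (if even j then P (\<theta> j) else P (\<theta> j + pi))" for j
  have ev: "P r = z j" if "even j" "r \<in> {\<theta> j..\<theta> (Suc j)}" for j r
    using constant_on_vertex_angles[OF _ that(2)] type[of j] that(1) by (simp add: z_def)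
  have od: "P r = z j + cis r" if "odd j" "r \<in> {\<theta> j..\<theta> (Suc j)}" for j r
    using constant_on_antipodal_angles[OF _ that(2)] type[of j] that(1) P_pi[of r] by (simp add: z_def diff_eq_eq)
  have sp: "star_polygon m \<theta> z"
  proof
    fix j
    show "odd m" "\<theta> j < \<theta> (Suc j)" "\<theta> (j + m) = \<theta> j + pi" by (fact odd inc per)+
    show "z (Suc j) = (if even j then z j - cis (\<theta> (Suc j)) else z j + cis (\<theta> (Suc j)))"
    proof (cases "even j")
      case True
      then show ?thesis using ev[of j "\<theta> (Suc j)"] inc[of j] P_pi[of "\<theta> (Suc j)"] by (simp add: z_def)
    next
      case False
      then show ?thesis using od[of j "\<theta> (Suc j)"] inc[of j] by (simp add: z_def)
    qed
    have e: "\<theta> j + pi + pi = \<theta> j + 2 * pi" by simp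
    show "z (j + m) = z j" using odd unfolding z_def per e P_2pi by simp
  qed
  interpret S: star_polygon m \<theta> z by (rule sp)
  have "P t = S.X t" if t: "\<theta> 0 \<le> t" for t
  proof -
    define j where "j = S.idx t"
    have "t \<in> {\<theta> j..\<theta> (Suc j)}" using S.idx_bounds[OF t] by (auto simp: j_def)
    then show ?thesis using ev[of j t] od[of j t] unfolding S.X_def j_def by (cases "even j") (auto simp: j_def)
  qed
  then have "K = S.H" using K_eq_halfplanes[of "\<theta> 0"] unfolding S.H_def by auto
  then have "K = disk_intersection (z ` {..<m})" using S.body_eq_H by simp
  then show ?thesis using sp by blast
qed

end

context star_polygon
begin

text \<open>Only even shifts respect the parity built into \<open>z_Suc\<close>; since
  \<open>m\<close> is odd, they still bring every vertex to index 0.\<close>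

lemma star_polygon_shift_index: "star_polygon m (\<lambda>j. \<theta> (j + 2 * i)) (\<lambda>j. z (j + 2 * i))"
proof
  fix j
  show "odd m" by (rule odd_m)
  show "\<theta> (j + 2 * i) < \<theta> (Suc j + 2 * i)" using \<theta>_Suc[of "j + 2 * i"] by simp
  show "\<theta> (j + m + 2 * i) = \<theta> (j + 2 * i) + pi" "z (j + m + 2 * i) = z (j + 2 * i)"
    using \<theta>_period[of "j + 2 * i"] z_period[of "j + 2 * i"] by (simp_all add: ac_simps)
  show "z (Suc j + 2 * i) = (if even j then z (j + 2 * i) - cis (\<theta> (Suc j + 2 * i)) else z (j + 2 * i) + cis (\<theta> (Suc j + 2 * i)))"
    using z_Suc[of "j + 2 * i"] by simp
qed

lemma z_image_shift_index: "(\<lambda>j. z (j + 2 * i)) ` {..<m} = z ` {..<m}"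
proof (rule card_subset_eq)
  interpret T: star_polygon m "\<lambda>j. \<theta> (j + 2 * i)" "\<lambda>j. z (j + 2 * i)" by (rule star_polygon_shift_index)
  show "card ((\<lambda>j. z (j + 2 * i)) ` {..<m}) = card (z ` {..<m})" using T.card_z card_z by simp
qed (use z_in in auto)

end

lemma reuleaux_polygonE:
  assumes "reuleaux_polygon K"
  obtains m \<theta> z where "star_polygon m \<theta> z" "K = disk_intersection (z ` {..<m})"
proof -
  obtain C where "constant_width_shape K" "finite C" "K = disk_intersection C"
    using assms by (auto simp: reuleaux_polygon_def)
  then interpret reuleaux K C by unfold_locales
  show thesis using ex_star_polygon that by blast
qed

lemma reuleaux_polygon_vertexE:
  assumes "reuleaux_polygon K" "p \<in> vertices K"
  obtains m \<theta> z where "star_polygon m \<theta> z" "K = disk_intersection (z ` {..<m})" "z 0 = p"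
proof -
  obtain m \<theta> z where S: "star_polygon m \<theta> z" "K = disk_intersection (z ` {..<m})"
    using reuleaux_polygonE[OF assms(1)] .
  interpret star_polygon m \<theta> z by fact
  have "p \<in> (\<lambda>i. z (2 * i)) ` {..<m}" using assms(2) vertices_body unfolding S(2) z_even_image by simp
  then obtain i where "p = z (2 * i)" by blast
  then show thesis
    using that[OF star_polygon_shift_index[of i]] S(2) z_image_shift_index[of i] by simp
qed

section \<open>Perturbation of a vertex\<close>

lemma wedge_mult_left: "wedge (v * a) (v * b) = (norm v)\<^sup>2 * wedge a b"
  unfolding cmod_power2 by (simp add: wedge_def algebra_simps power2_eq_square)

lemma wedge_path:
  "wedge a (a + e) + wedge (a + e) (a + e + f) + wedge (a + e + f) (a + e + f + g)
    = wedge a (e + f + g) + (wedge e f + wedge e g + wedge f g)"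
  by (simp add: wedge_def algebra_simps)

text \<open>The sign \<open>\<sigma>\<close> of the imaginary part from
  \<open>unit_circles_intersection\<close> is locally constant and selects one intersection point
  \<open>G s\<close> for each moving centre \<open>s\<close>. Existence of \<open>G\<close> supplies
  the paths in \<open>vertex_perturbation\<close>; local uniqueness recognises a given perturbed
  vertex as the end of such a path.\<close>

lemma unit_circles_branch:
  fixes p q r :: complex
  assumes q: "norm (q - p) = 1" "norm (q - r) = 1" and r: "p \<noteq> r" "norm (r - p) < 2"
  obtains \<epsilon> G where "\<epsilon> > 0" "continuous_on (ball r \<epsilon>) G" "G r = q"
    "\<And>s. s \<in> ball r \<epsilon> \<Longrightarrow> norm (G s - p) = 1 \<and> norm (G s - s) = 1"
    "\<And>s w. s \<in> ball r \<epsilon> \<Longrightarrow> w \<in> ball q \<epsilon> \<Longrightarrow> norm (w - p) = 1 \<Longrightarrow> norm (w - s) = 1 \<Longrightarrow> w = G s"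
proof -
  define \<sigma> where "\<sigma> = sgn (Im ((q - p) / (r - p)))"
  define h where "h s = sqrt (1 / (norm (s - p))\<^sup>2 - 1 / 4)" for s
  define G where "G s = p + (s - p) * Complex (1 / 2) (\<sigma> * h s)" for s
  have pos: "1 / (norm (s - p))\<^sup>2 - 1 / 4 > 0" if "s \<noteq> p" "norm (s - p) < 2" for s
  proof -
    have "(norm (s - p))\<^sup>2 < 2\<^sup>2" using that by (intro power_strict_mono) auto
    then show ?thesis using that by (simp add: field_simps)
  qed
  have "(Im ((q - p) / (r - p)))\<^sup>2 > 0" using unit_circles_intersection(2)[OF q r(1)] pos[of r] r by simp
  then have \<sigma>: "\<bar>\<sigma>\<bar> = 1" "\<sigma> * Im ((q - p) / (r - p)) > 0" "\<sigma> * \<sigma> = 1"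
    by (auto simp: \<sigma>_def sgn_if)
  have "isCont (\<lambda>x. \<sigma> * Im ((fst x - p) / (snd x - p))) (q, r)"
    using r by (intro continuous_intros) auto
  then have "((\<lambda>x. \<sigma> * Im ((fst x - p) / (snd x - p))) \<longlongrightarrow> \<sigma> * Im ((q - p) / (r - p))) (at (q, r))"
    by (simp add: isCont_def)
  then have "\<forall>\<^sub>F x in at (q, r). \<sigma> * Im ((fst x - p) / (snd x - p)) > 0"
    using \<sigma>(2) by (rule order_tendstoD(1))
  then obtain d where d: "d > 0"
    "\<And>x. x \<noteq> (q, r) \<Longrightarrow> dist x (q, r) < d \<Longrightarrow> \<sigma> * Im ((fst x - p) / (snd x - p)) > 0"
    unfolding eventually_at by auto
  obtain \<epsilon> where \<epsilon>: "\<epsilon> > 0" "\<epsilon> < d / 2" "\<epsilon> < norm (r - p)" "\<epsilon> < 2 - norm (r - p)"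
    using field_lbound_gt_zero[of "d / 2" "min (norm (r - p)) (2 - norm (r - p))"] d r by auto
  have near: "s \<noteq> p" "norm (s - p) < 2" if "s \<in> ball r \<epsilon>" for s
  proof -
    have "norm (s - r) < \<epsilon>" using that by (simp add: dist_norm norm_minus_commute)
    then show "s \<noteq> p" "norm (s - p) < 2"
      using \<epsilon> norm_triangle_ineq[of "s - r" "r - p"] by (auto simp: norm_minus_commute)
  qed
  have norms: "norm (p + (s - p) * Complex (1 / 2) y - p) = 1 \<and> norm (p + (s - p) * Complex (1 / 2) y - s) = 1"
    if "s \<noteq> p" "y\<^sup>2 = 1 / (norm (s - p))\<^sup>2 - 1 / 4" for s y
  proof -
    have n: "norm (Complex c y) = 1 / norm (s - p)" if "c\<^sup>2 = 1 / 4" for c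
    proof -
      have "c\<^sup>2 + y\<^sup>2 = (1 / norm (s - p))\<^sup>2" using that \<open>y\<^sup>2 = _\<close> by (simp add: power_divide)
      then show ?thesis unfolding complex_norm by simp
    qed
    have "p + (s - p) * Complex (1 / 2) y - s = (s - p) * Complex (- 1 / 2) y"
      by (simp add: complex_eq_iff algebra_simps)
    then show ?thesis using n[of "1 / 2"] n[of "- 1 / 2"] that(1)
      by (simp add: norm_mult power2_eq_square)
  qed
  have uniq: "w = G s" if s: "s \<in> ball r \<epsilon>" and w: "norm (w - p) = 1" "norm (w - s) = 1"
    and sg: "\<sigma> * Im ((w - p) / (s - p)) > 0" for w s
  proof -
    define \<omega> where "\<omega> = (w - p) / (s - p)"
    have ne: "p \<noteq> s" using near[OF s] by simp
    have re: "Re \<omega> = 1 / 2" "(Im \<omega>)\<^sup>2 = 1 / (norm (s - p))\<^sup>2 - 1 / 4"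
      using unit_circles_intersection[OF w ne] by (simp_all add: \<omega>_def)
    have "(\<sigma> * Im \<omega>)\<^sup>2 = 1 / (norm (s - p))\<^sup>2 - 1 / 4" unfolding power_mult_distrib re(2)
      using \<sigma>(3) by (simp add: power2_eq_square)
    then have "\<sigma> * Im \<omega> = h s" unfolding h_def using sg by (intro real_sqrt_unique[symmetric]) (auto simp: \<omega>_def)
    then have "\<sigma> * h s = (\<sigma> * \<sigma>) * Im \<omega>" by simp
    then have "\<omega> = Complex (1 / 2) (\<sigma> * h s)" using re \<sigma> by (simp add: complex_eq_iff)
    moreover have "w = p + (s - p) * \<omega>" using ne by (simp add: \<omega>_def)
    ultimately show ?thesis by (simp add: G_def)
  qed
  show thesis
  proof (rule that[of \<epsilon> G])
    show "\<epsilon> > 0" by fact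
    have "continuous_on (ball r \<epsilon>) (\<lambda>s. p + (s - p) * (of_real (1 / 2) + \<i> * of_real (\<sigma> * h s)))"
      unfolding h_def using near by (intro continuous_intros) auto
    then show "continuous_on (ball r \<epsilon>) G" by (simp add: G_def Complex_eq)
    show "G r = q" using uniq[of r q] q \<sigma> \<epsilon> by simp
    fix s assume s: "s \<in> ball r \<epsilon>"
    have "(\<sigma> * h s)\<^sup>2 = 1 / (norm (s - p))\<^sup>2 - 1 / 4"
      unfolding power_mult_distrib h_def real_sqrt_pow2[OF less_imp_le[OF pos[OF near[OF s]]]]
      using \<sigma>(3) by (simp add: power2_eq_square)
    then show "norm (G s - p) = 1 \<and> norm (G s - s) = 1"
      unfolding G_def using near[OF s] by (intro norms) auto
    fix w assume w: "w \<in> ball q \<epsilon>" "norm (w - p) = 1" "norm (w - s) = 1"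
    have "\<sigma> * Im ((w - p) / (s - p)) > 0"
    proof (cases "(w, s) = (q, r)")
      case False
      have "dist (w, s) (q, r) \<le> dist w q + dist s r"
        by (simp add: dist_Pair_Pair sqrt_sum_squares_le_sum)
      also have "\<dots> < d" using w(1) s \<epsilon>(2) by (simp add: dist_commute)
      finally show ?thesis using d(2)[OF False] by simp
    qed (use \<sigma> in auto)
    then show "w = G s" using uniq[OF s] w by blast
  qed
qed

context star_polygon
begin

lemma norm_edge: "norm (z (Suc j) - z j) = 1"
  by (simp add: z_Suc)

text \<open>A strictly increasing order of finitely many directions is an open condition. With
  \<open>d\<close> the smallest gap, each direction is corrected by an argument smaller than
  \<open>d / 2\<close>, which keeps the order.\<close>

lemma star_polygon_of_near_path:
  "\<exists>\<epsilon>>0. \<forall>z'. (\<forall>j. z' (j + m) = z' j) \<longrightarrow> (\<forall>j. norm (z' (Suc j) - z' j) = 1) \<longrightarrow>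
    (\<forall>j. norm (z' j - z j) < \<epsilon>) \<longrightarrow> (\<exists>\<theta>'. star_polygon m \<theta>' z')"
proof -
  define d where "d = Min ((\<lambda>j. \<theta> (Suc j) - \<theta> j) ` {..<m})"
  have ne: "{..<m} \<noteq> {}" using m_ge_3 by (simp add: lessThan_empty_iff)
  have d_le: "d \<le> \<theta> (Suc j) - \<theta> j" for j
  proof -
    have shift: "\<theta> (Suc (i + k * m)) - \<theta> (i + k * m) = \<theta> (Suc i) - \<theta> i" for i k
    proof (induction k)
      case (Suc k)
      have e: "i + Suc k * m = i + k * m + m" by simp
      show ?case unfolding e using Suc \<theta>_period[of "i + k * m"] \<theta>_period[of "Suc (i + k * m)"] by simp
    qed simp
    have "d \<le> \<theta> (Suc (j mod m)) - \<theta> (j mod m)"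
      unfolding d_def using m_ge_3 by (intro Min_le) auto
    then show ?thesis using shift[of "j mod m" "j div m"] by simp
  qed
  have "d > 0" unfolding d_def using ne \<theta>_Suc by (subst Min_gr_iff) auto
  have "isCont Arg 1" by (rule continuous_at_Arg) auto
  then have "\<forall>e>0. \<exists>s>0. \<forall>q. dist q 1 < s \<longrightarrow> dist (Arg q) (Arg 1) < e"
    by (simp add: continuous_at_eps_delta)
  moreover have "d / 2 > 0" using \<open>d > 0\<close> by simp
  ultimately obtain \<eta> where "\<eta> > 0" "\<forall>q. dist q 1 < \<eta> \<longrightarrow> dist (Arg q) (Arg 1) < d / 2" by blast
  moreover have "Arg 1 = 0" by (rule cis_Arg_unique) auto
  ultimately have \<eta>: "\<eta> > 0" "\<And>q. norm (q - 1) < \<eta> \<Longrightarrow> \<bar>Arg q\<bar> < d / 2"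
    by (auto simp: dist_norm)
  show ?thesis
  proof (intro exI[of _ "\<eta> / 2"] conjI allI impI)
    show "\<eta> / 2 > 0" using \<eta> by simp
    fix z' :: "nat \<Rightarrow> complex"
    assume per: "\<forall>j. z' (j + m) = z' j" and unit: "\<forall>j. norm (z' (Suc j) - z' j) = 1"
      and near: "\<forall>j. norm (z' j - z j) < \<eta> / 2"
    define E where "E j = (if even j then z' j - z' (Suc j) else z' (Suc j) - z' j)" for j
    have E: "norm (E j) = 1" for j using unit by (simp add: E_def norm_minus_commute)
    have Eper: "E (j + m) = - E j" for j
      using per[rule_format, of j] per[rule_format, of "Suc j"] odd_m by (simp add: E_def)
    define q where "q j = E j / cis (\<theta> (Suc j))" for j
    have qper: "q (j + m) = q j" for j
      using \<theta>_period[of "Suc j"] by (simp add: q_def Eper cis_add_pi)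
    have q1: "norm (q j) = 1" for j by (simp add: q_def norm_divide E)
    have "norm (q j - 1) < \<eta>" for j
    proof -
      have "cis (\<theta> (Suc j)) = (if even j then z j - z (Suc j) else z (Suc j) - z j)" by (simp add: z_Suc)
      then have "norm (E j - cis (\<theta> (Suc j))) \<le> norm (z' j - z j) + norm (z' (Suc j) - z (Suc j))"
        using norm_triangle_ineq4[of "z' j - z j" "z' (Suc j) - z (Suc j)"]
          norm_triangle_ineq4[of "z' (Suc j) - z (Suc j)" "z' j - z j"]
        by (auto simp: E_def algebra_simps)
      also have "\<dots> < \<eta>" using near[rule_format, of j] near[rule_format, of "Suc j"] by simp
      also have "E j - cis (\<theta> (Suc j)) = (q j - 1) * cis (\<theta> (Suc j))" by (simp add: q_def algebra_simps)
      finally show ?thesis by (simp add: norm_mult)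
    qed
    then have arg: "\<bar>Arg (q j)\<bar> < d / 2" for j using \<eta> by blast
    define \<theta>' where "\<theta>' j = \<theta> j + Arg (q (j + m - 1))" for j
    have \<theta>'S: "\<theta>' (Suc j) = \<theta> (Suc j) + Arg (q j)" for j using qper[of j] by (simp add: \<theta>'_def)
    have "star_polygon m \<theta>' z'"
    proof
      fix j
      show "odd m" by (rule odd_m)
      have "\<bar>Arg (q j)\<bar> < d / 2" "\<bar>Arg (q (j + m - 1))\<bar> < d / 2" using arg by auto
      then show "\<theta>' j < \<theta>' (Suc j)" using d_le[of j] unfolding \<theta>'S unfolding \<theta>'_def by linarith
      have "j + m + m - 1 = (j + m - 1) + m" using m_ge_3 by simp
      then show "\<theta>' (j + m) = \<theta>' j + pi" using qper[of "j + m - 1"] by (simp add: \<theta>'_def \<theta>_period)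
      have "cis (\<theta>' (Suc j)) = cis (\<theta> (Suc j)) * cis (Arg (q j))" by (simp add: \<theta>'S cis_mult)
      also have "cis (Arg (q j)) = q j"
        using cis_Arg[of "q j"] q1[of j] by (cases "q j = 0") (auto simp: sgn_div_norm)
      finally have "cis (\<theta>' (Suc j)) = E j" by (simp add: q_def)
      then show "z' (Suc j) = (if even j then z' j - cis (\<theta>' (Suc j)) else z' j + cis (\<theta>' (Suc j)))"
        by (simp add: E_def)
      show "z' (j + m) = z' j" using per by blast
    qed
    then show "\<exists>\<theta>'. star_polygon m \<theta>' z'" by blast
  qed
qed

text \<open>With bending angles \<open>\<beta>\<close>, \<open>\<gamma>\<close> and first direction
  \<open>u\<close> the ends satisfy \<open>z 0 - z 3 = u * W (\<beta>, \<gamma>)\<close>. The ends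
  can stay fixed exactly when the norm of \<open>W\<close> is kept, which is the cosine condition of
  \<open>linkage_angles\<close>; the sine expression there is the loss in the star sum.\<close>

lemma linkage_points:
  assumes m: "m \<ge> 5" and "\<epsilon> > 0"
    and neq: "\<theta> 2 - \<theta> 1 \<noteq> \<theta> 3 - \<theta> 2 \<or> \<theta> 2 - \<theta> 1 < pi / 3"
  shows "\<exists>b c. norm (b - z 1) < \<epsilon> \<and> norm (c - z 2) < \<epsilon> \<and>
    norm (b - z 0) = 1 \<and> norm (c - b) = 1 \<and> norm (z 3 - c) = 1 \<and>
    wedge (z 0) b + wedge b c + wedge c (z 3) < wedge (z 0) (z 1) + wedge (z 1) (z 2) + wedge (z 2) (z 3)"
proof -
  define \<beta> \<gamma> u where "\<beta> = \<theta> 2 - \<theta> 1" and "\<gamma> = \<theta> 3 - \<theta> 2" and "u = cis (\<theta> 1)"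
  define W where "W x = 1 - cis (fst x) + cis (fst x + snd x)" for x :: "real \<times> real"
  have bg: "\<beta> > 0" "\<gamma> > 0" "\<beta> + \<gamma> < pi"
    using \<theta>_less[of 1 2] \<theta>_less[of 2 3] \<theta>_less[of 3 "1 + m"] \<theta>_period[of 1] m by (auto simp: \<beta>_def \<gamma>_def)
  have cis2: "cis (\<theta> 2) = u * cis \<beta>" and cis3: "cis (\<theta> 3) = u * cis (\<beta> + \<gamma>)"
    by (simp_all add: u_def \<beta>_def \<gamma>_def cis_mult)
  have z: "z 1 = z 0 - u" "z 2 = z 1 + u * cis \<beta>" "z 3 = z 2 - u * cis (\<beta> + \<gamma>)"
  proof -
    show "z 1 = z 0 - u" using z_Suc[of 0] unfolding u_def One_nat_def by (simp only: even_zero if_True)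
    show "z 2 = z 1 + u * cis \<beta>" using z_Suc[of 1] unfolding cis2[symmetric] by (simp add: numeral_2_eq_2)
    show "z 3 = z 2 - u * cis (\<beta> + \<gamma>)" using z_Suc[of 2] unfolding cis3[symmetric] by (simp add: numeral_3_eq_3 numeral_2_eq_2)
  qed
  have z3: "z 3 = z 0 - u * W (\<beta>, \<gamma>)" unfolding z(3) z(2) z(1) by (simp add: W_def algebra_simps)
  have "z 0 \<noteq> z 3" using inj_onD[OF inj_z, of 0 3] m by auto
  then have W0: "W (\<beta>, \<gamma>) \<noteq> 0" using z3 by auto
  have normW: "(norm (W x))\<^sup>2 = 3 - 2 * (cos (fst x) + cos (snd x) - cos (fst x + snd x))" for x
  proof -
    have W: "W x = cis 0 - cis (fst x) + cis (fst x + snd x)" by (simp add: W_def)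
    show ?thesis
      unfolding power2_norm_eq_inner W inner_add_left inner_add_right inner_diff_left inner_diff_right inner_cis
      using cos_minus[of "fst x"] cos_minus[of "snd x"] cos_minus[of "fst x + snd x"] by simp
  qed
  \<comment> \<open>The first direction is turned so that the bent linkage again ends at
    \<open>z 3\<close>; the quotient is a rotation as soon as the norm of \<open>W\<close> is
    preserved.\<close>
  define v where "v x = u * (W (\<beta>, \<gamma>) / W x)" for x
  define b where "b x = z 0 - v x" for x
  define c where "c x = b x + v x * cis (fst x)" for x
  have v0: "v (\<beta>, \<gamma>) = u" using W0 by (simp add: v_def)
  have bc0: "b (\<beta>, \<gamma>) = z 1" "c (\<beta>, \<gamma>) = z 2"
    unfolding c_def b_def v0 z(1,2) by simp_all
  have contcis: "isCont (\<lambda>x. cis (f x)) y" if "isCont f y" for f :: "real \<times> real \<Rightarrow> real" and y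
    using that unfolding cis_conv_exp by (intro continuous_intros)
  have contW: "isCont W (\<beta>, \<gamma>)" unfolding W_def by (intro continuous_intros contcis)
  have contv: "isCont v (\<beta>, \<gamma>)" unfolding v_def using W0 by (intro continuous_intros contW)
  have contb: "isCont b (\<beta>, \<gamma>)" unfolding b_def by (intro continuous_intros contv)
  have contc: "isCont c (\<beta>, \<gamma>)" unfolding c_def by (intro continuous_intros contcis contv contb)
  obtain d1 where d1: "d1 > 0" "\<And>x. dist x (\<beta>, \<gamma>) < d1 \<Longrightarrow> dist (b x) (b (\<beta>, \<gamma>)) < \<epsilon>"
    using contb \<open>\<epsilon> > 0\<close> unfolding continuous_at_eps_delta by blast
  obtain d2 where d2: "d2 > 0" "\<And>x. dist x (\<beta>, \<gamma>) < d2 \<Longrightarrow> dist (c x) (c (\<beta>, \<gamma>)) < \<epsilon>"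
    using contc \<open>\<epsilon> > 0\<close> unfolding continuous_at_eps_delta by blast
  obtain \<beta>' \<gamma>' where bg': "\<bar>\<beta>' - \<beta>\<bar> < min d1 d2 / 2" "\<bar>\<gamma>' - \<gamma>\<bar> < min d1 d2 / 2"
    and same: "cos \<beta>' + cos \<gamma>' - cos (\<beta>' + \<gamma>') = cos \<beta> + cos \<gamma> - cos (\<beta> + \<gamma>)"
    and gain: "sin \<beta>' + sin \<gamma>' - sin (\<beta>' + \<gamma>') > sin \<beta> + sin \<gamma> - sin (\<beta> + \<gamma>)"
    using linkage_angles[of \<beta> \<gamma> "min d1 d2 / 2"] bg neq d1(1) d2(1) by (auto simp: \<beta>_def \<gamma>_def)
  define x where "x = (\<beta>', \<gamma>')"
  have "dist x (\<beta>, \<gamma>) \<le> \<bar>\<beta>' - \<beta>\<bar> + \<bar>\<gamma>' - \<gamma>\<bar>"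
    unfolding x_def by (simp add: dist_Pair_Pair dist_real_def sqrt_sum_squares_le_sum_abs)
  then have near: "dist x (\<beta>, \<gamma>) < d1" "dist x (\<beta>, \<gamma>) < d2" using bg' by linarith+
  have "(norm (W x))\<^sup>2 = (norm (W (\<beta>, \<gamma>)))\<^sup>2" unfolding normW using same by (simp add: x_def)
  then have "norm (W x) = norm (W (\<beta>, \<gamma>))" by simp
  then have v1: "norm (v x) = 1" and Wx: "W x \<noteq> 0" using W0 by (auto simp: v_def u_def norm_mult norm_divide)
  have vW: "v x * W x = u * W (\<beta>, \<gamma>)" using Wx by (simp add: v_def)
  have z3': "z 3 = c x - v x * cis (\<beta>' + \<gamma>')"
    unfolding z3 vW[symmetric] by (simp add: c_def b_def W_def x_def algebra_simps)
  have wedges: "wedge (z 0) (z 0 - w) + wedge (z 0 - w) (z 0 - w + w * cis s) + wedge (z 0 - w + w * cis s) (z 3)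
      = wedge (z 0) (z 3 - z 0) - (sin s + sin t - sin (s + t))"
    if w: "norm w = 1" "z 3 = z 0 - w + w * cis s - w * cis (s + t)" for w s t
  proof -
    have "wedge (w * a) (w * b) = wedge a b" for a b using w(1) by (simp add: wedge_mult_left)
    from this[of 1] this have ww: "wedge w (w * b) = wedge (cis 0) b" "wedge (w * a) (w * b) = wedge a b" for a b
      by simp_all
    have neg: "wedge (- a) b = - wedge a b" "wedge a (- b) = - wedge a b" for a b by (simp_all add: wedge_def)
    have calc: "wedge (z 0) (z 0 + - w) + wedge (z 0 + - w) (z 0 + - w + w * cis s)
        + wedge (z 0 + - w + w * cis s) (z 0 + - w + w * cis s + - (w * cis (s + t)))
      = wedge (z 0) (- w + w * cis s + - (w * cis (s + t))) - (sin s + sin t - sin (s + t))"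
      unfolding wedge_path neg ww wedge_cis by simp
    have e: "- w + w * cis s + - (w * cis (s + t)) = z 3 - z 0"
      "z 0 + - w + w * cis s + - (w * cis (s + t)) = z 3" using w(2) by simp_all
    show ?thesis using calc unfolding e by simp
  qed
  have "wedge (z 0) (b x) + wedge (b x) (c x) + wedge (c x) (z 3)
      = wedge (z 0) (z 3 - z 0) - (sin \<beta>' + sin \<gamma>' - sin (\<beta>' + \<gamma>'))"
    using wedges[OF v1, of \<beta>' \<gamma>'] z3' by (simp add: b_def c_def x_def)
  moreover have "wedge (z 0) (z 1) + wedge (z 1) (z 2) + wedge (z 2) (z 3)
      = wedge (z 0) (z 3 - z 0) - (sin \<beta> + sin \<gamma> - sin (\<beta> + \<gamma>))"
    using wedges[of u \<beta> \<gamma>] z by (simp add: u_def)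
  ultimately have "wedge (z 0) (b x) + wedge (b x) (c x) + wedge (c x) (z 3)
      < wedge (z 0) (z 1) + wedge (z 1) (z 2) + wedge (z 2) (z 3)" using gain by linarith
  moreover have "norm (b x - z 1) < \<epsilon>" "norm (c x - z 2) < \<epsilon>"
    using d1(2)[OF near(1)] d2(2)[OF near(2)] unfolding bc0 dist_norm .
  moreover have "norm (b x - z 0) = 1" "norm (c x - b x) = 1" "norm (z 3 - c x) = 1"
    using v1 unfolding z3' by (simp_all add: b_def c_def norm_mult)
  ultimately show ?thesis by blast
qed

lemma move_two_vertices:
  assumes m: "m \<ge> 5" and \<epsilon>: "\<epsilon> > 0"
    and neq: "\<theta> 2 - \<theta> 1 \<noteq> \<theta> 3 - \<theta> 2 \<or> \<theta> 2 - \<theta> 1 < pi / 3"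
  shows "\<exists>\<theta>' z'. star_polygon m \<theta>' z' \<and> (\<forall>j. norm (z' j - z j) < \<epsilon>) \<and>
    (\<forall>j. j mod m \<noteq> 1 \<longrightarrow> j mod m \<noteq> 2 \<longrightarrow> z' j = z j) \<and> star_sum m z' < star_sum m z"
proof -
  obtain \<epsilon>0 where \<epsilon>0: "\<epsilon>0 > 0" "\<And>z'. (\<forall>j. z' (j + m) = z' j) \<Longrightarrow> (\<forall>j. norm (z' (Suc j) - z' j) = 1) \<Longrightarrow>
    (\<forall>j. norm (z' j - z j) < \<epsilon>0) \<Longrightarrow> (\<exists>\<theta>'. star_polygon m \<theta>' z')"
    using star_polygon_of_near_path by blast
  obtain b c where near: "norm (b - z 1) < min \<epsilon> \<epsilon>0" "norm (c - z 2) < min \<epsilon> \<epsilon>0"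
    and unit: "norm (b - z 0) = 1" "norm (c - b) = 1" "norm (z 3 - c) = 1"
    and less: "wedge (z 0) b + wedge b c + wedge c (z 3) < wedge (z 0) (z 1) + wedge (z 1) (z 2) + wedge (z 2) (z 3)"
    using linkage_points[OF m _ neq, of "min \<epsilon> \<epsilon>0"] \<epsilon> \<epsilon>0(1) by auto
  define z' where "z' j = (if j mod m = 1 then b else if j mod m = 2 then c else z j)" for j
  have z': "z' 0 = z 0" "z' 1 = b" "z' 2 = c" "\<And>j. 3 \<le> j \<Longrightarrow> j \<le> m \<Longrightarrow> z' j = z j"
    using m by (auto simp: z'_def le_less)
  have per: "z' (j + m) = z' j" for j by (simp add: z'_def z_period)
  have mod: "z' (j mod m) = z' j" for j by (simp add: z'_def z_mod)
  have edge: "norm (z' (Suc j) - z' j) = 1" if "j < m" for j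
  proof -
    consider "j = 0" | "j = 1" | "j = 2" | "j \<ge> 3" by linarith
    then show ?thesis
    proof cases
      case 4
      then show ?thesis using that z'(4)[of j] z'(4)[of "Suc j"] norm_edge[of j] by simp
    qed (use unit z' z'(4)[of 3] m in \<open>auto simp: numeral_2_eq_2 numeral_3_eq_3\<close>)
  qed
  have "norm (z' (Suc j) - z' j) = 1" for j
  proof -
    have "z' (Suc (j mod m)) = z' (Suc j)" using mod[of "Suc (j mod m)"] mod[of "Suc j"] by (simp add: mod_Suc_eq)
    then show ?thesis using edge[of "j mod m"] mod[of j] m by simp
  qed
  moreover have close: "norm (z' j - z j) < min \<epsilon> \<epsilon>0" for j
    using near z_mod[of j] \<epsilon> \<epsilon>0(1) by (auto simp: z'_def)
  ultimately obtain \<theta>' where \<theta>': "star_polygon m \<theta>' z'" using \<epsilon>0(2)[of z'] per by auto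
  have split: "{..<m} = insert 0 (insert 1 (insert 2 {3..<m}))" using m by auto
  have "(\<Sum>j = 3..<m. wedge (z' j) (z' (Suc j))) = (\<Sum>j = 3..<m. wedge (z j) (z (Suc j)))"
    using z'(4) by (intro sum.cong) auto
  moreover have "z' 3 = z 3" using z'(4)[of 3] m by simp
  ultimately have "star_sum m z' < star_sum m z"
    using less unfolding star_sum_def split by (simp add: z' z'(2)[unfolded One_nat_def] numeral_2_eq_2[symmetric] numeral_3_eq_3[symmetric])
  then show ?thesis using \<theta>' close by (intro exI[of _ \<theta>'] exI[of _ z']) (auto simp: z'_def)
qed

text \<open>Both sums are determined by the area of the same body.\<close>

lemma star_sum_shift_index: "star_sum m (\<lambda>j. z (j + 2 * i)) = star_sum m z"
proof -
  interpret T: star_polygon m "\<lambda>j. \<theta> (j + 2 * i)" "\<lambda>j. z (j + 2 * i)" by (rule star_polygon_shift_index)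
  show ?thesis using T.area_body area_body unfolding z_image_shift_index by simp
qed

text \<open>The moved vertices are \<open>z 0\<close> and one of its two neighbours
  \<open>z (m - 1)\<close> and \<open>z 1\<close> in the path; all other vertices keep their
  places.\<close>

lemma perturb_vertex:
  assumes m: "m \<ge> 5" and \<epsilon>: "\<epsilon> > 0"
  shows "\<exists>\<theta>' z'. star_polygon m \<theta>' z' \<and> (\<forall>j. norm (z' j - z j) < \<epsilon>) \<and>
    (\<forall>j. 2 \<le> j \<longrightarrow> j \<le> m - 2 \<longrightarrow> z' j = z j) \<and> star_sum m z' < star_sum m z"
proof -
  obtain l where l: "m = 2 * l + 1" using odd_m by (elim oddE)
  \<comment> \<open>A shift by \<open>2 * i\<close> brings the pair to be moved to positions 1 and
    2. The shift by \<open>2 * k\<close> undoes it, since the two together make two full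
    periods.\<close>
  have transfer: ?thesis
    if h: "\<theta> (2 + 2 * i) - \<theta> (1 + 2 * i) \<noteq> \<theta> (3 + 2 * i) - \<theta> (2 + 2 * i) \<or> \<theta> (2 + 2 * i) - \<theta> (1 + 2 * i) < pi / 3"
      and i: "2 * i + 2 * k = 2 * m" and fixed: "\<And>j. 2 \<le> j \<Longrightarrow> j \<le> m - 2 \<Longrightarrow> (j + 2 * k) mod m \<noteq> 1 \<and> (j + 2 * k) mod m \<noteq> 2"
    for i k
  proof -
    interpret T: star_polygon m "\<lambda>j. \<theta> (j + 2 * i)" "\<lambda>j. z (j + 2 * i)" by (rule star_polygon_shift_index)
    obtain \<theta>' w where w: "star_polygon m \<theta>' w" "\<forall>j. norm (w j - z (j + 2 * i)) < \<epsilon>"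
      "\<forall>j. j mod m \<noteq> 1 \<longrightarrow> j mod m \<noteq> 2 \<longrightarrow> w j = z (j + 2 * i)"
      "star_sum m w < star_sum m (\<lambda>j. z (j + 2 * i))"
      using T.move_two_vertices[OF m \<epsilon> h] by blast
    interpret W: star_polygon m \<theta>' w by (rule w(1))
    have unshift: "z (j + 2 * k + 2 * i) = z j" for j
    proof -
      have e: "j + 2 * k + 2 * i = j + 2 * m" using i by simp
      show ?thesis unfolding e by (rule z_2period)
    qed
    show ?thesis
    proof (intro exI conjI allI impI)
      show "star_polygon m (\<lambda>j. \<theta>' (j + 2 * k)) (\<lambda>j. w (j + 2 * k))" by (rule W.star_polygon_shift_index)
      show "norm (w (j + 2 * k) - z j) < \<epsilon>" for j using w(2)[rule_format, of "j + 2 * k"] by (simp add: unshift)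
      show "star_sum m (\<lambda>j. w (j + 2 * k)) < star_sum m z"
        using w(4) unfolding W.star_sum_shift_index star_sum_shift_index .
      show "w (j + 2 * k) = z j" if "2 \<le> j" "j \<le> m - 2" for j
        using w(3)[rule_format, of "j + 2 * k"] fixed[OF that] by (simp add: unshift)
    qed
  qed
  define \<alpha> where "\<alpha> j = \<theta> (Suc j) - \<theta> j" for j
  have \<alpha>per: "\<alpha> (j + m) = \<alpha> j" for j using \<theta>_period[of j] \<theta>_period[of "Suc j"] by (simp add: \<alpha>_def)
  \<comment> \<open>The pair \<open>z (m - 1)\<close>, \<open>z 0\<close> is tried first. If it is
    blocked, the pair \<open>z 0\<close>, \<open>z 1\<close> is free: otherwise three consecutive
    angles would be equal and at least \<open>pi / 3\<close>, while their sum is less than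
    \<open>pi\<close> for \<open>m \<ge> 5\<close>.\<close>
  show ?thesis
  proof (cases "\<alpha> (m - 1) \<noteq> \<alpha> m \<or> \<alpha> (m - 1) < pi / 3")
    case True
    have s: "Suc (m - 1) = m" using m by simp
    have i: "2 + 2 * (m - 1) = Suc (m - 1 + m)" "1 + 2 * (m - 1) = m - 1 + m" "3 + 2 * (m - 1) = Suc (m + m)" "Suc (m - 1 + m) = m + m"
      using m by auto
    show ?thesis
    proof (rule transfer[of "m - 1" 1])
      have "\<theta> (2 + 2 * (m - 1)) - \<theta> (1 + 2 * (m - 1)) = \<alpha> (m - 1)"
        "\<theta> (3 + 2 * (m - 1)) - \<theta> (2 + 2 * (m - 1)) = \<alpha> m"
        using \<alpha>per[of "m - 1"] \<alpha>per[of m] unfolding i unfolding \<alpha>_def i(4) s by simp_all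
      then show "\<theta> (2 + 2 * (m - 1)) - \<theta> (1 + 2 * (m - 1)) \<noteq> \<theta> (3 + 2 * (m - 1)) - \<theta> (2 + 2 * (m - 1))
        \<or> \<theta> (2 + 2 * (m - 1)) - \<theta> (1 + 2 * (m - 1)) < pi / 3" using True by simp
      show "2 * (m - 1) + 2 * 1 = 2 * m" using m by simp
      show "(j + 2 * 1) mod m \<noteq> 1 \<and> (j + 2 * 1) mod m \<noteq> 2" if "2 \<le> j" "j \<le> m - 2" for j
      proof (cases "j = m - 2")
        case True
        then have "j + 2 * 1 = m" using m by simp
        then show ?thesis by simp
      qed (use that m in auto)
    qed
  next
    case False
    have i: "2 + 2 * l = Suc m" "1 + 2 * l = m" "3 + 2 * l = Suc (Suc m)" using l by auto
    show ?thesis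
    proof (rule transfer[of l "l + 1"])
      have "\<alpha> m \<noteq> \<alpha> (Suc m)"
      proof
        assume eq: "\<alpha> m = \<alpha> (Suc m)"
        have "\<theta> (Suc (Suc m)) < \<theta> (m - 1 + m)" using m by (intro \<theta>_less) simp
        then have "\<theta> (Suc (Suc m)) < \<theta> (m - 1) + pi" using \<theta>_period[of "m - 1"] by simp
        moreover have "\<alpha> (m - 1) = \<theta> m - \<theta> (m - 1)" using m by (simp add: \<alpha>_def)
        ultimately have "\<alpha> (m - 1) + \<alpha> m + \<alpha> (Suc m) < pi" by (simp add: \<alpha>_def)
        then show False using eq False by linarith
      qed
      then show "\<theta> (2 + 2 * l) - \<theta> (1 + 2 * l) \<noteq> \<theta> (3 + 2 * l) - \<theta> (2 + 2 * l)
        \<or> \<theta> (2 + 2 * l) - \<theta> (1 + 2 * l) < pi / 3" unfolding i by (simp add: \<alpha>_def)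
      show "2 * l + 2 * (l + 1) = 2 * m" using l by simp
      show "(j + 2 * (l + 1)) mod m \<noteq> 1 \<and> (j + 2 * (l + 1)) mod m \<noteq> 2" if "2 \<le> j" "j \<le> m - 2" for j
      proof -
        have "j + 2 * (l + 1) = Suc j + m" using l by simp
        then have "(j + 2 * (l + 1)) mod m = Suc j mod m" by (simp only: mod_add_self2)
        then have "(j + 2 * (l + 1)) mod m = Suc j" using that m by simp
        then show ?thesis using that by simp
      qed
    qed
  qed
qed

text \<open>In the labelling \<open>x i = z (2 * i)\<close> the vertices \<open>x l\<close> and
  \<open>x (l + 1)\<close> are the path neighbours \<open>z (m - 1)\<close> and \<open>z 1\<close>
  of \<open>z 0\<close>, and \<open>x (2 * l)\<close>, \<open>x 1\<close> are the next ones,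
  \<open>z (m - 2)\<close> and \<open>z 2\<close>. The straight motion of \<open>x 0\<close> need
  not be a motion of the linkage; only its end has to be the perturbed polygon.\<close>

lemma vertex_perturbation_realization:
  assumes m: "m = 2 * l + 1" "l \<ge> 2" and "\<eta> > 0"
  shows "\<exists>\<theta>' z' v t y. star_polygon m \<theta>' z' \<and> (\<forall>j. norm (z' j - z j) < \<eta>) \<and> star_sum m z' < star_sum m z \<and>
    norm v = 1 \<and> \<bar>t\<bar> < \<eta> \<and> vertex_perturbation l (\<lambda>i. z (2 * i)) v t y \<and> y ` {..<m} = z' ` {..<m}"
proof -
  have m5: "m \<ge> 5" using m by simp
  have i: "2 * l = m - 1" "2 * (l + 1) = 1 + m" "2 * (m - 1) = m - 2 + m" using m by auto
  have idx: "z (2 * l) = z (m - 1)" "z (2 * (l + 1)) = z 1" "z (2 * (2 * l)) = z (m - 2)" "z (2 * 1) = z 2"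
    unfolding i z_period by simp_all
  have neq: "z i \<noteq> z j" if "i < m" "j < m" "i \<noteq> j" for i j using inj_onD[OF inj_z, of i j] that by auto
  have dist: "norm (z i - z j) < 2" for i j using H_dist[OF z_in_H z_in_H, of i j] by simp
  have a: "norm (z (m - 1) - z (m - 2)) = 1" "norm (z (m - 1) - z 0) = 1"
  proof -
    have "Suc (m - 2) = m - 1" "Suc (m - 1) = m" using m5 by auto
    then show "norm (z (m - 1) - z (m - 2)) = 1" "norm (z (m - 1) - z 0) = 1"
      using norm_edge[of "m - 2"] norm_edge[of "m - 1"] z_m by (simp_all add: norm_minus_commute)
  qed
  have b: "norm (z 1 - z 2) = 1" "norm (z 1 - z 0) = 1"
    using norm_edge[of 1] norm_edge[of 0] by (simp_all add: norm_minus_commute numeral_2_eq_2)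
  have ne: "z (m - 2) \<noteq> z 0" "z 2 \<noteq> z 0" using neq[of "m - 2" 0] neq[of 2 0] m5 by auto
  obtain \<epsilon>a Ga where Ga: "\<epsilon>a > 0" "continuous_on (ball (z 0) \<epsilon>a) Ga" "Ga (z 0) = z (m - 1)"
    "\<And>s. s \<in> ball (z 0) \<epsilon>a \<Longrightarrow> norm (Ga s - z (m - 2)) = 1 \<and> norm (Ga s - s) = 1"
    "\<And>s w. s \<in> ball (z 0) \<epsilon>a \<Longrightarrow> w \<in> ball (z (m - 1)) \<epsilon>a \<Longrightarrow> norm (w - z (m - 2)) = 1 \<Longrightarrow> norm (w - s) = 1 \<Longrightarrow> w = Ga s"
    by (rule unit_circles_branch[OF a ne(1) dist], rule that, assumption+)
  obtain \<epsilon>b Gb where Gb: "\<epsilon>b > 0" "continuous_on (ball (z 0) \<epsilon>b) Gb" "Gb (z 0) = z 1"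
    "\<And>s. s \<in> ball (z 0) \<epsilon>b \<Longrightarrow> norm (Gb s - z 2) = 1 \<and> norm (Gb s - s) = 1"
    "\<And>s w. s \<in> ball (z 0) \<epsilon>b \<Longrightarrow> w \<in> ball (z 1) \<epsilon>b \<Longrightarrow> norm (w - z 2) = 1 \<Longrightarrow> norm (w - s) = 1 \<Longrightarrow> w = Gb s"
    by (rule unit_circles_branch[OF b ne(2) dist], rule that, assumption+)
  define \<epsilon> where "\<epsilon> = min \<eta> (min \<epsilon>a \<epsilon>b)"
  have \<epsilon>: "\<epsilon> > 0" "\<epsilon> \<le> \<eta>" "\<epsilon> \<le> \<epsilon>a" "\<epsilon> \<le> \<epsilon>b" using \<open>\<eta> > 0\<close> Ga(1) Gb(1) by (auto simp: \<epsilon>_def)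
  obtain \<theta>' z' where S: "star_polygon m \<theta>' z'" and near: "\<And>j. norm (z' j - z j) < \<epsilon>"
    and fixed: "\<And>j. 2 \<le> j \<Longrightarrow> j \<le> m - 2 \<Longrightarrow> z' j = z j" and less: "star_sum m z' < star_sum m z"
    using perturb_vertex[OF m5 \<epsilon>(1)] by blast
  interpret S: star_polygon m \<theta>' z' by (rule S)
  define t where "t = norm (z' 0 - z 0)"
  \<comment> \<open>For \<open>t = 0\<close> any unit vector will do, and 1 is taken.\<close>
  define v where "v = (if z' 0 = z 0 then 1 else (z' 0 - z 0) /\<^sub>R t)"
  have v: "norm v = 1" "z 0 + t *\<^sub>R v = z' 0" by (auto simp: v_def t_def)
  have t: "0 \<le> t" "t < \<epsilon>" using near[of 0] by (simp_all add: t_def)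
  have seg: "closed_segment 0 t = {0..t}" using t by (simp add: closed_segment_eq_real_ivl)
  have inb: "z 0 + s *\<^sub>R v \<in> ball (z 0) \<epsilon>a" "z 0 + s *\<^sub>R v \<in> ball (z 0) \<epsilon>b" if "s \<in> {0..t}" for s
    using that t v(1) \<epsilon> by (auto simp: dist_norm)
  define ga gb where "ga s = Ga (z 0 + s *\<^sub>R v)" and "gb s = Gb (z 0 + s *\<^sub>R v)" for s
  \<comment> \<open>The perturbed vertex lies on both circles and near the old one, so it is on the
    selected branch.\<close>
  have z'a: "z' (m - 1) = ga t"
    unfolding ga_def v(2)
  proof (rule Ga(5))
    show "z' 0 \<in> ball (z 0) \<epsilon>a" "z' (m - 1) \<in> ball (z (m - 1)) \<epsilon>a"
      using near[of 0] near[of "m - 1"] \<epsilon> by (auto simp: dist_norm norm_minus_commute)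
    have "Suc (m - 2) = m - 1" "Suc (m - 1) = m" using m5 by auto
    then show "norm (z' (m - 1) - z (m - 2)) = 1" "norm (z' (m - 1) - z' 0) = 1"
      using S.norm_edge[of "m - 2"] S.norm_edge[of "m - 1"] S.z_m fixed[of "m - 2"] m5
      by (simp_all add: norm_minus_commute)
  qed
  have z'b: "z' 1 = gb t"
    unfolding gb_def v(2)
  proof (rule Gb(5))
    show "z' 0 \<in> ball (z 0) \<epsilon>b" "z' 1 \<in> ball (z 1) \<epsilon>b"
      using near[of 0] near[of 1] \<epsilon> by (auto simp: dist_norm norm_minus_commute)
    show "norm (z' 1 - z 2) = 1" "norm (z' 1 - z' 0) = 1"
      using S.norm_edge[of 1] S.norm_edge[of 0] fixed[of 2] m5 by (simp_all add: norm_minus_commute numeral_2_eq_2)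
  qed
  define y where "y = (\<lambda>i. z (2 * i))(0 := z (2 * 0) + t *\<^sub>R v, l := ga t, l + 1 := gb t)"
  have y: "y i = z' (2 * i)" if "i < m" for i
  proof -
    consider "i = 0" | "i = l" | "i = l + 1" | "1 \<le> i" "i < l" | "l + 1 < i" by linarith
    then show ?thesis
    proof cases
      case 1
      then show ?thesis using v(2) m by (simp add: y_def)
    next
      case 2
      then show ?thesis using z'a m by (simp add: y_def)
    next
      case 3
      then have "2 * i = 1 + m" using m by simp
      then have "z' (2 * i) = z' 1" by (simp only: S.z_period)
      then show ?thesis using z'b 3 by (simp add: y_def)
    next
      case 4
      then show ?thesis using fixed[of "2 * i"] m by (simp add: y_def)
    next
      case 5
      then have e: "2 * i = (2 * i - m) + m" using m by simp
      have "z' (2 * i) = z' (2 * i - m)" "z (2 * i) = z (2 * i - m)"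
        by (subst e, rule S.z_period, subst e, rule z_period)
      moreover have "z' (2 * i - m) = z (2 * i - m)" using 5 that m by (intro fixed) auto
      ultimately show ?thesis using 5 m by (simp add: y_def)
    qed
  qed
  have "vertex_perturbation l (\<lambda>i. z (2 * i)) v t y"
    unfolding vertex_perturbation_def seg
  proof (intro exI conjI ballI)
    have "continuous_on {0..t} (\<lambda>s. z 0 + s *\<^sub>R v)" by (intro continuous_intros)
    then show "continuous_on {0..t} ga" "continuous_on {0..t} gb"
      unfolding ga_def gb_def using inb
      by (auto intro!: continuous_on_compose2[OF Ga(2)] continuous_on_compose2[OF Gb(2)])
    show "ga 0 = z (2 * l)" "gb 0 = z (2 * (l + 1))" by (simp_all only: ga_def gb_def idx) (simp_all add: Ga(3) Gb(3))
    fix s assume s: "s \<in> {0..t}"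
    show "ga s \<in> sphere (z (2 * 0) + s *\<^sub>R v) 1 \<inter> sphere (z (2 * (2 * l))) 1"
      unfolding ga_def idx using Ga(4)[OF inb(1)[OF s]] by (simp add: dist_norm norm_minus_commute)
    show "gb s \<in> sphere (z (2 * 0) + s *\<^sub>R v) 1 \<inter> sphere (z (2 * 1)) 1"
      unfolding gb_def idx using Gb(4)[OF inb(2)[OF s]] by (simp add: dist_norm norm_minus_commute)
  qed (simp add: y_def)
  moreover have "y ` {..<m} = z' ` {..<m}"
    using y S.z_even_image by (metis (no_types, lifting) image_cong lessThan_iff)
  moreover have "\<forall>j. norm (z' j - z j) < \<eta>" using near \<epsilon>(2) by (meson order_less_le_trans)
  moreover have "\<bar>t\<bar> < \<eta>" using t \<epsilon> by simp
  ultimately show ?thesis using S less v(1) by blast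
qed

lemma not_local_area_minimizer:
  assumes "m \<ge> 5"
  shows "\<not> local_area_minimizer body"
proof
  assume "local_area_minimizer body"
  then obtain \<epsilon> where \<epsilon>: "\<epsilon> > 0" and min: "\<And>S \<phi>. reuleaux_polygon S \<Longrightarrow> sides S = sides body \<Longrightarrow>
      bij_betw \<phi> (vertices body) (vertices S) \<Longrightarrow> (\<And>p. p \<in> vertices body \<Longrightarrow> dist (\<phi> p) p < \<epsilon>) \<Longrightarrow> area body \<le> area S"
    unfolding local_area_minimizer_def by blast
  obtain \<theta>' z' where S: "star_polygon m \<theta>' z'" and near: "\<And>j. norm (z' j - z j) < \<epsilon>"
    and less: "star_sum m z' < star_sum m z"
    using perturb_vertex[OF assms \<epsilon>] by blast
  interpret S: star_polygon m \<theta>' z' by (rule S)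
  define \<phi> where "\<phi> = z' \<circ> the_inv_into {..<m} z"
  have \<phi>: "\<phi> (z j) = z' j" if "j < m" for j using the_inv_into_f_f[OF inj_z, of j] that by (simp add: \<phi>_def)
  have "bij_betw \<phi> (vertices body) (vertices S.body)"
    unfolding vertices_body S.vertices_body \<phi>_def
    by (rule bij_betw_trans[OF bij_betw_the_inv_into]) (use inj_z S.inj_z in \<open>auto simp: bij_betw_def\<close>)
  moreover have "dist (\<phi> p) p < \<epsilon>" if "p \<in> vertices body" for p
    using that near \<phi> by (auto simp: vertices_body dist_norm)
  ultimately have "area body \<le> area S.body"
    by (intro min S.reuleaux_polygon_body) (simp_all add: sides_body S.sides_body)
  then show False using less by (simp add: area_body S.area_body)
qed

end

theorem corollary9:
  fixes n k :: nat
  assumes "n = 2 * k + 1" and "n \<ge> 3"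
  shows "(\<forall>P. regular_reuleaux_polygon n P \<longrightarrow>
            is_arg_max area (\<lambda>K. reuleaux_polygon K \<and> sides K \<le> n) P)
       \<and> (\<forall>T. reuleaux_triangle T \<longrightarrow>
            is_arg_min area (\<lambda>K. reuleaux_polygon K \<and> sides K \<le> n) T)
       \<and> (\<forall>R. reuleaux_polygon R \<and> sides R \<le> n \<and> \<not> reuleaux_triangle R \<longrightarrow>
            \<not> local_area_minimizer R \<and>
            (\<forall>p\<in>vertices R. \<exists>l x.
               sides R = 2 * l + 1 \<and> ccw_labelling R (2 * l + 1) x \<and> x 0 = p \<and>
               (\<forall>\<eta>>0. \<exists>v t y. norm v = 1 \<and> \<bar>t\<bar> < \<eta> \<and> vertex_perturbation l x v t y \<and>
                  (let R' = disk_intersection (y ` {..<2 * l + 1}) in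
                     reuleaux_polygon R' \<and> sides R' = 2 * l + 1 \<and> area R' < area R))))"
proof (intro conjI allI impI ballI)
  fix P assume P: "regular_reuleaux_polygon n P"
  have n: "odd n" "n \<ge> 3" using assms by auto
  obtain \<theta> z where S: "star_polygon n \<theta> z" "P = disk_intersection (z ` {..<n})"
    "star_sum n z = - (real n / 2) * tan (pi / (2 * real n))"
    using regular_reuleaux_polygonE[OF P n] .
  interpret S: star_polygon n \<theta> z by (rule S(1))
  have "area K \<le> area P" if K: "reuleaux_polygon K" "sides K \<le> n" for K
  proof -
    obtain m \<phi> w where T: "star_polygon m \<phi> w" "K = disk_intersection (w ` {..<m})"
      using reuleaux_polygonE[OF K(1)] .
    interpret T: star_polygon m \<phi> w by (rule T(1))
    have "m \<le> n" using K(2) T.sides_body T(2) by simp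
    then show ?thesis using T.star_sum_le[of n] S(3) unfolding S(2) T(2) S.area_body T.area_body by simp
  qed
  then show "is_arg_max area (\<lambda>K. reuleaux_polygon K \<and> sides K \<le> n) P"
    using S.reuleaux_polygon_body S.sides_body unfolding is_arg_max_def S(2) by (auto simp: not_less)
next
  fix T assume T: "reuleaux_triangle T"
  obtain \<theta> z where S: "star_polygon 3 \<theta> z" "T = disk_intersection (z ` {..<3})"
    "star_sum 3 z = - (real 3 / 2) * tan (pi / (2 * real 3))"
    using regular_reuleaux_polygonE[OF T] by auto
  interpret S: star_polygon 3 \<theta> z by (rule S(1))
  \<comment> \<open>With this value the area of the triangle equals the lower bound in
    \<open>area_body_ge\<close>.\<close>
  have "star_sum 3 z = - sqrt 3 / 2"
  proof -
    have "tan (pi / (2 * real 3)) = 1 / sqrt 3" "3 / sqrt 3 = sqrt (3 :: real)"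
      using tan_30 by (simp_all add: real_div_sqrt)
    then show ?thesis unfolding S(3) by simp
  qed
  then have area_T: "area T = (pi - sqrt 3) / 2" unfolding S(2) S.area_body by (simp add: field_simps)
  have "area T \<le> area K" if K: "reuleaux_polygon K" for K
  proof -
    obtain m \<phi> w where W: "star_polygon m \<phi> w" "K = disk_intersection (w ` {..<m})"
      using reuleaux_polygonE[OF K] .
    then show ?thesis using star_polygon.area_body_ge[OF W(1)] area_T by simp
  qed
  then show "is_arg_min area (\<lambda>K. reuleaux_polygon K \<and> sides K \<le> n) T"
    using S.reuleaux_polygon_body S.sides_body assms(2) unfolding is_arg_min_def S(2) by (auto simp: not_less)
next
  fix R assume R: "reuleaux_polygon R \<and> sides R \<le> n \<and> \<not> reuleaux_triangle R"
  \<comment> \<open>Star polygons have an odd number of vertices, at least 3, and those with three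
    are Reuleaux triangles.\<close>
  have m5: "m \<ge> 5" if T: "star_polygon m \<theta> z" "R = disk_intersection (z ` {..<m})" for m \<theta> z
  proof -
    interpret star_polygon m \<theta> z by (rule T(1))
    have "m \<noteq> 3" using reuleaux_triangle_body R T(2) by blast
    moreover have "m \<noteq> 4" using odd_m by auto
    ultimately show ?thesis using m_ge_3 by linarith
  qed
  show "\<not> local_area_minimizer R"
    using R m5 star_polygon.not_local_area_minimizer by (metis reuleaux_polygonE)
  fix p assume "p \<in> vertices R"
  then obtain m \<theta> z where T: "star_polygon m \<theta> z" "R = disk_intersection (z ` {..<m})" "z 0 = p"
    using reuleaux_polygon_vertexE R by metis
  interpret star_polygon m \<theta> z by (rule T(1))
  obtain l where l: "m = 2 * l + 1" using odd_m by (elim oddE)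
  have "l \<ge> 2" using m5[OF T(1,2)] l by simp
  show "\<exists>l x. sides R = 2 * l + 1 \<and> ccw_labelling R (2 * l + 1) x \<and> x 0 = p \<and>
     (\<forall>\<eta>>0. \<exists>v t y. norm v = 1 \<and> \<bar>t\<bar> < \<eta> \<and> vertex_perturbation l x v t y \<and>
        (let R' = disk_intersection (y ` {..<2 * l + 1}) in
           reuleaux_polygon R' \<and> sides R' = 2 * l + 1 \<and> area R' < area R))"
  proof (intro exI[of _ l] exI[of _ "\<lambda>i. z (2 * i)"] conjI allI impI)
    show "sides R = 2 * l + 1" "ccw_labelling R (2 * l + 1) (\<lambda>i. z (2 * i))"
      using sides_body ccw_labelling_body unfolding T(2) l[symmetric] by auto
    show "z (2 * 0) = p" using T(3) by simp
    fix \<eta> :: real assume "\<eta> > 0"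
    then obtain \<theta>' z' v t y where W: "star_polygon m \<theta>' z'" "star_sum m z' < star_sum m z"
      "norm v = 1" "\<bar>t\<bar> < \<eta>" "vertex_perturbation l (\<lambda>i. z (2 * i)) v t y" "y ` {..<m} = z' ` {..<m}"
      using vertex_perturbation_realization[OF l \<open>l \<ge> 2\<close>] by blast
    interpret W: star_polygon m \<theta>' z' by (rule W(1))
    have "reuleaux_polygon W.body" "sides W.body = m" "area W.body < area R"
      using W.reuleaux_polygon_body W.sides_body W(2) unfolding T(2) area_body W.area_body by auto
    then show "\<exists>v t y. norm v = 1 \<and> \<bar>t\<bar> < \<eta> \<and> vertex_perturbation l (\<lambda>i. z (2 * i)) v t y \<and>
        (let R' = disk_intersection (y ` {..<2 * l + 1}) in
           reuleaux_polygon R' \<and> sides R' = 2 * l + 1 \<and> area R' < area R)"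
      unfolding Let_def l[symmetric] using W(3-6) by (intro exI[of _ v] exI[of _ t] exI[of _ y]) simp
  qed
qed

end
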